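(* Let $\zeta_1,\dots,\zeta_L>0$ with $\sum_k\zeta_k=1$ be fixed. Assume the distribution of the attenuation coefficients $d_{k,l,m}$ does not depend on $N$ or $m$ (only on $(k,l)$), and let $N\to\infty$ with $K/N=\beta$ fixed. Then $$\lim_{N\to\infty,\;K/N=\beta} r^{(N)}_{\rm TD}(\{\zeta_k\})=\frac{\tau_d}{\tau_c}\cdot\frac{1}{L\beta}\sum_{k=1}^{L}\zeta_k\,\Psi\big(A^{\rm TD}_k,\beta\big).$$
   Context: System model (uplink multi-cell MIMO). Fix integers $L\ge 1$ (cells), $N$ (antennas per base station, BS) and $K$ (single-antenna user terminals, UTs, per cell); $\mathcal L=\{1,\dots,L\}$, $\mathcal K=\{1,\dots,K\}$. For $k,l\in\mathcal L$, $D_{k,l}$ is a random $K\times K$ diagonal matrix with strictly positive diagonal entries $d_{k,l,1},\dots,d_{k,l,K}$ (attenuation between the UTs of cell $l$ and BS $k$); all $d_{k,l,m}$ are mutually independent and, for fixed $(k,l)$, $d_{k,l,1},\dots,d_{k,l,K}$ are identically distributed. Block fading with coherence $\tau_c$ symbols, $\tau_p\ge K$ pilot and $\tau_d=\tau_c-\tau_p$ data symbols; noise variance $\sigma_w^2>0$. Logarithms are base 2, $|\cdot|$ is the determinant. Definitions: $b_{k,l,m}=\dfrac{\tau_p d_{k,l,m}^2}{\sigma_w^2+\tau_p\sum_{l'=1}^{L}d_{k,l',m}^2}$; $B_{k,l}=\mathrm{diag}(b_{k,l,1},\dots,b_{k,l,K})$; $M$ is an $N\times K$ matrix with i.i.d.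 zero-mean unit-variance proper complex Gaussian entries independent of all $D_{k,l}$; $\Phi^{\rm TD}_k(\zeta_k)=\dfrac{1}{\mathrm{Tr}((I_K-B_{k,k})D_{k,k}^2)+\zeta_k\sigma_w^2}B_{k,k}D_{k,k}^2$; and $r^{(N)}_{\rm TD}(\{\zeta_k\})=\frac{\tau_d}{\tau_c}\frac{1}{LK}\sum_{k=1}^{L}\zeta_k\mathbb E\{\log|I_N+M\Phi^{\rm TD}_k(\zeta_k)M^H|\}$ (the achievable average ergodic rate when the data phase is time-divided between cells, cell $k$ using a fraction $\zeta_k$ with transmit power $1/\zeta_k$). Random variable: $A^{\rm TD}_k=\dfrac{b_{k,k,1}d_{k,k,1}^2}{\beta\,\mathbb E\{(1-b_{k,k,1})d_{k,k,1}^2\}}$. For a nonnegative real random variable $A$ and $\beta>0$, $\Psi(A,\beta)=\beta\,\mathbb E\{\log(1+\eta A)\}-\log\eta+(\eta-1)\log e$, where $\eta\in(0,1]$ is the solution of $\beta=\dfrac{1-\eta}{1-\mathbb E\{1/(1+\eta A)\}}$. *)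

theory Defs
  imports "HOL-Probability.Probability" "Jordan_Normal_Form.Determinant"
begin

text \<open>Indexing convention (0-based): cells k, l range over {..<L}, users m over {..<K}
  (user m here is user m+1 of the paper), antenna i over {..<N}.
  The random attenuations are d k l m, the Gaussian matrix entries are G i j, all living on
  one probability space P; for a given N (and K) the relevant objects are the
  entries with m < K, i < N, j < K.\<close>

definition std_cgauss_density :: "complex \<Rightarrow> ennreal" where
  "std_cgauss_density z = ennreal (exp (- (cmod z)\<^sup>2) / pi)"

definition bcoef :: "real \<Rightarrow> real \<Rightarrow> nat \<Rightarrow> (nat \<Rightarrow> nat \<Rightarrow> nat \<Rightarrow> 'a \<Rightarrow> real)
    \<Rightarrow> nat \<Rightarrow> nat \<Rightarrow> nat \<Rightarrow> 'a \<Rightarrow> real" where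
  "bcoef tau_p sigma2 L d k l m \<omega> =
     tau_p * (d k l m \<omega>)\<^sup>2 / (sigma2 + tau_p * (\<Sum>l'<L. (d k l' m \<omega>)\<^sup>2))"

definition Mmat :: "nat \<Rightarrow> nat \<Rightarrow> (nat \<Rightarrow> nat \<Rightarrow> 'a \<Rightarrow> complex) \<Rightarrow> 'a \<Rightarrow> complex mat" where
  "Mmat N K G \<omega> = mat N K (\<lambda>(i, j). G i j \<omega>)"

definition MmatH :: "nat \<Rightarrow> nat \<Rightarrow> (nat \<Rightarrow> nat \<Rightarrow> 'a \<Rightarrow> complex) \<Rightarrow> 'a \<Rightarrow> complex mat" where
  "MmatH N K G \<omega> = mat K N (\<lambda>(i, j). cnj (G j i \<omega>))"

text \<open>Phi^TD_k(zeta_k), a K x K diagonal matrix; the trace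
  Tr((I_K - B_{k,k}) D_{k,k}^2) is written out as a sum.\<close>
definition PhiTD :: "real \<Rightarrow> real \<Rightarrow> nat \<Rightarrow> nat \<Rightarrow> (nat \<Rightarrow> nat \<Rightarrow> nat \<Rightarrow> 'a \<Rightarrow> real)
    \<Rightarrow> nat \<Rightarrow> real \<Rightarrow> 'a \<Rightarrow> complex mat" where
  "PhiTD tau_p sigma2 L K d k zeta \<omega> =
     (let tr = (\<Sum>m<K. (1 - bcoef tau_p sigma2 L d k k m \<omega>) * (d k k m \<omega>)\<^sup>2)
      in mat K K (\<lambda>(i, j). if i = j then
            complex_of_real (bcoef tau_p sigma2 L d k k i \<omega> * (d k k i \<omega>)\<^sup>2
                              / (tr + zeta * sigma2))
          else 0))"

text \<open>r^{(N)}_TD({zeta_k}) (logarithms base 2; the determinant is real and positive,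
  we take its real part).\<close>
definition rTD :: "'a measure \<Rightarrow> real \<Rightarrow> real \<Rightarrow> real \<Rightarrow> real \<Rightarrow> nat \<Rightarrow>
    (nat \<Rightarrow> nat \<Rightarrow> nat \<Rightarrow> 'a \<Rightarrow> real) \<Rightarrow> (nat \<Rightarrow> nat \<Rightarrow> 'a \<Rightarrow> complex) \<Rightarrow>
    (nat \<Rightarrow> real) \<Rightarrow> nat \<Rightarrow> nat \<Rightarrow> real" where
  "rTD P tau_c tau_p tau_d sigma2 L d G zeta N K =
     tau_d / tau_c * (1 / (real L * real K)) *
       (\<Sum>k<L. zeta k * (\<integral>\<omega>. log 2 (Re (det (1\<^sub>m N +
            Mmat N K G \<omega> * PhiTD tau_p sigma2 L K d k (zeta k) \<omega> * MmatH N K G \<omega>))) \<partial>P))"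

definition ATD :: "'a measure \<Rightarrow> real \<Rightarrow> real \<Rightarrow> nat \<Rightarrow> (nat \<Rightarrow> nat \<Rightarrow> nat \<Rightarrow> 'a \<Rightarrow> real)
    \<Rightarrow> real \<Rightarrow> nat \<Rightarrow> 'a \<Rightarrow> real" where
  "ATD P tau_p sigma2 L d beta k \<omega> =
     bcoef tau_p sigma2 L d k k 0 \<omega> * (d k k 0 \<omega>)\<^sup>2 /
       (beta * (\<integral>\<omega>'. (1 - bcoef tau_p sigma2 L d k k 0 \<omega>') * (d k k 0 \<omega>')\<^sup>2 \<partial>P))"

definition eta_of :: "'a measure \<Rightarrow> ('a \<Rightarrow> real) \<Rightarrow> real \<Rightarrow> real" where
  "eta_of P A beta = (THE eta. 0 < eta \<and> eta \<le> 1 \<and>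
      beta = (1 - eta) / (1 - (\<integral>\<omega>. 1 / (1 + eta * A \<omega>) \<partial>P)))"

definition Psi :: "'a measure \<Rightarrow> ('a \<Rightarrow> real) \<Rightarrow> real \<Rightarrow> real" where
  "Psi P A beta = (let eta = eta_of P A beta in
     beta * (\<integral>\<omega>. log 2 (1 + eta * A \<omega>) \<partial>P) - log 2 eta + (eta - 1) * log 2 (exp 1))"

definition ratio_filter :: "real \<Rightarrow> nat filter" where
  "ratio_filter beta = inf at_top (principal {N. \<exists>K::nat. real K = beta * real N})"

text \<open>Joint family of all random variables (reals embedded into complex) for the
  mutual independence hypothesis.\<close>
definition all_vars :: "(nat \<Rightarrow> nat \<Rightarrow> nat \<Rightarrow> 'a \<Rightarrow> real) \<Rightarrow> (nat \<Rightarrow> nat \<Rightarrow> 'a \<Rightarrow> complex)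
    \<Rightarrow> (nat \<times> nat \<times> nat) + (nat \<times> nat) \<Rightarrow> 'a \<Rightarrow> complex" where
  "all_vars d G x = (case x of Inl (k, l, m) \<Rightarrow> (\<lambda>\<omega>. complex_of_real (d k l m \<omega>))
                             | Inr (i, j) \<Rightarrow> G i j)"

end

theory Submission
  imports Defs "HOL-Real_Asymp.Real_Asymp"
begin

text \<open>Write \<open>B = I + (\<Sum>j. w j * x j * (x j)\<^sup>H)\<close> for deterministic weights \<open>w j \<ge> 0\<close> and independent standard
  complex Gaussian columns \<open>x j\<close> in dimension \<open>N\<close>. By Jensen's inequality
  \<open>- ln (E (1 / det B)) \<le> E (ln (det B)) \<le> ln (E (det B))\<close>, and both outer terms are \<open>N * \<Psi> + o(N)\<close>.
  Indeed, adding the columns one at a time gives, for all \<open>y > 0\<close>,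
  \<open>E (det B) \<le> N! * y powr (- N) * exp y * (\<Prod>j. 1 + w j * y)\<close>. On the other hand
  \<open>1 / det B\<close> is the expectation of \<open>exp (- z\<^sup>H (B - I) z)\<close> over a standard Gaussian vector \<open>z\<close>, whence
  \<open>E (1 / det B) = E (\<Prod>j. 1 / (1 + w j * \<rho>))\<close> with \<open>\<rho> = |z|\<^sup>2\<close> Erlang distributed; here
  \<open>1 / (1 + w * \<rho>) \<le> 1 / (1 + w * y) * (\<rho> / y) powr (- w * y / (1 + w * y))\<close>, with equality at \<open>\<rho> = y\<close>.
  For \<open>y = N * \<eta>\<close> the two bounds agree to leading order exactly when \<open>\<eta>\<close> solves the fixed point equation,
  because \<open>\<Psi>\<close> is the minimum over \<open>\<eta>\<close> of a function that is convex in \<open>ln \<eta>\<close>.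
  The random weights are handled by conditioning on the attenuations, the law of large numbers, and an
  exponential lower tail bound for the trace in their denominator.\<close>


section \<open>Rank-one updates of determinants\<close>


text \<open>Jensen is applied conditionally on the attenuations. Averaging \<open>det B\<close> over
  the weights too would bring in their large deviations, and that mean may be infinite, since of the
  numerators only the logarithm is assumed integrable.

  The two bounds meet for the following reason. The product of the tangents turns
  \<open>E (1 / det B)\<close> into the mean of \<rho> to the power -S, where S is the sum of the
  slopes \<open>w * y / (1 + w * y)\<close>. That mean is dominated by \<rho> near N - S, whereas
  the tangents touch at N\<eta>. The two points agree when S = N (1 - \<eta>), and the law of large
  numbers for S makes this the fixed point equation.

  The obstacle is the trace, which all weights share. If it is small, all K weights are large at
  once. The noise term caps the resulting loss at K times O(ln N), so the upper bound requires a
  probability of o(1 / ln N) for a small trace; a law of large numbers without rate would not give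
  this. In the lower bound the integrand is nonnegative, bad attenuations can be discarded, and weak
  laws suffice.\<close>

lemma mat_delete_mat:
  assumes "k < n" "l < n"
  shows "mat_delete (mat n n (\<lambda>(i, j). f i j)) k l =
    mat (n - 1) (n - 1) (\<lambda>(i, j). f (insert_index k i) (insert_index l j))"
  using assms by (intro eq_matI) (auto simp: mat_delete_def insert_index_def)

lemma insert_index_neq [simp]: "insert_index k i \<noteq> k"
  by (simp add: insert_index_def)

lemma det_mat_row_add:
  fixes c u :: "nat \<Rightarrow> nat \<Rightarrow> 'a :: comm_ring_1"
  assumes "k < n"
  shows "det (mat n n (\<lambda>(i, j). if i = k then a j + t * b j else c i j)) =
    det (mat n n (\<lambda>(i, j). if i = k then a j else c i j)) +
    t * det (mat n n (\<lambda>(i, j). if i = k then b j else c i j))"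
proof -
  let ?M = "mat n n (\<lambda>(i, j). if i = k then a j + t * b j else c i j)"
  let ?A = "mat n n (\<lambda>(i, j). if i = k then a j else c i j)"
  let ?B = "mat n n (\<lambda>(i, j). if i = k then b j else c i j)"
  have cof: "cofactor ?M k j = cofactor ?A k j" "cofactor ?M k j = cofactor ?B k j" if "j < n" for j
    using assms that by (simp_all add: cofactor_def mat_delete_mat)
  have "det ?M = (\<Sum>j<n. ?M $$ (k, j) * cofactor ?M k j)"
    by (rule laplace_expansion_row) (use assms in auto)
  also have "\<dots> = (\<Sum>j<n. a j * cofactor ?M k j) + t * (\<Sum>j<n. b j * cofactor ?M k j)"
    using assms by (simp add: algebra_simps sum.distrib sum_distrib_left)
  also have "(\<Sum>j<n. a j * cofactor ?M k j) = (\<Sum>j<n. ?A $$ (k, j) * cofactor ?A k j)"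
    using assms by (intro sum.cong) (simp_all add: cof(1))
  also have "\<dots> = det ?A"
    by (rule laplace_expansion_row[symmetric]) (use assms in auto)
  also have "(\<Sum>j<n. b j * cofactor ?M k j) = (\<Sum>j<n. ?B $$ (k, j) * cofactor ?B k j)"
    using assms by (intro sum.cong) (simp_all add: cof(2)[symmetric])
  also have "\<dots> = det ?B"
    by (rule laplace_expansion_row[symmetric]) (use assms in auto)
  finally show ?thesis .
qed

text \<open>Multilinearity inserts the update one row at a time. The expansion stops at first order:
  once two rows have been replaced by \<open>v\<close>, the determinant has equal rows. The cut-off
  \<open>i < k\<close> lets the induction hypothesis apply both to \<open>B\<close> and to
  \<open>B\<close> with row k already overwritten.\<close>

lemma det_mat_rank_one_aux:
  fixes B :: "nat \<Rightarrow> nat \<Rightarrow> 'a :: comm_ring_1"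
  assumes "k \<le> n"
  shows "det (mat n n (\<lambda>(i, j). B i j + (if i < k then x i * v j else 0))) =
    det (mat n n (\<lambda>(i, j). B i j)) +
    (\<Sum>a<k. x a * det (mat n n (\<lambda>(i, j). if i = a then v j else B i j)))"
  using assms
proof (induction k arbitrary: B)
  case 0
  then show ?case by simp
next
  case (Suc k)
  let ?B = "\<lambda>i j. if i = k then v j else B i j"
  let ?C = "\<lambda>i j. B i j + (if i < k then x i * v j else 0)"
  have "det (mat n n (\<lambda>(i, j). B i j + (if i < Suc k then x i * v j else 0))) =
    det (mat n n (\<lambda>(i, j). if i = k then B k j + x k * v j else ?C i j))"
    by (intro arg_cong[where f=det] cong_mat) (auto simp: less_Suc_eq)
  also have "\<dots> = det (mat n n (\<lambda>(i, j). if i = k then B k j else ?C i j)) +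
    x k * det (mat n n (\<lambda>(i, j). if i = k then v j else ?C i j))"
    by (rule det_mat_row_add) (use Suc.prems in auto)
  also have "det (mat n n (\<lambda>(i, j). if i = k then B k j else ?C i j)) = det (mat n n (\<lambda>(i, j). ?C i j))"
    by (intro arg_cong[where f=det] cong_mat) auto
  also have "det (mat n n (\<lambda>(i, j). if i = k then v j else ?C i j)) =
    det (mat n n (\<lambda>(i, j). ?B i j + (if i < k then x i * v j else 0)))"
    by (intro arg_cong[where f=det] cong_mat) auto
  also have "\<dots> = det (mat n n (\<lambda>(i, j). ?B i j)) +
    (\<Sum>a<k. x a * det (mat n n (\<lambda>(i, j). if i = a then v j else ?B i j)))"
    by (rule Suc.IH) (use Suc.prems in auto)
  also have "(\<Sum>a<k. x a * det (mat n n (\<lambda>(i, j). if i = a then v j else ?B i j))) = 0"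
  proof (intro sum.neutral ballI)
    fix a assume "a \<in> {..<k}"
    then have "det (mat n n (\<lambda>(i, j). if i = a then v j else ?B i j)) = 0"
      using Suc.prems by (intro det_identical_rows[of _ n a k]) (auto simp: row_def)
    then show "x a * det (mat n n (\<lambda>(i, j). if i = a then v j else ?B i j)) = 0"
      by simp
  qed
  finally show ?case using Suc.IH[of B] Suc.prems by (simp add: algebra_simps)
qed

lemma det_mat_rank_one:
  fixes B :: "nat \<Rightarrow> nat \<Rightarrow> 'a :: comm_ring_1"
  shows "det (mat n n (\<lambda>(i, j). B i j + x i * v j)) =
    det (mat n n (\<lambda>(i, j). B i j)) +
    (\<Sum>a<n. x a * det (mat n n (\<lambda>(i, j). if i = a then v j else B i j)))"
proof -
  have "mat n n (\<lambda>(i, j). B i j + x i * v j) = mat n n (\<lambda>(i, j). B i j + (if i < n then x i * v j else 0))"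
    by (intro cong_mat) auto
  then show ?thesis using det_mat_rank_one_aux[of n n B x v] by simp
qed

text \<open>The matrix determinant lemma in cofactor form, which avoids inverting \<open>B\<close>.
  When \<open>x\<close> and \<open>v\<close> come from a new random column, it is a quadratic form
  in that column whose coefficients depend on the earlier columns only.\<close>

lemma det_mat_rank_one_cofactor:
  fixes B :: "nat \<Rightarrow> nat \<Rightarrow> 'a :: comm_ring_1"
  shows "det (mat n n (\<lambda>(i, j). B i j + x i * v j)) =
    det (mat n n (\<lambda>(i, j). B i j)) +
    (\<Sum>a<n. \<Sum>b<n. x a * v b * cofactor (mat n n (\<lambda>(i, j). B i j)) a b)"
proof -
  have "det (mat n n (\<lambda>(i, j). if i = a then v j else B i j)) =
      (\<Sum>b<n. v b * cofactor (mat n n (\<lambda>(i, j). B i j)) a b)" if "a < n" for a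
  proof -
    let ?A = "mat n n (\<lambda>(i, j). if i = a then v j else B i j)"
    have "det ?A = (\<Sum>b<n. ?A $$ (a, b) * cofactor ?A a b)"
      by (rule laplace_expansion_row) (use that in auto)
    also have "\<dots> = (\<Sum>b<n. v b * cofactor (mat n n (\<lambda>(i, j). B i j)) a b)"
    proof (intro sum.cong refl arg_cong2[where f="(*)"])
      fix b assume "b \<in> {..<n}"
      then show "?A $$ (a, b) = v b" using that by simp
      show "cofactor ?A a b = cofactor (mat n n (\<lambda>(i, j). B i j)) a b"
        using that \<open>b \<in> {..<n}\<close> by (simp add: cofactor_def mat_delete_mat)
    qed
    finally show ?thesis .
  qed
  then show ?thesis unfolding det_mat_rank_one by (simp add: sum_distrib_left mult.assoc)
qed

text \<open>Eliminating column n with the pivot row n is itself a rank-one update, with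
  \<open>v\<close> the pivot row; each correction term contains that row twice. Setting
  \<open>x n = 0\<close> keeps the pivot row in place.\<close>

lemma det_mat_schur:
  fixes M :: "nat \<Rightarrow> nat \<Rightarrow> 'a :: field"
  assumes "M n n \<noteq> 0"
  shows "det (mat (Suc n) (Suc n) (\<lambda>(i, j). M i j)) =
    M n n * det (mat n n (\<lambda>(i, j). M i j - M i n * M n j / M n n))"
proof -
  define x where "x i = (if i = n then 0 else - (M i n / M n n))" for i
  let ?C = "mat (Suc n) (Suc n) (\<lambda>(i, j). M i j + x i * M n j)"
  have "(\<Sum>a<Suc n. x a * det (mat (Suc n) (Suc n) (\<lambda>(i, j). if i = a then M n j else M i j))) = 0"
  proof (intro sum.neutral ballI)
    fix a assume a: "a \<in> {..<Suc n}"
    show "x a * det (mat (Suc n) (Suc n) (\<lambda>(i, j). if i = a then M n j else M i j)) = 0"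
    proof (cases "a = n")
      case False
      then have "det (mat (Suc n) (Suc n) (\<lambda>(i, j). if i = a then M n j else M i j)) = 0"
        using a by (intro det_identical_rows[of _ "Suc n" a n]) (auto simp: row_def)
      then show ?thesis by simp
    qed (simp add: x_def)
  qed
  then have "det (mat (Suc n) (Suc n) (\<lambda>(i, j). M i j)) = det ?C"
    unfolding det_mat_rank_one by simp
  also have "\<dots> = (\<Sum>i<Suc n. ?C $$ (i, n) * cofactor ?C i n)"
    by (rule laplace_expansion_column) auto
  also have "\<dots> = ?C $$ (n, n) * cofactor ?C n n"
    using assms by (subst sum.remove[of _ n]) (auto intro!: sum.neutral simp: x_def)
  also have "cofactor ?C n n = det (mat n n (\<lambda>(i, j). M i j - M i n * M n j / M n n))"
    by (auto simp: cofactor_def mat_delete_def x_def intro!: arg_cong[where f=det])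
  finally show ?thesis by (simp add: x_def)
qed


section \<open>The standard complex Gaussian distribution\<close>


abbreviation (input) kdelta :: "nat \<Rightarrow> nat \<Rightarrow> complex" where
  "kdelta i j \<equiv> (if i = j then 1 else 0)"

definition cgauss :: "complex measure" where
  "cgauss = density lborel std_cgauss_density"

lemma measurable_std_cgauss_density [measurable]: "std_cgauss_density \<in> borel_measurable borel"
  unfolding std_cgauss_density_def by measurable

lemma sets_cgauss [simp, measurable_cong]: "sets cgauss = sets borel"
  by (simp add: cgauss_def)

lemma space_cgauss [simp]: "space cgauss = UNIV"
  by (simp add: cgauss_def)

lemma emeasure_lborel_norm_square_le:
  assumes "0 \<le> a"
  shows "emeasure lborel {z::complex. (cmod z)\<^sup>2 \<le> a} = ennreal (pi * a)"
proof -
  have "{z::complex. (cmod z)\<^sup>2 \<le> a} = cball 0 (sqrt a)"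
    using assms by (auto simp: real_le_rsqrt intro: order_trans[OF power_mono[of _ "sqrt a" 2]])
  then show ?thesis using assms by (simp add: emeasure_cball unit_ball_vol_2)
qed

text \<open>Layer-cake: with \<open>exp (- s) = \<integral> t \<ge> s. exp (- t)\<close>, the mass of
  \<open>{z. (cmod z)\<^sup>2 \<ge> a}\<close> is an integral of areas of annuli.\<close>
lemma emeasure_cgauss_tail:
  assumes a: "0 \<le> a"
  shows "emeasure cgauss {z. a < (cmod z)\<^sup>2} = ennreal (exp (- a))"
proof -
  have ex: "ennreal (exp (- s)) = (\<integral>\<^sup>+t. ennreal (exp (- t)) * indicator {s..} t \<partial>lborel)" for s :: real
  proof -
    have "(\<integral>\<^sup>+t. ennreal (exp (- t)) * indicator {s..} t \<partial>lborel) = ennreal (0 - (- exp (- s)))"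
    proof (rule nn_integral_FTC_atLeast)
      show "((\<lambda>x::real. - exp (- x)) \<longlongrightarrow> 0) at_top"
        by real_asymp
    qed (auto intro!: derivative_eq_intros)
    then show ?thesis by simp
  qed
  have "emeasure cgauss {z. a < (cmod z)\<^sup>2} =
      (\<integral>\<^sup>+z. std_cgauss_density z * indicator {z. a < (cmod z)\<^sup>2} z \<partial>lborel)"
    unfolding cgauss_def by (subst emeasure_density) auto
  also have "\<dots> = (\<integral>\<^sup>+z. (\<integral>\<^sup>+t. ennreal (1 / pi) * (ennreal (exp (- t)) * indicator {(cmod z)\<^sup>2..} t *
      indicator {z. a < (cmod z)\<^sup>2} z) \<partial>lborel) \<partial>lborel)"
  proof (intro nn_integral_cong)
    fix z :: complex
    have "std_cgauss_density z = ennreal (1 / pi) * ennreal (exp (- (cmod z)\<^sup>2))"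
      by (simp add: std_cgauss_density_def ennreal_mult'[symmetric])
    moreover have "(\<integral>\<^sup>+t. ennreal (1 / pi) * (ennreal (exp (- t)) * indicator {(cmod z)\<^sup>2..} t *
        indicator {z. a < (cmod z)\<^sup>2} z) \<partial>lborel) =
      ennreal (1 / pi) * ((\<integral>\<^sup>+t. ennreal (exp (- t)) * indicator {(cmod z)\<^sup>2..} t \<partial>lborel) *
        indicator {z. a < (cmod z)\<^sup>2} z)"
      by (subst nn_integral_cmult, measurable, subst nn_integral_multc, measurable)
    ultimately show "std_cgauss_density z * indicator {z. a < (cmod z)\<^sup>2} z =
      (\<integral>\<^sup>+t. ennreal (1 / pi) * (ennreal (exp (- t)) * indicator {(cmod z)\<^sup>2..} t *
      indicator {z. a < (cmod z)\<^sup>2} z) \<partial>lborel)"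
      by (simp add: mult.assoc flip: ex)
  qed
  also have "\<dots> = (\<integral>\<^sup>+t. (\<integral>\<^sup>+z. ennreal (1 / pi) * (ennreal (exp (- t)) * indicator {(cmod z)\<^sup>2..} t *
      indicator {z. a < (cmod z)\<^sup>2} z) \<partial>lborel) \<partial>lborel)"
    by (rule lborel_pair.Fubini') (simp only: indicator_def atLeast_iff mem_Collect_eq split_beta', measurable)
  also have "\<dots> = (\<integral>\<^sup>+t. ennreal ((t - a) * exp (- t)) * indicator {a..} t \<partial>lborel)"
  proof (intro nn_integral_cong)
    fix t :: real
    have "(\<integral>\<^sup>+z. ennreal (1 / pi) * (ennreal (exp (- t)) * indicator {(cmod z)\<^sup>2..} t *
      indicator {z. a < (cmod z)\<^sup>2} z) \<partial>lborel) =
      (\<integral>\<^sup>+z. ennreal (exp (- t) / pi) * indicator {z. a < (cmod z)\<^sup>2 \<and> (cmod z)\<^sup>2 \<le> t} z \<partial>lborel)"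
      by (intro nn_integral_cong) (auto simp: indicator_def ennreal_mult'[symmetric])
    also have "\<dots> = ennreal (exp (- t) / pi) * emeasure lborel {z::complex. a < (cmod z)\<^sup>2 \<and> (cmod z)\<^sup>2 \<le> t}"
      by (subst nn_integral_cmult_indicator) auto
    also have "\<dots> = ennreal ((t - a) * exp (- t)) * indicator {a..} t"
    proof (cases "a \<le> t")
      case True
      have "{z::complex. a < (cmod z)\<^sup>2 \<and> (cmod z)\<^sup>2 \<le> t} =
          {z. (cmod z)\<^sup>2 \<le> t} - {z. (cmod z)\<^sup>2 \<le> a}" by auto
      also have "emeasure lborel \<dots> = emeasure lborel {z::complex. (cmod z)\<^sup>2 \<le> t} - emeasure lborel {z::complex. (cmod z)\<^sup>2 \<le> a}"
        by (rule emeasure_Diff) (use a True in \<open>auto simp: emeasure_lborel_norm_square_le\<close>)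
      also have "\<dots> = ennreal (pi * (t - a))"
        using a True by (simp add: emeasure_lborel_norm_square_le ennreal_minus algebra_simps)
      finally show ?thesis using True by (simp add: ennreal_mult'[symmetric] field_simps)
    next
      case False
      then have "{z::complex. a < (cmod z)\<^sup>2 \<and> (cmod z)\<^sup>2 \<le> t} = {}" by auto
      then show ?thesis using False by (simp only: emeasure_empty) simp
    qed
    finally show "(\<integral>\<^sup>+z. ennreal (1 / pi) * (ennreal (exp (- t)) * indicator {(cmod z)\<^sup>2..} t *
      indicator {z. a < (cmod z)\<^sup>2} z) \<partial>lborel) = ennreal ((t - a) * exp (- t)) * indicator {a..} t" .
  qed
  also have "\<dots> = ennreal (0 - (- (a - a + 1) * exp (- a)))"
  proof (rule nn_integral_FTC_atLeast[where F = "\<lambda>t. - (t - a + 1) * exp (- t)"])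
    show "((\<lambda>t::real. - (t - a + 1) * exp (- t)) \<longlongrightarrow> 0) at_top"
      by real_asymp
  qed (auto intro!: derivative_eq_intros simp: algebra_simps)
  finally show ?thesis by simp
qed

text \<open>The total mass is the tail at 0, the origin being a null set. The normalising constant 1
  / pi thus comes from areas of discs, without polar coordinates.\<close>

lemma prob_space_cgauss: "prob_space cgauss"
proof
  have "AE z in cgauss. 0 < (cmod z)\<^sup>2"
    unfolding cgauss_def by (subst AE_density) (auto intro: AE_mp[OF AE_lborel_singleton[of 0]])
  then have "emeasure cgauss (space cgauss) = emeasure cgauss {z. 0 < (cmod z)\<^sup>2}"
    by (intro emeasure_eq_AE) auto
  then show "emeasure cgauss (space cgauss) = 1"
    using emeasure_cgauss_tail[of 0] by simp
qed

interpretation cgauss: prob_space cgauss by (rule prob_space_cgauss)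

lemma cgauss_norm_square_exponential:
  "distributed cgauss lborel (\<lambda>z. (cmod z)\<^sup>2) (exponential_density 1)"
proof (rule exponential_distributedI)
  show "(\<lambda>z. (cmod z)\<^sup>2) \<in> borel_measurable cgauss" by measurable
  show "0 < (1::real)" by simp
  fix a :: real assume a: "0 \<le> a"
  have "{z. (cmod z)\<^sup>2 \<le> a} = space cgauss - {z. a < (cmod z)\<^sup>2}" by auto
  then have "emeasure cgauss {z. (cmod z)\<^sup>2 \<le> a} = emeasure cgauss (space cgauss - {z. a < (cmod z)\<^sup>2})"
    by simp
  also have "\<dots> = 1 - emeasure cgauss {z. a < (cmod z)\<^sup>2}"
    by (subst emeasure_compl) (use cgauss.emeasure_space_1 in auto)
  also have "\<dots> = 1 - ennreal (exp (- a))"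
    using a by (simp add: emeasure_cgauss_tail)
  finally show "emeasure cgauss {x \<in> space cgauss. (cmod x)\<^sup>2 \<le> a} = 1 - ennreal (exp (- a * 1))"
    by simp
qed

lemma integrable_cgauss_norm_square: "integrable cgauss (\<lambda>z. (cmod z)\<^sup>2)"
  and integral_cgauss_norm_square: "(\<integral>z. (cmod z)\<^sup>2 \<partial>cgauss) = 1"
  using cgauss.erlang_ith_moment_integrable[OF _ cgauss_norm_square_exponential, of 1]
    cgauss.exponential_distributed_expectation[OF _ cgauss_norm_square_exponential] by auto

lemma integrable_cgauss_id: "integrable cgauss (\<lambda>z. z)"
proof (rule Bochner_Integration.integrable_bound[of _ "\<lambda>z. 1 + (cmod z)\<^sup>2"])
  have "cmod z \<le> 1 + (cmod z)\<^sup>2" for z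
  proof -
    have "0 \<le> (cmod z - 1)\<^sup>2" by simp
    then show ?thesis using norm_ge_zero[of z] by (simp add: power2_eq_square algebra_simps del: norm_ge_zero)
  qed
  then show "AE z in cgauss. norm z \<le> norm (1 + (cmod z)\<^sup>2)"
    by (intro AE_I2) (metis abs_ge_self order_trans real_norm_def)
qed (auto intro: integrable_cgauss_norm_square)

text \<open>Evenness of the density, from which the mean vanishes.\<close>

lemma distr_cgauss_uminus: "distr cgauss borel uminus = cgauss"
proof -
  have "cgauss = density (density (distr lborel borel (\<lambda>x. 0 + (-1) *\<^sub>R x)) (\<lambda>_. ennreal (\<bar>- 1\<bar> ^ DIM(complex)))) std_cgauss_density"
    unfolding cgauss_def by (subst lborel_affine[of "-1" "0::complex", symmetric]) auto
  also have "\<dots> = density (distr lborel borel uminus) std_cgauss_density"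
    by (simp add: density_1)
  also have "\<dots> = distr (density lborel (\<lambda>x. std_cgauss_density (- x))) borel uminus"
    by (subst density_distr) auto
  also have "\<dots> = distr cgauss borel uminus"
    by (simp add: cgauss_def std_cgauss_density_def[abs_def])
  finally show ?thesis ..
qed

lemma integral_cgauss_id: "(\<integral>z. z \<partial>cgauss) = 0"
proof -
  have "(\<integral>z. z \<partial>cgauss) = (\<integral>z. z \<partial>distr cgauss borel uminus)"
    by (simp add: distr_cgauss_uminus)
  also have "\<dots> = (\<integral>z. - z \<partial>cgauss)"
    by (subst integral_distr) auto
  finally show ?thesis by simp
qed

text \<open>Completing the square: with b = 1 + h, the substitution z = - c / b + u / sqrt b turns
  the exponent into the standard one plus the constant |c|^2 / b. The Jacobian is 1 / b because the
  plane has real dimension two. This is one step of Gaussian elimination under the integral.\<close>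

lemma nn_integral_cgauss_quadratic:
  assumes b: "0 < 1 + h"
  shows "(\<integral>\<^sup>+z. ennreal (exp (- (h * (cmod z)\<^sup>2 + 2 * Re (cnj z * c)))) \<partial>cgauss) =
    ennreal (exp ((cmod c)\<^sup>2 / (1 + h)) / (1 + h))"
proof -
  define b where "b = 1 + h"
  have b0: "0 < b" using b by (simp add: b_def)
  define t where "t = - c /\<^sub>R b"
  have eq: "b * (cmod (t + (1 / sqrt b) *\<^sub>R u))\<^sup>2 + 2 * Re (cnj (t + (1 / sqrt b) *\<^sub>R u) * c) = (cmod u)\<^sup>2 - (cmod c)\<^sup>2 / b" for u
  proof -
    define s where "s = 1 / sqrt b"
    have s2: "b * s\<^sup>2 = 1" using b0 by (simp add: s_def power_divide)
    have t: "Re t = - Re c / b" "Im t = - Im c / b" by (simp_all add: t_def divide_inverse)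
    have *: "b * (- x / b + s * y)\<^sup>2 + 2 * ((- x / b + s * y) * x) = y\<^sup>2 - x\<^sup>2 / b" for x y
    proof -
      have "b * (- x / b + s * y)\<^sup>2 + 2 * ((- x / b + s * y) * x) =
          (b * s\<^sup>2) * y\<^sup>2 - 2 * (b * (x / b)) * s * y + (b * (x / b)) * (x / b) - 2 * x * x / b + 2 * s * y * x"
        by (simp add: power2_eq_square algebra_simps)
      also have "\<dots> = y\<^sup>2 - x\<^sup>2 / b"
        using b0 s2 by (simp add: power2_eq_square)
      finally show ?thesis .
    qed
    show ?thesis
      using *[of "Re c" "Re u"] *[of "Im c" "Im u"]
      by (simp add: cmod_power2 t algebra_simps add_divide_distrib flip: s_def)
  qed
  have "(\<integral>\<^sup>+z. ennreal (exp (- (h * (cmod z)\<^sup>2 + 2 * Re (cnj z * c)))) \<partial>cgauss) =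
    (\<integral>\<^sup>+z. std_cgauss_density z * ennreal (exp (- (h * (cmod z)\<^sup>2 + 2 * Re (cnj z * c)))) \<partial>lborel)"
    unfolding cgauss_def by (rule nn_integral_density) auto
  also have "\<dots> = (\<integral>\<^sup>+z. ennreal (exp (- (b * (cmod z)\<^sup>2 + 2 * Re (cnj z * c))) / pi) \<partial>lborel)"
    by (intro nn_integral_cong)
       (simp add: std_cgauss_density_def b_def ennreal_mult'[symmetric] mult_exp_exp ring_distribs)
  also have "\<dots> = (\<integral>\<^sup>+z. ennreal (exp (- (b * (cmod z)\<^sup>2 + 2 * Re (cnj z * c))) / pi)
      \<partial>density (distr lborel borel (\<lambda>x. t + (1 / sqrt b) *\<^sub>R x)) (\<lambda>_. ennreal (\<bar>1 / sqrt b\<bar> ^ DIM(complex))))"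
    by (subst lborel_affine[of "1 / sqrt b" t]) (use b0 in auto)
  also have "\<dots> = (\<integral>\<^sup>+u. ennreal (1 / b) * ennreal (exp (- ((cmod u)\<^sup>2 - (cmod c)\<^sup>2 / b)) / pi) \<partial>lborel)"
    using b0 by (subst nn_integral_density, simp, simp, subst nn_integral_distr, simp, simp) (simp only: eq, simp add: power_divide)
  also have "\<dots> = (\<integral>\<^sup>+u. ennreal (exp ((cmod c)\<^sup>2 / b) / b) * std_cgauss_density u \<partial>lborel)"
    using b0 by (intro nn_integral_cong)
       (simp add: std_cgauss_density_def ennreal_mult'[symmetric] exp_diff exp_minus divide_inverse mult_ac)
  also have "\<dots> = ennreal (exp ((cmod c)\<^sup>2 / b) / b) * emeasure cgauss (space cgauss)"
    by (simp add: nn_integral_cmult cgauss_def emeasure_density)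
  finally show ?thesis using cgauss.emeasure_space_1 by (simp add: b_def)
qed


section \<open>Gaussian integrals and determinants\<close>


abbreviation gauss_vec :: "nat \<Rightarrow> (nat \<Rightarrow> complex) measure" where
  "gauss_vec n \<equiv> PiM {..<n} (\<lambda>_. cgauss)"

abbreviation gauss_mat :: "nat \<Rightarrow> nat \<Rightarrow> (nat \<Rightarrow> nat \<Rightarrow> complex) measure" where
  "gauss_mat n K \<equiv> PiM {..<K} (\<lambda>_. gauss_vec n)"

lemma prob_space_gauss_vec: "prob_space (gauss_vec n)"
  by (intro prob_space_PiM prob_space_cgauss)

lemma prob_space_gauss_mat: "prob_space (gauss_mat n K)"
  by (intro prob_space_PiM prob_space_gauss_vec)

interpretation gv: product_prob_space "\<lambda>_::nat. cgauss" UNIV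
  by unfold_locales

interpretation gm: product_prob_space "\<lambda>_::nat. gauss_vec n" UNIV for n
  using prob_space_gauss_vec by (simp add: product_prob_space_def product_prob_space_axioms_def
    product_sigma_finite_def prob_space_imp_sigma_finite)

lemma measurable_cnj [measurable]: "cnj \<in> borel_measurable borel"
  by (intro borel_measurable_continuous_onI continuous_intros)

lemma cnj_mult_self: "cnj c * c = of_real ((cmod c)\<^sup>2)"
  by (simp only: complex_norm_square mult.commute)

section \<open>Hermitian forms under Gaussian integrals\<close>

definition qform :: "nat \<Rightarrow> (nat \<Rightarrow> nat \<Rightarrow> complex) \<Rightarrow> (nat \<Rightarrow> complex) \<Rightarrow> complex" where
  "qform n H z = (\<Sum>i<n. \<Sum>j<n. cnj (z i) * H i j * z j)"

lemma qform_cong: "(\<And>i. i < n \<Longrightarrow> z i = z' i) \<Longrightarrow> qform n H z = qform n H z'"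
  unfolding qform_def by (intro sum.cong) auto

lemma measurable_qform [measurable]: "qform n H \<in> borel_measurable (gauss_vec n)"
  unfolding qform_def[abs_def] by measurable

text \<open>Brings the last coordinate into the shape of
  \<open>nn_integral_cgauss_quadratic\<close>. Hermitian symmetry merges the two cross sums into one
  real part and makes \<open>H n n\<close> real.\<close>

lemma qform_Suc:
  assumes "\<And>i. i \<le> n \<Longrightarrow> H i n = cnj (H n i)"
  shows "Re (qform (Suc n) H z) = Re (qform n H z) +
    (Re (H n n) * (cmod (z n))\<^sup>2 + 2 * Re (cnj (z n) * (\<Sum>j<n. H n j * z j)))"
proof -
  let ?c = "\<Sum>j<n. H n j * z j"
  have 1: "(\<Sum>i<n. cnj (z i) * H i n * z n) = cnj (cnj (z n) * ?c)"
    using assms by (simp add: sum_distrib_left sum_distrib_right mult_ac)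
  have 2: "(\<Sum>j<n. cnj (z n) * H n j * z j) = cnj (z n) * ?c"
    by (simp add: sum_distrib_left mult_ac)
  have "H n n = of_real (Re (H n n))"
    using assms[of n] by (metis Reals_cnj_iff complex_is_Real_iff le_refl of_real_Re)
  then have "cnj (z n) * H n n * z n = of_real (Re (H n n)) * (z n * cnj (z n))"
    by (metis mult.commute mult.left_commute)
  then have 3: "cnj (z n) * H n n * z n = of_real (Re (H n n) * (cmod (z n))\<^sup>2)"
    by (simp add: complex_norm_square[symmetric])
  have "qform (Suc n) H z = qform n H z + (\<Sum>i<n. cnj (z i) * H i n * z n) +
    ((\<Sum>j<n. cnj (z n) * H n j * z j) + cnj (z n) * H n n * z n)"
    by (simp add: qform_def sum.distrib)
  also have "\<dots> = qform n H z + cnj (cnj (z n) * ?c) + (cnj (z n) * ?c + of_real (Re (H n n) * (cmod (z n))\<^sup>2))"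
    by (simp only: 1 2 3)
  finally show ?thesis
    by (simp only: plus_complex.sel cnj.sel Re_complex_of_real)
qed

text \<open>Integrating out the last coordinate replaces \<open>1 + H\<close> by its Schur complement.\<close>
lemma gaussian_integral_det:
  assumes herm: "\<And>i j. i < n \<Longrightarrow> j < n \<Longrightarrow> H i j = cnj (H j i)"
    and psd: "\<And>z. 0 \<le> Re (qform n H z)"
  shows "\<exists>D\<ge>1. det (mat n n (\<lambda>(i, j). kdelta i j + H i j)) = of_real D \<and>
    (\<integral>\<^sup>+z. ennreal (exp (- Re (qform n H z))) \<partial>gauss_vec n) = ennreal (1 / D)"
  using assms
proof (induction n arbitrary: H)
  case 0
  have "(\<integral>\<^sup>+z. ennreal (exp (- Re (qform 0 H z))) \<partial>gauss_vec 0) = 1"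
    by (simp add: qform_def PiM_empty nn_integral_count_space_finite)
  then show ?case by (intro exI[of _ 1]) simp
next
  case (Suc n)
  define h where "h = Re (H n n)"
  have Hnn: "H n n = of_real h"
    using Suc.prems(1)[of n n] unfolding h_def
    by (metis Reals_cnj_iff complex_is_Real_iff lessI of_real_Re)
  have q_Suc: "Re (qform (Suc n) H z) = Re (qform n H z) +
    (h * (cmod (z n))\<^sup>2 + 2 * Re (cnj (z n) * (\<Sum>j<n. H n j * z j)))" for z
    unfolding h_def by (rule qform_Suc, rule Suc.prems(1)) auto
  have Hin: "H i n = cnj (H n i)" if "i < n" for i
    using that by (intro Suc.prems(1)) auto
  have h: "0 \<le> h"
    using Suc.prems(2)[of "\<lambda>i. if i = n then 1 else 0"] unfolding q_Suc
    by (simp add: qform_def)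
  define H' where "H' i j = H i j - H i n * H n j / of_real (1 + h)" for i j
  have q_H': "Re (qform n H' z) = Re (qform n H z) - (cmod (\<Sum>j<n. H n j * z j))\<^sup>2 / (1 + h)" for z
  proof -
    let ?c = "\<Sum>j<n. H n j * z j"
    have "qform n H' z = qform n H z - (\<Sum>i<n. \<Sum>j<n. (cnj (z i) * H i n) * (H n j * z j) / of_real (1 + h))"
      by (simp add: qform_def H'_def algebra_simps sum_subtractf)
    also have "(\<Sum>i<n. \<Sum>j<n. (cnj (z i) * H i n) * (H n j * z j) / of_real (1 + h)) =
      (\<Sum>i<n. cnj (z i) * H i n) * ?c / of_real (1 + h)"
      by (simp add: sum_product sum_divide_distrib)
    also have "(\<Sum>i<n. cnj (z i) * H i n) = cnj ?c"
      by (simp add: Hin mult.commute)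
    also have "cnj ?c * ?c / of_real (1 + h) = of_real ((cmod ?c)\<^sup>2 / (1 + h))"
      unfolding cnj_mult_self by simp
    finally show ?thesis by simp
  qed
  have herm': "H' i j = cnj (H' j i)" if "i < n" "j < n" for i j
  proof -
    have "H i j = cnj (H j i)"
      by (rule Suc.prems(1)) (use that in auto)
    then show ?thesis using that by (simp add: H'_def Hin)
  qed
  have psd': "0 \<le> Re (qform n H' z)" for z
  proof -
    let ?c = "\<Sum>j<n. H n j * z j"
    \<comment> \<open>This value of the last coordinate minimises the quadratic of 1 + H. The
      minimiser for H alone would be - c / h, which fails at h = 0; the inequality h / (1 + h)^2
      \<le> 1 / (1 + h) pays for the difference.\<close>
    let ?z = "z(n := - ?c / of_real (1 + h))"
    have c: "(\<Sum>j<n. H n j * ?z j) = ?c" by (intro sum.cong) auto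
    have q: "qform n H ?z = qform n H z" by (intro qform_cong) auto
    have n2: "(cmod (?z n))\<^sup>2 = (cmod ?c)\<^sup>2 / (1 + h)\<^sup>2"
      by (simp only: fun_upd_same norm_divide norm_minus_cancel norm_of_real power_divide power2_abs)
    have r: "Re (cnj (?z n) * ?c) = - ((cmod ?c)\<^sup>2 / (1 + h))"
    proof -
      have "cnj (?z n) * ?c = - (cnj ?c * ?c) / of_real (1 + h)"
        by simp
      also have "\<dots> = - of_real ((cmod ?c)\<^sup>2 / (1 + h))"
        unfolding cnj_mult_self by simp
      finally show ?thesis by (simp only: uminus_complex.sel Re_complex_of_real)
    qed
    have "h / (1 + h)\<^sup>2 \<le> (1 + h) / (1 + h)\<^sup>2"
      by (intro divide_right_mono) auto
    also have "\<dots> = 1 / (1 + h)"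
      using h by (simp add: power2_eq_square)
    finally have "h * ((cmod ?c)\<^sup>2 / (1 + h)\<^sup>2) \<le> (cmod ?c)\<^sup>2 / (1 + h)"
      using mult_right_mono[of "h / (1 + h)\<^sup>2" "1 / (1 + h)" "(cmod ?c)\<^sup>2"] by simp
    moreover have "0 \<le> Re (qform (Suc n) H ?z)" by (rule Suc.prems(2))
    ultimately show ?thesis unfolding q_Suc c q n2 r q_H' by linarith
  qed
  obtain D where D: "D \<ge> 1" "det (mat n n (\<lambda>(i, j). kdelta i j + H' i j)) = of_real D"
    "(\<integral>\<^sup>+z. ennreal (exp (- Re (qform n H' z))) \<partial>gauss_vec n) = ennreal (1 / D)"
    using Suc.IH[of H'] herm' psd' by blast
  have "(1::complex) + of_real h \<noteq> 0"
    using h by (metis add_nonneg_eq_0_iff of_real_1 of_real_add of_real_eq_0_iff zero_le_one zero_neq_one)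
  then have "det (mat (Suc n) (Suc n) (\<lambda>(i, j). kdelta i j + H i j)) =
    of_real (1 + h) * det (mat n n (\<lambda>(i, j). kdelta i j + H i j - (kdelta i n + H i n) * (kdelta n j + H n j) / of_real (1 + h)))"
    by (subst det_mat_schur) (simp_all add: Hnn)
  also have "mat n n (\<lambda>(i, j). kdelta i j + H i j - (kdelta i n + H i n) * (kdelta n j + H n j) / of_real (1 + h)) =
    mat n n (\<lambda>(i, j). kdelta i j + H' i j)"
    by (intro cong_mat) (auto simp: H'_def)
  finally have det: "det (mat (Suc n) (Suc n) (\<lambda>(i, j). kdelta i j + H i j)) = of_real ((1 + h) * D)"
    by (simp add: D)
  have "(\<integral>\<^sup>+z. ennreal (exp (- Re (qform (Suc n) H z))) \<partial>gauss_vec (Suc n)) =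
    (\<integral>\<^sup>+z. (\<integral>\<^sup>+y. ennreal (exp (- Re (qform (Suc n) H (z(n := y))))) \<partial>cgauss) \<partial>gauss_vec n)"
    unfolding lessThan_Suc
    by (rule gv.product_nn_integral_insert) (auto simp flip: lessThan_Suc)
  also have "\<dots> = (\<integral>\<^sup>+z. ennreal (1 / (1 + h)) * ennreal (exp (- Re (qform n H' z))) \<partial>gauss_vec n)"
  proof (intro nn_integral_cong)
    fix z
    let ?c = "\<Sum>j<n. H n j * z j"
    have c: "(\<Sum>j<n. H n j * (z(n := y)) j) = ?c" for y by (intro sum.cong) auto
    have q: "qform n H (z(n := y)) = qform n H z" for y by (intro qform_cong) auto
    have "(\<integral>\<^sup>+y. ennreal (exp (- Re (qform (Suc n) H (z(n := y))))) \<partial>cgauss) =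
      (\<integral>\<^sup>+y. ennreal (exp (- Re (qform n H z))) * ennreal (exp (- (h * (cmod y)\<^sup>2 + 2 * Re (cnj y * ?c)))) \<partial>cgauss)"
      unfolding q_Suc c q fun_upd_same
      by (simp add: ennreal_mult'[symmetric] mult_exp_exp algebra_simps)
    also have "\<dots> = ennreal (exp (- Re (qform n H z))) * ennreal (exp ((cmod ?c)\<^sup>2 / (1 + h)) / (1 + h))"
    proof (subst nn_integral_cmult)
      show "(\<lambda>y. ennreal (exp (- (h * (cmod y)\<^sup>2 + 2 * Re (cnj y * ?c))))) \<in> borel_measurable cgauss"
        by measurable
    qed (subst nn_integral_cgauss_quadratic, use h in auto)
    also have "\<dots> = ennreal (1 / (1 + h)) * ennreal (exp (- Re (qform n H' z)))"
      using h by (simp add: ennreal_mult'[symmetric] mult_exp_exp q_H')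
    finally show "(\<integral>\<^sup>+y. ennreal (exp (- Re (qform (Suc n) H (z(n := y))))) \<partial>cgauss) =
      ennreal (1 / (1 + h)) * ennreal (exp (- Re (qform n H' z)))" .
  qed
  also have "\<dots> = ennreal (1 / (1 + h)) * ennreal (1 / D)"
    by (subst nn_integral_cmult) (auto simp: D)
  also have "\<dots> = ennreal (1 / ((1 + h) * D))"
    using h by (simp add: ennreal_mult'[symmetric])
  finally show ?case
    using det D(1) h mult_mono[of 1 "1 + h" 1 D] by (intro exI[of _ "(1 + h) * D"]) simp
qed


section \<open>Mean and inverse mean of the determinant\<close>


text \<open>\<open>X k\<close> is the k-th column, so the index order is opposite to that of
  \<open>G\<close>. In this way columns are the coordinates of \<open>gauss_mat\<close> and can be
  integrated out one at a time.\<close>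

definition gramw :: "(nat \<Rightarrow> real) \<Rightarrow> nat \<Rightarrow> (nat \<Rightarrow> nat \<Rightarrow> complex) \<Rightarrow> nat \<Rightarrow> nat \<Rightarrow> complex" where
  "gramw w K X i j = (\<Sum>k<K. of_real (w k) * X k i * cnj (X k j))"

definition covmat :: "nat \<Rightarrow> (nat \<Rightarrow> real) \<Rightarrow> nat \<Rightarrow> (nat \<Rightarrow> nat \<Rightarrow> complex) \<Rightarrow> complex mat" where
  "covmat n w K X = mat n n (\<lambda>(i, j). kdelta i j + gramw w K X i j)"

definition covdet :: "nat \<Rightarrow> (nat \<Rightarrow> real) \<Rightarrow> nat \<Rightarrow> (nat \<Rightarrow> nat \<Rightarrow> complex) \<Rightarrow> real" where
  "covdet n w K X = Re (det (covmat n w K X))"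

lemma covmat_carrier [simp]: "covmat n w K X \<in> carrier_mat n n"
  by (simp add: covmat_def)

lemma covdet_cong:
  assumes "\<And>k. k < K \<Longrightarrow> w k = w' k" "\<And>k i. k < K \<Longrightarrow> i < n \<Longrightarrow> X k i = X' k i"
  shows "covdet n w K X = covdet n w' K X'"
  unfolding covdet_def covmat_def gramw_def
  using assms by (intro arg_cong[where f="\<lambda>A. Re (det A)"] cong_mat) auto

text \<open>By the Leibniz formula the determinant is a polynomial in the entries. Weights and
  columns may vary together, as the later exchange of integrals over both requires.\<close>

lemma measurable_covdet:
  assumes [measurable]: "\<And>k. k < K \<Longrightarrow> (\<lambda>\<omega>. w \<omega> k) \<in> borel_measurable M"
    and [measurable]: "\<And>k i. k < K \<Longrightarrow> i < n \<Longrightarrow> (\<lambda>\<omega>. X \<omega> k i) \<in> borel_measurable M"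
  shows "(\<lambda>\<omega>. covdet n (w \<omega>) K (X \<omega>)) \<in> borel_measurable M"
proof -
  have [measurable]: "(\<lambda>\<omega>. gramw (w \<omega>) K (X \<omega>) i j) \<in> borel_measurable M" if "i < n" "j < n" for i j
    unfolding gramw_def using that by measurable
  have "(\<lambda>\<omega>. Re (\<Sum>p\<in>{p. p permutes {0..<n}}. signof p *
      (\<Prod>i = 0..<n. kdelta i (p i) + gramw (w \<omega>) K (X \<omega>) i (p i)))) \<in> borel_measurable M"
    by measurable (auto dest: permutes_in_image)
  moreover have "det (covmat n (w \<omega>) K (X \<omega>)) = (\<Sum>p\<in>{p. p permutes {0..<n}}. signof p *
      (\<Prod>i = 0..<n. kdelta i (p i) + gramw (w \<omega>) K (X \<omega>) i (p i)))" for \<omega>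
    unfolding det_def'[OF covmat_carrier]
    by (intro sum.cong prod.cong arg_cong2[where f="(*)"] refl)
       (auto simp: covmat_def dest: permutes_in_image)
  ultimately show ?thesis by (simp add: covdet_def)
qed

lemma measurable_gauss_mat_component:
  assumes "k < K" "i < m"
  shows "(\<lambda>X. X k i) \<in> borel_measurable (gauss_mat m K)"
proof -
  have "(\<lambda>x. x i) \<in> gauss_vec m \<rightarrow>\<^sub>M cgauss"
    using assms by (intro measurable_component_singleton) auto
  moreover have "(\<lambda>X. X k) \<in> gauss_mat m K \<rightarrow>\<^sub>M gauss_vec m"
    using assms by (intro measurable_component_singleton) auto
  ultimately have "(\<lambda>X. X k i) \<in> gauss_mat m K \<rightarrow>\<^sub>M cgauss"
    by (rule measurable_compose[rotated])
  then show ?thesis by (simp add: measurable_cong_sets[OF refl sets_cgauss])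
qed

lemma measurable_gauss_vec_component:
  "i < m \<Longrightarrow> (\<lambda>x. x i) \<in> borel_measurable (gauss_vec m)"
  using measurable_component_singleton[of i "{..<m}" "\<lambda>_. cgauss"]
  by (simp add: measurable_cong_sets[OF refl sets_cgauss])

lemma gramw_Suc: "gramw w (Suc K) X i j = gramw w K X i j + (of_real (w K) * X K i) * cnj (X K j)"
  by (simp add: gramw_def)

lemma gramw_herm: "gramw w K X i j = cnj (gramw w K X j i)"
  by (simp add: gramw_def mult_ac)

text \<open>The form is a weighted sum over columns of squared projections. For nonnegative weights
  it is therefore nonnegative, and for fixed \<open>z\<close> its exponential is a product over the
  columns.\<close>

lemma qform_gramw:
  "qform n (gramw w K X) z = of_real (\<Sum>k<K. w k * (cmod (\<Sum>j<n. cnj (X k j) * z j))\<^sup>2)"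
proof -
  have "qform n (gramw w K X) z =
    (\<Sum>i<n. \<Sum>j<n. \<Sum>k<K. of_real (w k) * ((cnj (z i) * X k i) * (cnj (X k j) * z j)))"
    by (simp add: qform_def gramw_def sum_distrib_left sum_distrib_right mult_ac)
  also have "\<dots> = (\<Sum>i<n. \<Sum>k<K. \<Sum>j<n. of_real (w k) * ((cnj (z i) * X k i) * (cnj (X k j) * z j)))"
    by (intro sum.cong refl sum.swap)
  also have "\<dots> = (\<Sum>k<K. \<Sum>i<n. \<Sum>j<n. of_real (w k) * ((cnj (z i) * X k i) * (cnj (X k j) * z j)))"
    by (rule sum.swap)
  also have "\<dots> = (\<Sum>k<K. of_real (w k) * ((\<Sum>i<n. cnj (z i) * X k i) * (\<Sum>j<n. cnj (X k j) * z j)))"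
    by (simp only: sum_product) (simp only: sum_distrib_left)
  also have "\<dots> = (\<Sum>k<K. of_real (w k) * (cnj (\<Sum>j<n. cnj (X k j) * z j) * (\<Sum>j<n. cnj (X k j) * z j)))"
    by (simp add: mult.commute)
  finally show ?thesis unfolding cnj_mult_self by simp
qed

text \<open>The lower bound 1 makes the logarithm nonnegative, so that its means can be handled as
  nonnegative integrals. The Gaussian representation replaces the determinant, in which all columns
  interact, by an exponential in which they decouple.\<close>

lemma
  assumes w: "\<And>k. k < K \<Longrightarrow> 0 \<le> w k"
  shows covdet_ge_1: "1 \<le> covdet n w K X"
    and covdet_gaussian: "(\<integral>\<^sup>+z. ennreal (exp (- (\<Sum>k<K. w k * (cmod (\<Sum>j<n. cnj (X k j) * z j))\<^sup>2))) \<partial>gauss_vec n)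
      = ennreal (1 / covdet n w K X)"
proof -
  have "\<exists>D\<ge>1. det (mat n n (\<lambda>(i, j). kdelta i j + gramw w K X i j)) = of_real D \<and>
    (\<integral>\<^sup>+z. ennreal (exp (- Re (qform n (gramw w K X) z))) \<partial>gauss_vec n) = ennreal (1 / D)"
  proof (rule gaussian_integral_det)
    show "gramw w K X i j = cnj (gramw w K X j i)" for i j by (rule gramw_herm)
    show "0 \<le> Re (qform n (gramw w K X) z)" for z
      unfolding qform_gramw using w by (auto intro!: sum_nonneg)
  qed
  then obtain D where D: "1 \<le> D" "det (covmat n w K X) = of_real D"
    "(\<integral>\<^sup>+z. ennreal (exp (- Re (qform n (gramw w K X) z))) \<partial>gauss_vec n) = ennreal (1 / D)"
    unfolding covmat_def by blast
  then have [simp]: "covdet n w K X = D" by (simp add: covdet_def)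
  show "1 \<le> covdet n w K X" using D by simp
  show "(\<integral>\<^sup>+z. ennreal (exp (- (\<Sum>k<K. w k * (cmod (\<Sum>j<n. cnj (X k j) * z j))\<^sup>2))) \<partial>gauss_vec n)
      = ennreal (1 / covdet n w K X)"
    using D(3) by (simp only: qform_gramw Re_complex_of_real \<open>covdet n w K X = D\<close>)
qed

section \<open>Mean of the inverse determinant\<close>

lemma cofactor_one:
  assumes "a < n" "b < n"
  shows "cofactor (1\<^sub>m n :: 'a :: comm_ring_1 mat) a b = (if a = b then 1 else 0)"
proof -
  let ?A = "1\<^sub>m n :: 'a mat"
  have "adj_mat ?A \<in> carrier_mat n n" "?A * adj_mat ?A = det ?A \<cdot>\<^sub>m 1\<^sub>m n"
    by (rule adj_mat, simp)+
  moreover have "1 \<cdot>\<^sub>m ?A = ?A" by (intro eq_matI) auto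
  ultimately have "adj_mat ?A = 1\<^sub>m n" by simp
  then have "adj_mat ?A $$ (b, a) = (if a = b then 1 else 0)" using assms by auto
  then show ?thesis using assms by (simp add: adj_mat_def)
qed

lemma covdet_one:
  "covdet n w (Suc 0) X = 1 + w 0 * (\<Sum>i<n. (cmod (X 0 i))\<^sup>2)"
proof -
  have one: "mat n n (\<lambda>(i, j). kdelta i j) = 1\<^sub>m n" by (auto simp: one_mat_def)
  have "det (covmat n w (Suc 0) X) = det (mat n n (\<lambda>(i, j). kdelta i j + (of_real (w 0) * X 0 i) * cnj (X 0 j)))"
    by (simp add: covmat_def gramw_def)
  also have "\<dots> = 1 + (\<Sum>a<n. \<Sum>b<n. (of_real (w 0) * X 0 a) * cnj (X 0 b) * cofactor (1\<^sub>m n) a b)"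
    unfolding det_mat_rank_one_cofactor one by simp
  also have "(\<Sum>a<n. \<Sum>b<n. (of_real (w 0) * X 0 a) * cnj (X 0 b) * cofactor (1\<^sub>m n) a b) =
    (\<Sum>a<n. of_real (w 0 * (cmod (X 0 a))\<^sup>2))"
  proof (intro sum.cong refl)
    fix a assume a: "a \<in> {..<n}"
    have "(\<Sum>b<n. (of_real (w 0) * X 0 a) * cnj (X 0 b) * cofactor (1\<^sub>m n) a b) =
      (\<Sum>b<n. if a = b then of_real (w 0) * (cnj (X 0 b) * X 0 b) else 0)"
      using a by (intro sum.cong refl) (simp add: cofactor_one mult_ac)
    then show "(\<Sum>b<n. (of_real (w 0) * X 0 a) * cnj (X 0 b) * cofactor (1\<^sub>m n) a b) = of_real (w 0 * (cmod (X 0 a))\<^sup>2)"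
      using a by (simp add: cnj_mult_self)
  qed
  finally show ?thesis by (simp add: covdet_def sum_distrib_left flip: of_real_sum)
qed

text \<open>The modulus of the inner product is symmetric in \<open>x\<close> and \<open>z\<close>.
  Hence this is the determinant formula for the single column \<open>z\<close>, with the random
  column \<open>x\<close> in the role of the auxiliary Gaussian vector.\<close>

lemma gaussian_integral_rank_one:
  assumes "0 \<le> w"
  shows "(\<integral>\<^sup>+x. ennreal (exp (- (w * (cmod (\<Sum>j<n. cnj (x j) * z j))\<^sup>2))) \<partial>gauss_vec n) =
    ennreal (1 / (1 + w * (\<Sum>i<n. (cmod (z i))\<^sup>2)))"
proof -
  have "cmod (\<Sum>j<n. cnj (x j) * z j) = cmod (\<Sum>j<n. cnj (z j) * x j)" for x :: "nat \<Rightarrow> complex"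
    using complex_mod_cnj[of "\<Sum>j<n. cnj (x j) * z j"] by (simp add: mult.commute)
  then show ?thesis
    using covdet_gaussian[of "Suc 0" "\<lambda>_. w" n "\<lambda>_. z"] assms by (simp add: covdet_one)
qed

text \<open>Exchanging the auxiliary vector with the columns: for fixed \<open>z\<close> the columns
  are independent and enter as a product, and each factor integrates to a function of |z|^2. The
  whole Gaussian matrix collapses to one scalar, with equality.\<close>

lemma nn_integral_inverse_covdet:
  assumes w: "\<And>k. k < K \<Longrightarrow> 0 \<le> w k"
  shows "(\<integral>\<^sup>+X. ennreal (1 / covdet n w K X) \<partial>gauss_mat n K) =
    (\<integral>\<^sup>+z. ennreal (\<Prod>k<K. 1 / (1 + w k * (\<Sum>i<n. (cmod (z i))\<^sup>2))) \<partial>gauss_vec n)"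
proof -
  interpret GM: prob_space "gauss_mat n K" by (rule prob_space_gauss_mat)
  interpret GV: prob_space "gauss_vec n" by (rule prob_space_gauss_vec)
  interpret pair_sigma_finite "gauss_mat n K" "gauss_vec n" ..
  have [measurable]: "(\<lambda>p. fst p k j) \<in> borel_measurable (gauss_mat n K \<Otimes>\<^sub>M gauss_vec n)" if "k < K" "j < n" for k j
    by (rule measurable_compose[OF measurable_fst measurable_gauss_mat_component[OF that]])
  have [measurable]: "(\<lambda>p. snd p j) \<in> borel_measurable (gauss_mat n K \<Otimes>\<^sub>M gauss_vec n)" if "j < n" for j
    by (rule measurable_compose[OF measurable_snd measurable_gauss_vec_component[OF that]])
  have "(\<integral>\<^sup>+X. ennreal (1 / covdet n w K X) \<partial>gauss_mat n K) =
    (\<integral>\<^sup>+X. (\<integral>\<^sup>+z. ennreal (exp (- (\<Sum>k<K. w k * (cmod (\<Sum>j<n. cnj (X k j) * z j))\<^sup>2))) \<partial>gauss_vec n) \<partial>gauss_mat n K)"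
    by (intro nn_integral_cong covdet_gaussian[symmetric] w)
  also have "\<dots> = (\<integral>\<^sup>+z. (\<integral>\<^sup>+X. ennreal (exp (- (\<Sum>k<K. w k * (cmod (\<Sum>j<n. cnj (X k j) * z j))\<^sup>2))) \<partial>gauss_mat n K) \<partial>gauss_vec n)"
    by (rule Fubini'[symmetric]) (simp only: split_beta', measurable)
  also have "\<dots> = (\<integral>\<^sup>+z. ennreal (\<Prod>k<K. 1 / (1 + w k * (\<Sum>i<n. (cmod (z i))\<^sup>2))) \<partial>gauss_vec n)"
  proof (intro nn_integral_cong)
    fix z
    have "(\<integral>\<^sup>+X. ennreal (exp (- (\<Sum>k<K. w k * (cmod (\<Sum>j<n. cnj (X k j) * z j))\<^sup>2))) \<partial>gauss_mat n K) =
      (\<integral>\<^sup>+X. (\<Prod>k<K. ennreal (exp (- (w k * (cmod (\<Sum>j<n. cnj (X k j) * z j))\<^sup>2)))) \<partial>gauss_mat n K)"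
      by (simp add: sum_negf[symmetric] exp_sum prod_ennreal)
    also have "\<dots> = (\<Prod>k<K. \<integral>\<^sup>+x. ennreal (exp (- (w k * (cmod (\<Sum>j<n. cnj (x j) * z j))\<^sup>2))) \<partial>gauss_vec n)"
    proof (rule gm.product_nn_integral_prod)
      note measurable_gauss_vec_component[measurable]
      show "(\<lambda>x. ennreal (exp (- (w k * (cmod (\<Sum>j<n. cnj (x j) * z j))\<^sup>2)))) \<in> borel_measurable (gauss_vec n)" for k
        by measurable
    qed simp
    also have "\<dots> = (\<Prod>k<K. ennreal (1 / (1 + w k * (\<Sum>i<n. (cmod (z i))\<^sup>2))))"
      using w by (intro prod.cong refl gaussian_integral_rank_one) auto
    also have "\<dots> = ennreal (\<Prod>k<K. 1 / (1 + w k * (\<Sum>i<n. (cmod (z i))\<^sup>2)))"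
      using w by (intro prod_ennreal) (auto intro!: divide_nonneg_nonneg add_nonneg_nonneg mult_nonneg_nonneg sum_nonneg)
    finally show "(\<integral>\<^sup>+X. ennreal (exp (- (\<Sum>k<K. w k * (cmod (\<Sum>j<n. cnj (X k j) * z j))\<^sup>2))) \<partial>gauss_mat n K) =
      ennreal (\<Prod>k<K. 1 / (1 + w k * (\<Sum>i<n. (cmod (z i))\<^sup>2)))" .
  qed
  finally show ?thesis .
qed


section \<open>Mean of the determinant\<close>

lemma gauss_vec_covariance:
  assumes "p < m" "q < m"
  shows "integrable (gauss_vec m) (\<lambda>x. x p * cnj (x q))" (is ?A)
    and "(\<integral>x. x p * cnj (x q) \<partial>gauss_vec m) = kdelta p q" (is ?B)
proof -
  \<comment> \<open>The integrand is written as a product over all coordinates, with factor 1 at the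
    idle ones, so that one product formula serves both p = q and p \<noteq> q.\<close>
  define f where "f i z = (if i = p then z else 1) * (if i = q then cnj z else (1::complex))" for i z
  have prod: "(\<Prod>i<m. f i (x i)) = x p * cnj (x q)" for x
    unfolding f_def prod.distrib using assms by (simp add: prod.delta)
  have sq: "z * cnj z = of_real ((cmod z)\<^sup>2)" for z
    by (simp only: complex_norm_square)
  have int: "integrable cgauss (f i)" for i
    unfolding f_def using integrable_cgauss_id integrable_cgauss_norm_square
    by (cases "i = p"; cases "i = q") (auto simp: sq simp del: of_real_power intro!: integrable_of_real)
  show ?A
    using gv.product_integrable_prod[of "{..<m}" f] int by (simp add: prod)
  have "(\<integral>x. x p * cnj (x q) \<partial>gauss_vec m) = (\<Prod>i<m. integral\<^sup>L cgauss (f i))"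
    using gv.product_integral_prod[of "{..<m}" f] int by (simp add: prod)
  also have "\<dots> = kdelta p q"
  proof (cases "p = q")
    case True
    have "integral\<^sup>L cgauss (f i) = 1" for i
    proof (cases "i = p")
      case True
      then show ?thesis using \<open>p = q\<close> integral_cgauss_norm_square
        unfolding f_def by (simp add: sq integral_of_real del: of_real_power)
    qed (use \<open>p = q\<close> in \<open>simp add: f_def[abs_def] cgauss.prob_space[simplified]\<close>)
    then show ?thesis using True by simp
  next
    case False
    then have "f p = (\<lambda>z. z)" by (auto simp: f_def)
    then have "integral\<^sup>L cgauss (f p) = 0" by (simp add: integral_cgauss_id)
    then show ?thesis using False assms by (auto intro!: prod_zero bexI[of _ p])
  qed
  finally show ?B .
qed

text \<open>Only diagonal cofactors survive in the mean, and each is the same determinant with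
  antenna \<open>a\<close> deleted. The relabelling by \<open>insert_index a\<close> is the reason
  why the bound below is stated for an arbitrary injective selection \<open>r\<close> of antennas:
  the selections compose in the induction while \<open>m\<close> stays fixed.\<close>

lemma cofactor_covmat:
  assumes "a < n"
  shows "cofactor (covmat n w K X) a a = det (covmat (n - 1) w K (\<lambda>k i. X k (insert_index a i)))"
proof -
  have "kdelta (insert_index a i) (insert_index a j) = kdelta i j" for i j
    by (auto simp: insert_index_def)
  moreover have "(- 1 :: complex) ^ (a + a) = 1" by simp
  ultimately show ?thesis
    using assms unfolding cofactor_def covmat_def by (simp add: mat_delete_mat gramw_def)
qed

text \<open>Expanding along the last column and using that it is independent of the others with
  unit covariance, the expected determinants \<open>p\<close> obey
  \<open>p n (K + 1) = p n K + w K * n * p (n - 1) K\<close>.\<close>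
lemma nn_integral_covdet_le:
  assumes w: "\<And>k. k < K \<Longrightarrow> 0 \<le> w k" and y: "0 < y"
    and r: "inj_on r {..<n}" "r ` {..<n} \<subseteq> {..<m}"
  shows "(\<integral>\<^sup>+X. ennreal (covdet n w K (\<lambda>k i. X k (r i))) \<partial>gauss_mat m K) \<le>
    ennreal (fact n / y ^ n * exp y * (\<Prod>k<K. 1 + w k * y))"
  using assms
proof (induction K arbitrary: n r)
  case 0
  \<comment> \<open>Without columns the claim is y^n / n! \<le> exp y, a single term of the series.
    The same estimate is the origin of the whole bound: the part of the mean of degree j in the
    weights carries the factor n! / (n - j)!, which is at most n! / y^n * exp y * y^j.\<close>
  have "(\<Sum>k\<in>{n}. y ^ k /\<^sub>R fact k) \<le> exp y"
    unfolding exp_def by (rule sum_le_suminf[OF summable_exp_generic]) (use y in auto)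
  then have "y ^ n / fact n \<le> exp y"
    by (simp add: divide_inverse mult.commute)
  then have "1 \<le> fact n / y ^ n * exp y"
    using y by (simp add: field_simps)
  moreover have "covdet n w 0 X = 1" for X
  proof -
    have "covmat n w 0 X = 1\<^sub>m n" by (auto simp: covmat_def gramw_def one_mat_def)
    then show ?thesis by (simp add: covdet_def)
  qed
  moreover have "emeasure (gauss_mat m 0) (space (gauss_mat m 0)) = 1"
    by (rule prob_space.emeasure_space_1[OF prob_space_gauss_mat])
  ultimately show ?case by simp
next
  case (Suc K)
  have w: "0 \<le> w k" if "k < Suc K" for k using Suc.prems(1) that by auto
  let ?T = "\<lambda>n. fact n / y ^ n * exp y * (\<Prod>k<K. 1 + w k * y)"
  have r: "r i < m" if "i < n" for i using Suc.prems(4) that by auto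
  have T0: "0 \<le> ?T k" for k using w y by (auto intro!: mult_nonneg_nonneg divide_nonneg_nonneg prod_nonneg add_nonneg_nonneg)
  let ?Y = "\<lambda>X k i. X k (r i)"
  note [measurable] = measurable_gauss_mat_component measurable_gauss_vec_component
  have meas: "(\<lambda>X. covdet n w K (\<lambda>k i. X k (r i))) \<in> borel_measurable (gauss_mat m K)"
    if "\<And>i. i < n \<Longrightarrow> r i < m" for n K r
    by (rule measurable_covdet) (use that in measurable)
  have inner: "(\<integral>\<^sup>+x. ennreal (covdet n w (Suc K) (?Y (X(K := x)))) \<partial>gauss_vec m) =
    ennreal (covdet n w K (?Y X)) + (\<Sum>a<n. ennreal (w K) * ennreal (covdet (n - 1) w K (\<lambda>k i. X k (r (insert_index a i)))))" for X
  proof -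
    let ?C = "\<lambda>a b. cofactor (covmat n w K (?Y X)) a b"
    let ?f = "\<lambda>x. covdet n w K (?Y X) + (\<Sum>a<n. \<Sum>b<n. w K * Re (x (r a) * cnj (x (r b)) * ?C a b))"
    have f: "covdet n w (Suc K) (?Y (X(K := x))) = ?f x" for x
    proof -
      have g: "gramw w K (?Y (X(K := x))) i j = gramw w K (?Y X) i j" for i j
        by (simp add: gramw_def)
      have "covmat n w (Suc K) (?Y (X(K := x))) = mat n n (\<lambda>(i, j). (kdelta i j + gramw w K (?Y X) i j) + (of_real (w K) * x (r i)) * cnj (x (r j)))"
        unfolding covmat_def gramw_Suc g by (intro cong_mat) auto
      then have "det (covmat n w (Suc K) (?Y (X(K := x)))) = det (covmat n w K (?Y X)) +
        (\<Sum>a<n. \<Sum>b<n. of_real (w K) * x (r a) * cnj (x (r b)) * ?C a b)"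
        by (simp only: det_mat_rank_one_cofactor covmat_def)
      then show ?thesis
        unfolding covdet_def by (simp add: Re_sum mult.assoc)
    qed
    have int: "integrable (gauss_vec m) (\<lambda>x. w K * Re (x (r a) * cnj (x (r b)) * ?C a b))"
      and int2: "(\<integral>x. w K * Re (x (r a) * cnj (x (r b)) * ?C a b) \<partial>gauss_vec m) = (if a = b then w K * Re (?C a a) else 0)"
      if "a < n" "b < n" for a b
    proof -
      have i: "integrable (gauss_vec m) (\<lambda>x. x (r a) * cnj (x (r b)) * ?C a b)"
        by (intro integrable_mult_left gauss_vec_covariance(1) r that)
      then show "integrable (gauss_vec m) (\<lambda>x. w K * Re (x (r a) * cnj (x (r b)) * ?C a b))"
        by (intro integrable_mult_right integrable_Re)
      have eq: "r a = r b \<longleftrightarrow> a = b"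
        using Suc.prems(3) that by (auto dest: inj_onD)
      have "(\<integral>x. w K * Re (x (r a) * cnj (x (r b)) * ?C a b) \<partial>gauss_vec m) =
        w K * Re (\<integral>x. x (r a) * cnj (x (r b)) * ?C a b \<partial>gauss_vec m)"
        by (simp only: integral_mult_right_zero integral_Re[OF i])
      also have "(\<integral>x. x (r a) * cnj (x (r b)) * ?C a b \<partial>gauss_vec m) = kdelta (r a) (r b) * ?C a b"
        by (simp only: integral_mult_left_zero gauss_vec_covariance(2)[OF r[OF that(1)] r[OF that(2)]])
      also have "w K * Re (kdelta (r a) (r b) * ?C a b) = (if a = b then w K * Re (?C a a) else 0)"
        by (simp add: eq)
      finally show "(\<integral>x. w K * Re (x (r a) * cnj (x (r b)) * ?C a b) \<partial>gauss_vec m) = (if a = b then w K * Re (?C a a) else 0)" .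
    qed
    have int_f: "integrable (gauss_vec m) ?f"
      using int by (intro Bochner_Integration.integrable_add Bochner_Integration.integrable_sum) auto
    have "(\<integral>\<^sup>+x. ennreal (?f x) \<partial>gauss_vec m) = ennreal (\<integral>x. ?f x \<partial>gauss_vec m)"
    proof (rule nn_integral_eq_integral[OF int_f])
      have "0 \<le> ?f x" for x
        unfolding f[symmetric] using covdet_ge_1[of "Suc K" w n "?Y (X(K := x))"] w by simp
      then show "AE x in gauss_vec m. 0 \<le> ?f x" by simp
    qed
    also have "(\<integral>x. ?f x \<partial>gauss_vec m) = covdet n w K (?Y X) + (\<Sum>a<n. w K * Re (?C a a))"
    proof -
      define h where "h a b x = w K * Re (x (r a) * cnj (x (r b)) * ?C a b)" for a b x
      have h: "integrable (gauss_vec m) (h a b)" if "a < n" "b < n" for a b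
        unfolding h_def using that by (rule int)
      have h': "integrable (gauss_vec m) (\<lambda>x. \<Sum>b<n. h a b x)" if "a < n" for a
        using h that by (intro Bochner_Integration.integrable_sum) auto
      have "(\<integral>x. (\<Sum>a<n. \<Sum>b<n. h a b x) \<partial>gauss_vec m) = (\<Sum>a<n. \<integral>x. (\<Sum>b<n. h a b x) \<partial>gauss_vec m)"
        using h' by (intro Bochner_Integration.integral_sum) auto
      also have "\<dots> = (\<Sum>a<n. \<Sum>b<n. \<integral>x. h a b x \<partial>gauss_vec m)"
        using h by (intro sum.cong refl Bochner_Integration.integral_sum) auto
      finally have "(\<integral>x. covdet n w K (?Y X) + (\<Sum>a<n. \<Sum>b<n. h a b x) \<partial>gauss_vec m) =
          covdet n w K (?Y X) + (\<Sum>a<n. \<Sum>b<n. \<integral>x. h a b x \<partial>gauss_vec m)"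
        using h by (subst Bochner_Integration.integral_add)
          (auto simp: prob_space.prob_space[OF prob_space_gauss_vec] intro!: Bochner_Integration.integrable_sum)
      then have "(\<integral>x. ?f x \<partial>gauss_vec m) = covdet n w K (?Y X) + (\<Sum>a<n. \<Sum>b<n. \<integral>x. w K * Re (x (r a) * cnj (x (r b)) * ?C a b) \<partial>gauss_vec m)"
        by (simp only: h_def)
      also have "\<dots> = covdet n w K (?Y X) + (\<Sum>a<n. \<Sum>b<n. (if a = b then w K * Re (?C a a) else 0))"
        by (intro arg_cong2[where f="(+)"] refl sum.cong int2) auto
      finally show ?thesis by simp
    qed
    also have "(\<Sum>a<n. w K * Re (?C a a)) = (\<Sum>a<n. w K * covdet (n - 1) w K (\<lambda>k i. X k (r (insert_index a i))))"
      by (intro sum.cong refl) (simp add: cofactor_covmat covdet_def)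
    also have "ennreal (covdet n w K (?Y X) + \<dots>) = ennreal (covdet n w K (?Y X)) +
      (\<Sum>a<n. ennreal (w K) * ennreal (covdet (n - 1) w K (\<lambda>k i. X k (r (insert_index a i)))))"
    proof -
      have "0 \<le> covdet n' w K X'" for n' X'
        using covdet_ge_1[of K w n' X'] w by simp
      then show ?thesis using w by (simp add: ennreal_plus sum_nonneg ennreal_mult'[symmetric] flip: sum_ennreal)
    qed
    finally show ?thesis unfolding f .
  qed
  have ins: "(\<integral>\<^sup>+X. ennreal (covdet (n - 1) w K (\<lambda>k i. X k (r (insert_index a i)))) \<partial>gauss_mat m K) \<le> ennreal (?T (n - 1))"
    if "a < n" for a
  proof -
    have i: "inj_on (insert_index a) {..<n - 1}" "insert_index a ` {..<n - 1} \<subseteq> {..<n}"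
      using that by (auto simp: inj_on_def insert_index_def split: if_splits)
    have "inj_on (\<lambda>i. r (insert_index a i)) {..<n - 1}"
      using comp_inj_on[OF i(1) inj_on_subset[OF Suc.prems(3) i(2)]] by (simp add: comp_def)
    moreover have "(\<lambda>i. r (insert_index a i)) ` {..<n - 1} \<subseteq> {..<m}"
      using i(2) r by auto
    ultimately show ?thesis using Suc.IH[of "\<lambda>i. r (insert_index a i)" "n - 1"] w y by simp
  qed
  have "(\<integral>\<^sup>+X. ennreal (covdet n w (Suc K) (?Y X)) \<partial>gauss_mat m (Suc K)) =
    (\<integral>\<^sup>+X. (\<integral>\<^sup>+x. ennreal (covdet n w (Suc K) (?Y (X(K := x)))) \<partial>gauss_vec m) \<partial>gauss_mat m K)"
    unfolding lessThan_Suc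
  proof (rule gm.product_nn_integral_insert)
    show "(\<lambda>X. ennreal (covdet n w (Suc K) (?Y X))) \<in> borel_measurable (PiM (insert K {..<K}) (\<lambda>_. gauss_vec m))"
      using meas[of n r "Suc K"] r by (simp add: lessThan_Suc)
  qed auto
  also have "\<dots> = (\<integral>\<^sup>+X. ennreal (covdet n w K (?Y X)) \<partial>gauss_mat m K) +
    (\<Sum>a<n. ennreal (w K) * (\<integral>\<^sup>+X. ennreal (covdet (n - 1) w K (\<lambda>k i. X k (r (insert_index a i)))) \<partial>gauss_mat m K))"
  proof -
    have [measurable]: "(\<lambda>X. covdet (n - 1) w K (\<lambda>k i. X k (r (insert_index a i)))) \<in> borel_measurable (gauss_mat m K)" if "a < n" for a
      using that r by (intro meas[of "n - 1" "\<lambda>i. r (insert_index a i)" K]) (auto simp: insert_index_def)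
    have [measurable]: "(\<lambda>X. covdet n w K (?Y X)) \<in> borel_measurable (gauss_mat m K)"
      by (rule meas) (rule r)
    show ?thesis unfolding inner
      by (subst nn_integral_add, measurable, subst nn_integral_sum, measurable)
        (intro arg_cong2[where f="(+)"] refl sum.cong nn_integral_cmult, measurable)
  qed
  also have "\<dots> \<le> ennreal (?T n) + (\<Sum>a<n. ennreal (w K) * ennreal (?T (n - 1)))"
    using Suc.prems w by (intro add_mono sum_mono mult_left_mono ins Suc.IH) auto
  also have "\<dots> = ennreal (?T n + n * (w K * ?T (n - 1)))"
  proof -
    have "ennreal A + (\<Sum>a<n. ennreal c * ennreal B) = ennreal (A + n * (c * B))"
      if "0 \<le> A" "0 \<le> B" "0 \<le> c" for A B c :: real
      using that by (simp add: ennreal_plus ennreal_mult ennreal_of_nat_eq_real_of_nat)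
    from this[OF T0 T0 w[OF lessI]] show ?thesis .
  qed
  \<comment> \<open>For positive n this is an equality, since n * \<open>?T (n - 1)\<close> = y *
    \<open>?T n\<close>. For n = 0 the truncated index n - 1 = 0 is multiplied by 0, and it remains
    to use 1 \<le> 1 + w y.\<close>
  also have "?T n + n * (w K * ?T (n - 1)) \<le> fact n / y ^ n * exp y * (\<Prod>k<Suc K. 1 + w k * y)"
  proof (cases n)
    case 0
    have "?T 0 * 1 \<le> ?T 0 * (1 + w K * y)"
      using w[of K] y by (intro mult_left_mono T0) simp
    then show ?thesis by (simp add: 0 mult.assoc)
  next
    case (Suc n')
    have "n * (w K * ?T (n - 1)) = ?T n * (w K * y)"
      using y by (simp add: Suc field_simps)
    then show ?thesis by (simp add: algebra_simps)
  qed
  finally show ?case by (simp add: ennreal_leI)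
qed


section \<open>Bounds on the mean logarithm of the determinant\<close>


text \<open>The values are extended nonnegative, so that averaging over random weights raises no
  question of integrability. For nonnegative weights the determinant is at least 1, and
  \<open>ennreal\<close> represents the logarithm faithfully.\<close>

definition mean_ln_covdet :: "nat \<Rightarrow> (nat \<Rightarrow> real) \<Rightarrow> nat \<Rightarrow> ennreal" where
  "mean_ln_covdet n w K = (\<integral>\<^sup>+X. ennreal (ln (covdet n w K X)) \<partial>gauss_mat n K)"

lemma measurable_covdet_gauss_mat [measurable]: "covdet n w K \<in> borel_measurable (gauss_mat n K)"
  by (rule measurable_covdet) (auto intro: measurable_gauss_mat_component)

text \<open>Jensen in the form of the tangent to ln at the bound T of the mean, ln x + 1 \<le> ln T
  + x / T. The constant stays on the left and is cancelled at the end, because subtraction in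
  \<open>ennreal\<close> is truncated.\<close>

lemma mean_ln_covdet_le:
  assumes w: "\<And>k. k < K \<Longrightarrow> 0 \<le> w k" and y: "0 < y"
  shows "mean_ln_covdet n w K \<le> ennreal ((\<Sum>k<K. ln (1 + w k * y)) + ln (fact n) - real n * ln y + y)"
proof -
  define T where "T = fact n / y ^ n * exp y * (\<Prod>k<K. 1 + w k * y)"
  have pos: "0 < 1 + w k * y" if "k < K" for k
    using w[OF that] y by (simp add: add_pos_nonneg)
  then have T: "0 < T" unfolding T_def using y by (auto intro!: mult_pos_pos divide_pos_pos prod_pos)
  have lnT: "ln T = (\<Sum>k<K. ln (1 + w k * y)) + ln (fact n) - real n * ln y + y"
  proof -
    have "0 < (\<Prod>k<K. 1 + w k * y)" using pos by (auto intro!: prod_pos)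
    moreover have "ln (\<Prod>k<K. 1 + w k * y) = (\<Sum>k<K. ln (1 + w k * y))"
      using pos by (intro ln_prod finite_lessThan) (metis lessThan_iff less_irrefl)
    moreover have "ln (fact n / y ^ n * exp y * Q) = ln Q + ln (fact n) - real n * ln y + y" if "0 < Q" for Q
      using that y by (simp add: ln_mult ln_div ln_realpow)
    ultimately show ?thesis unfolding T_def by simp
  qed
  interpret GM: prob_space "gauss_mat n K" by (rule prob_space_gauss_mat)
  have c: "1 \<le> covdet n w K X" for X by (rule covdet_ge_1[OF w])
  have E: "(\<integral>\<^sup>+X. ennreal (covdet n w K X) \<partial>gauss_mat n K) \<le> ennreal T"
    using nn_integral_covdet_le[OF w y, where K=K and n=n and r=id and m=n] by (simp add: T_def)
  have "1 \<le> (\<integral>\<^sup>+X. ennreal (covdet n w K X) \<partial>gauss_mat n K)"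
  proof -
    have "(\<integral>\<^sup>+X. 1 \<partial>gauss_mat n K) \<le> (\<integral>\<^sup>+X. ennreal (covdet n w K X) \<partial>gauss_mat n K)"
      using c by (intro nn_integral_mono) simp
    then show ?thesis using GM.emeasure_space_1 by simp
  qed
  \<comment> \<open>Ensures 0 \<le> ln T, so that \<open>ennreal (ln T)\<close> is not cut
    off.\<close>
  then have T1: "1 \<le> T"
    using E by (metis ennreal_1 ennreal_le_iff T less_imp_le order_trans)
  have "mean_ln_covdet n w K + 1 = (\<integral>\<^sup>+X. ennreal (ln (covdet n w K X)) + 1 \<partial>gauss_mat n K)"
    unfolding mean_ln_covdet_def using GM.emeasure_space_1 by (subst nn_integral_add) auto
  also have "\<dots> \<le> (\<integral>\<^sup>+X. ennreal (ln T) + ennreal (1 / T) * ennreal (covdet n w K X) \<partial>gauss_mat n K)"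
  proof (intro nn_integral_mono)
    fix X
    have c1: "1 \<le> covdet n w K X" by (rule c)
    then have "ln (covdet n w K X / T) \<le> covdet n w K X / T - 1"
      using T by (intro ln_le_minus_one) auto
    then have "ln (covdet n w K X) + 1 \<le> ln T + covdet n w K X / T"
      using c1 T by (simp add: ln_div)
    then show "ennreal (ln (covdet n w K X)) + 1 \<le> ennreal (ln T) + ennreal (1 / T) * ennreal (covdet n w K X)"
      using c1 T T1 by (simp add: ennreal_mult'[symmetric] flip: ennreal_plus ennreal_1)
  qed
  also have "\<dots> = ennreal (ln T) + ennreal (1 / T) * (\<integral>\<^sup>+X. ennreal (covdet n w K X) \<partial>gauss_mat n K)"
    using GM.emeasure_space_1 by (subst nn_integral_add) (auto simp: nn_integral_cmult)
  also have "\<dots> \<le> ennreal (ln T) + ennreal (1 / T) * ennreal T"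
    by (intro add_left_mono mult_left_mono E) auto
  also have "ennreal (1 / T) * ennreal T = 1"
    using T by (simp add: ennreal_mult'[symmetric])
  finally have "1 + mean_ln_covdet n w K \<le> 1 + ennreal (ln T)"
    by (simp add: add.commute)
  then show ?thesis unfolding lnT[symmetric] by (simp add: ennreal_add_left_cancel_le)
qed

text \<open>The mirror image of the upper bound: the same logarithm inequality, applied to exp a / x
  instead of x / T. A negative \<open>a\<close> is sent to 0 by \<open>ennreal\<close>.\<close>

lemma mean_ln_covdet_ge:
  assumes w: "\<And>k. k < K \<Longrightarrow> 0 \<le> w k"
    and E: "(\<integral>\<^sup>+X. ennreal (1 / covdet n w K X) \<partial>gauss_mat n K) \<le> ennreal (exp (- a))"
  shows "ennreal a \<le> mean_ln_covdet n w K"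
proof (cases "0 \<le> a")
  case a: True
  interpret GM: prob_space "gauss_mat n K" by (rule prob_space_gauss_mat)
  have c: "1 \<le> covdet n w K X" for X by (rule covdet_ge_1[OF w])
  have "ennreal a + 1 = (\<integral>\<^sup>+X. ennreal a + 1 \<partial>gauss_mat n K)"
    using GM.emeasure_space_1 by simp
  also have "\<dots> \<le> (\<integral>\<^sup>+X. ennreal (ln (covdet n w K X)) + ennreal (exp a) * ennreal (1 / covdet n w K X) \<partial>gauss_mat n K)"
  proof (intro nn_integral_mono)
    fix X
    have c1: "1 \<le> covdet n w K X" by (rule c)
    then have "ln (exp a / covdet n w K X) \<le> exp a / covdet n w K X - 1"
      by (intro ln_le_minus_one) auto
    then have "a + 1 \<le> ln (covdet n w K X) + exp a / covdet n w K X"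
      using c1 by (simp add: ln_div)
    then show "ennreal a + 1 \<le> ennreal (ln (covdet n w K X)) + ennreal (exp a) * ennreal (1 / covdet n w K X)"
      using c1 a by (simp add: ennreal_mult'[symmetric] flip: ennreal_plus ennreal_1)
  qed
  also have "\<dots> = mean_ln_covdet n w K + ennreal (exp a) * (\<integral>\<^sup>+X. ennreal (1 / covdet n w K X) \<partial>gauss_mat n K)"
    unfolding mean_ln_covdet_def by (subst nn_integral_add) (auto simp: nn_integral_cmult)
  also have "\<dots> \<le> mean_ln_covdet n w K + ennreal (exp a) * ennreal (exp (- a))"
    by (intro add_left_mono mult_left_mono E) auto
  also have "ennreal (exp a) * ennreal (exp (- a)) = 1"
    by (simp add: ennreal_mult'[symmetric] mult_exp_exp)
  finally have "1 + ennreal a \<le> 1 + mean_ln_covdet n w K"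
    by (simp add: add.commute)
  then show ?thesis by (simp add: ennreal_add_left_cancel_le)
next
  case False
  then show ?thesis by (simp add: ennreal_neg)
qed

section \<open>Negative powers of an Erlang variable\<close>

lemma gauss_vec_norm_square_erlang:
  assumes n: "1 \<le> n"
  shows "distributed (gauss_vec n) lborel (\<lambda>z. \<Sum>i<n. (cmod (z i))\<^sup>2) (erlang_density (n - 1) 1)"
proof -
  have comp: "(\<lambda>z. z i) \<in> gauss_vec n \<rightarrow>\<^sub>M cgauss" if "i < n" for i
    using that by (intro measurable_component_singleton) auto
  have law: "distr (gauss_vec n) cgauss (\<lambda>z. z i) = cgauss" if "i < n" for i
    using that by (intro distr_PiM_component prob_space_cgauss) auto
  have "distributed (gauss_vec n) lborel (\<lambda>z. (cmod (z i))\<^sup>2) (exponential_density 1)" if "i < n" for i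
  proof -
    have "distr (gauss_vec n) lborel (\<lambda>z. (cmod (z i))\<^sup>2) = distr (distr (gauss_vec n) cgauss (\<lambda>z. z i)) lborel (\<lambda>z. (cmod z)\<^sup>2)"
      using comp[OF that] by (subst distr_distr) (auto simp: comp_def)
    also have "\<dots> = density lborel (exponential_density 1)"
      using cgauss_norm_square_exponential unfolding law[OF that] by (simp add: distributed_def)
    finally show ?thesis
      using measurable_compose[OF comp[OF that], of "\<lambda>z. (cmod z)\<^sup>2" lborel]
      by (simp add: distributed_def)
  qed
  moreover have "prob_space.indep_vars (gauss_vec n) (\<lambda>_. borel) (\<lambda>i z. (cmod (z i))\<^sup>2) {..<n}"
  proof (rule prob_space.indep_vars_compose2[OF prob_space_gauss_vec,
        where M' = "\<lambda>_. cgauss" and X = "\<lambda>i z. z i" and Y = "\<lambda>_ z. (cmod z)\<^sup>2"])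
    have "distr (gauss_vec n) (gauss_vec n) (\<lambda>z. \<lambda>i\<in>{..<n}. z i) = distr (gauss_vec n) (gauss_vec n) (\<lambda>z. z)"
      by (intro distr_cong refl) (auto simp: space_PiM PiE_restrict)
    then show "prob_space.indep_vars (gauss_vec n) (\<lambda>_. cgauss) (\<lambda>i z. z i) {..<n}"
      using n comp law by (subst prob_space.indep_vars_iff_distr_eq_PiM'[OF prob_space_gauss_vec])
        (auto simp: lessThan_empty_iff intro!: PiM_cong)
  qed simp
  \<comment> \<open>The shape parameter counts from 0: \<open>erlang_density k\<close> is the law of
    a sum of k + 1 exponentials, hence n - 1.\<close>
  ultimately show ?thesis
    using n prob_space.exponential_distributed_sum[OF prob_space_gauss_vec,
        where I = "{..<n}" and l = 1 and X = "\<lambda>i z. (cmod (z i))\<^sup>2"]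
    by (auto simp: lessThan_empty_iff)
qed

text \<open>Stirling's formula is used up to O(ln n) only, an error that disappears on dividing by
  N. This half is one term of the series of exp n.\<close>

lemma ln_fact_ge: "real n * ln (real n) - real n \<le> ln (fact n)"
proof (cases "n = 0")
  case False
  have "(\<Sum>k\<in>{n}. real n ^ k /\<^sub>R fact k) \<le> exp (real n)"
    unfolding exp_def by (rule sum_le_suminf[OF summable_exp_generic]) auto
  then have "real n ^ n \<le> exp (real n) * fact n"
    by (simp add: field_simps)
  then have "ln (real n ^ n) \<le> ln (exp (real n) * fact n)"
    using False by (subst ln_le_cancel_iff) auto
  then show ?thesis using False by (simp add: ln_realpow ln_mult)
qed simp

lemma ln_fact_le:
  assumes "1 \<le> n"
  shows "ln (fact n) \<le> real n * ln (real n) - real n + ln (real n) + 1"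
  using assms
proof (induction n rule: dec_induct)
  case (step n)
  have "1 / (real n + 1) \<le> ln (real n + 1) - ln (real n)"
  proof -
    have "ln (real n / (real n + 1)) \<le> real n / (real n + 1) - 1"
      using step by (intro ln_le_minus_one) auto
    then show ?thesis using step by (simp add: ln_div field_simps)
  qed
  then have "1 \<le> (real n + 1) * (ln (real n + 1) - ln (real n))"
    by (simp add: field_simps)
  moreover have "ln (fact (Suc n) :: real) = ln (real n + 1) + ln (fact n)"
    by (simp add: ln_mult add.commute del: of_nat_Suc flip: of_nat_Suc)
  ultimately show ?case using step by (simp add: algebra_simps)
qed simp

text \<open>One gets this rate by comparing \<open>t powr a * exp (- t)\<close> with its maximum; the factor
  \<open>exp (- t / n)\<close> is kept to make the integral finite.\<close>
lemma erlang_neg_power: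
  fixes n :: nat and \<eta> \<sigma> :: real
  assumes n: "1 \<le> n" and \<eta>: "0 < \<eta>" and \<sigma>: "0 \<le> \<sigma>" "\<sigma> < 1" "1 \<le> real n * (1 - \<sigma>)"
  shows "(\<integral>\<^sup>+t. ennreal (erlang_density (n - 1) 1 t) * ennreal ((t / (n * \<eta>)) powr (- (n * \<sigma>))) \<partial>lborel) \<le>
    ennreal (exp 1 * n / (1 - \<sigma>) * exp (n * (\<sigma> * ln \<eta> + (1 - \<sigma>) * ln (1 - \<sigma>) + \<sigma>)))"
proof -
  define c where "c = 1 - \<sigma>"
  have c: "0 < c" "c \<le> 1" "1 \<le> n * c" using \<sigma> by (auto simp: c_def)
  define C where "C = exp (n * \<sigma> * ln (n * \<eta>) - ln (fact (n - 1)) + (n * c - 1) * (ln (n * c) - 1))"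
  have C0: "0 \<le> C" by (simp add: C_def)
  have pt: "erlang_density (n - 1) 1 t * (t / (n * \<eta>)) powr (- (n * \<sigma>)) \<le> C * exp (- t / n)" if t: "0 < t" for t
  proof -
    \<comment> \<open>The tangent to ln is taken at n c, next to the mode n c - 1 of the tilted
      density. At the mode itself t would cancel completely; here t / (n c) remains, and since c
      \<le> 1 this is at least t / n, the source of the integrable factor.\<close>
    have "(n * c - 1) * (ln t - ln (n * c)) \<le> (n * c - 1) * (t / (n * c) - 1)"
      using c t n ln_le_minus_one[of "t / (n * c)"] by (intro mult_left_mono) (auto simp: ln_div)
    also have "(n * c - 1) * (t / (n * c) - 1) = t - t / (n * c) - (n * c - 1)"
      using c n by (simp add: field_simps)
    also have "\<dots> \<le> t - t / n - (n * c - 1)"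
      using c n t by (simp add: frac_le mult_le_cancel_left1)
    finally have *: "(n * c - 1) * ln t - t \<le> (n * c - 1) * (ln (n * c) - 1) - t / n"
      by (simp add: algebra_simps)
    have "erlang_density (n - 1) 1 t * (t / (n * \<eta>)) powr (- (n * \<sigma>)) =
      exp (real (n - 1) * ln t - t - ln (fact (n - 1)) - (n * \<sigma>) * (ln t - ln (n * \<eta>)))"
    proof -
      define m where "m = n - 1"
      have "t ^ m = exp (real m * ln t)" using t by (simp add: exp_of_nat_mult)
      moreover have "(t / (n * \<eta>)) powr (- (n * \<sigma>)) = exp (- ((n * \<sigma>) * (ln t - ln (n * \<eta>))))"
        using t n \<eta> by (simp add: powr_def ln_div)
      moreover have "fact m = exp (ln (fact m :: real))" by simp
      ultimately show ?thesis
        unfolding m_def[symmetric] using t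
        by (simp add: erlang_density_def exp_diff exp_minus divide_inverse mult_ac)
    qed
    also have "real (n - 1) * ln t - t - ln (fact (n - 1)) - (n * \<sigma>) * (ln t - ln (n * \<eta>)) =
      ((n * c - 1) * ln t - t) - ln (fact (n - 1)) + n * \<sigma> * ln (n * \<eta>)"
      using n by (simp add: c_def of_nat_diff algebra_simps)
    also have "exp \<dots> \<le> exp (((n * c - 1) * (ln (n * c) - 1) - t / n) - ln (fact (n - 1)) + n * \<sigma> * ln (n * \<eta>))"
      using * by simp
    also have "\<dots> = C * exp (- t / n)"
      unfolding C_def mult_exp_exp by (simp add: algebra_simps)
    finally show ?thesis .
  qed
  have "(\<integral>\<^sup>+t. ennreal (erlang_density (n - 1) 1 t) * ennreal ((t / (n * \<eta>)) powr (- (n * \<sigma>))) \<partial>lborel) \<le>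
    (\<integral>\<^sup>+t. ennreal C * (ennreal (exp (- t / n)) * indicator {0..} t) \<partial>lborel)"
  proof (rule nn_integral_mono_AE, rule AE_mp[OF AE_lborel_singleton[of 0]], rule AE_I2, rule impI)
    fix t :: real assume "t \<noteq> 0"
    then consider "t < 0" | "0 < t" by linarith
    then show "ennreal (erlang_density (n - 1) 1 t) * ennreal ((t / (n * \<eta>)) powr (- (n * \<sigma>))) \<le>
      ennreal C * (ennreal (exp (- t / n)) * indicator {0..} t)"
    proof cases
      case 1
      then show ?thesis by (simp add: erlang_density_def)
    next
      case 2
      have "ennreal (erlang_density (n - 1) 1 t) * ennreal ((t / (n * \<eta>)) powr (- (n * \<sigma>))) =
        ennreal (erlang_density (n - 1) 1 t * (t / (n * \<eta>)) powr (- (n * \<sigma>)))"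
        by (rule ennreal_mult[symmetric]) auto
      also have "\<dots> \<le> ennreal (C * exp (- t / n))"
        by (rule ennreal_leI) (rule pt[OF 2])
      also have "\<dots> = ennreal C * (ennreal (exp (- t / n)) * indicator {0..} t)"
        using 2 C0 by (simp add: ennreal_mult)
      finally show ?thesis .
    qed
  qed
  also have "\<dots> = ennreal C * ennreal (0 - (- (real n * exp (- 0 / real n))))"
  proof (subst nn_integral_cmult)
    have "((\<lambda>t. - (real n * exp (- t / real n))) \<longlongrightarrow> 0) at_top"
      using n by real_asymp
    then show "ennreal C * (\<integral>\<^sup>+t. ennreal (exp (- t / n)) * indicator {0..} t \<partial>lborel) = ennreal C * ennreal (0 - (- (real n * exp (- 0 / real n))))"
      using n by (subst nn_integral_FTC_atLeast[where F="\<lambda>t. - (real n * exp (- t / real n))"])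
        (auto intro!: derivative_eq_intros)
  qed measurable
  also have "\<dots> = ennreal (C * n)"
    using C0 by (simp add: ennreal_mult)
  also have "\<dots> \<le> ennreal (exp 1 * n / (1 - \<sigma>) * exp (n * (\<sigma> * ln \<eta> + (1 - \<sigma>) * ln (1 - \<sigma>) + \<sigma>)))"
  proof (rule ennreal_leI)
    have "ln (fact n :: real) = ln (real n) + ln (fact (n - 1))"
      using n by (subst fact_reduce) (auto simp: ln_mult)
    then have f: "- ln (fact (n - 1)) \<le> ln (real n) - n * ln (real n) + n"
      using ln_fact_ge[of n] by simp
    have l: "ln (n * c) = ln (real n) + ln c" "ln (n * \<eta>) = ln (real n) + ln \<eta>"
      using n c \<eta> by (auto simp: ln_mult)
    have "C * n = exp (n * \<sigma> * ln (n * \<eta>) - ln (fact (n - 1)) + (n * c - 1) * (ln (n * c) - 1) + ln (real n))"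
      using n by (simp add: C_def exp_add)
    also have "\<dots> \<le> exp (n * \<sigma> * ln (n * \<eta>) + (ln (real n) - n * ln (real n) + n) + (n * c - 1) * (ln (n * c) - 1) + ln (real n))"
      using f by simp
    also have "n * \<sigma> * ln (n * \<eta>) + (ln (real n) - n * ln (real n) + n) + (n * c - 1) * (ln (n * c) - 1) + ln (real n) =
      1 + ln (real n) - ln c + n * (\<sigma> * ln \<eta> + c * ln c + \<sigma>)"
      unfolding l by (simp add: c_def algebra_simps)
    also have "exp \<dots> = exp 1 * n / c * exp (n * (\<sigma> * ln \<eta> + c * ln c + \<sigma>))"
      using n c by (simp add: exp_add exp_diff)
    finally show "C * n \<le> exp 1 * n / (1 - \<sigma>) * exp (n * (\<sigma> * ln \<eta> + (1 - \<sigma>) * ln (1 - \<sigma>) + \<sigma>))"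
      by (simp add: c_def)
  qed
  finally show ?thesis .
qed


text \<open>Weighted AM-GM: with s = w y / (1 + w y), the quotient (1 + w t) / (1 + w y) is the mean
  of 1 and t / y with weights 1 - s and s, hence at least (t / y)^s. Equivalently, ln (1 + w exp u)
  is convex and lies above its tangent at u = ln y. Powers multiply over the columns, so that only
  the sum of the slopes matters.\<close>

lemma inverse_one_plus_le_powr:
  fixes w y t :: real
  assumes "0 \<le> w" "0 < y" "0 < t"
  shows "1 / (1 + w * t) \<le> 1 / (1 + w * y) * (t / y) powr (- (w * y / (1 + w * y)))"
proof -
  define s where "s = w * y / (1 + w * y)"
  have pos: "0 < 1 + w * y" "0 < 1 + w * t" using assms by (simp_all add: add_pos_nonneg)
  have s: "0 \<le> s" "s \<le> 1" using assms pos by (auto simp: s_def field_simps)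
  have "s * ln (t / y) \<le> ln ((1 + w * t) / (1 + w * y))"
  proof -
    have "1 + s * (t / y - 1) = (1 + w * t) / (1 + w * y)"
    proof -
      define D where "D = 1 + w * y"
      have D: "0 < D" using pos by (simp add: D_def)
      have "1 + s * (t / y - 1) = 1 + w * (t - y) / D"
        unfolding s_def D_def[symmetric] using D assms by (simp add: field_simps)
      also have "\<dots> = (D + w * (t - y)) / D"
        using D by (simp add: add_divide_distrib)
      also have "D + w * (t - y) = 1 + w * t"
        by (simp add: D_def algebra_simps)
      finally show ?thesis by (simp add: D_def)
    qed
    moreover have "exp (s * ln (t / y)) \<le> 1 + s * (t / y - 1)"
    proof -
      have "exp ((1 - s) *\<^sub>R 0 + s *\<^sub>R ln (t / y)) \<le> (1 - s) * exp 0 + s * exp (ln (t / y))"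
        using s by (intro convex_onD[OF exp_convex]) auto
      then show ?thesis using assms by (simp add: algebra_simps)
    qed
    ultimately have "exp (s * ln (t / y)) \<le> (1 + w * t) / (1 + w * y)" by simp
    then show ?thesis using pos by (subst ln_ge_iff) auto
  qed
  then have "exp (- ln ((1 + w * t) / (1 + w * y))) \<le> exp (- s * ln (t / y))" by simp
  then have "(1 + w * y) / (1 + w * t) \<le> (t / y) powr (- s)"
    using assms pos by (simp add: powr_def exp_minus)
  then have "1 / (1 + w * y) * ((1 + w * y) / (1 + w * t)) \<le> 1 / (1 + w * y) * (t / y) powr (- s)"
    using pos by (intro mult_left_mono) auto
  then show ?thesis using pos by (simp add: s_def)
qed

text \<open>The parameter \<open>r\<close> absorbs the random normalisation of the weights by the trace.\<close>
lemma mean_ln_covdet_ge_tangent: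
  fixes n :: nat and \<eta> r y S \<sigma>1 \<sigma>2 \<tau> :: real
  assumes w: "\<And>k. k < K \<Longrightarrow> 0 \<le> w k" and n: "1 \<le> n" and \<eta>: "0 < \<eta>" and r: "0 < r"
    and y: "y = n * \<eta> / r"
    and S: "S = (\<Sum>k<K. w k * y / (1 + w k * y))" "n * \<sigma>1 \<le> S" "S \<le> n * \<sigma>2"
    and \<sigma>: "0 \<le> \<sigma>1" "\<sigma>1 \<le> \<sigma>2" "\<sigma>2 < 1" "1 \<le> n * (1 - \<sigma>2)"
    and \<tau>: "\<sigma>1 * ln \<eta> + (1 - \<sigma>1) * ln (1 - \<sigma>1) + \<sigma>1 \<le> \<tau>" "\<sigma>2 * ln \<eta> + (1 - \<sigma>2) * ln (1 - \<sigma>2) + \<sigma>2 \<le> \<tau>"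
  shows "ennreal ((\<Sum>k<K. ln (1 + w k * y)) + S * ln r - n * \<tau> - ln (2 * exp 1 * n / (1 - \<sigma>2))) \<le> mean_ln_covdet n w K"
proof (rule mean_ln_covdet_ge[OF w])
  have y0: "0 < y" using n \<eta> r by (simp add: y)
  have pos: "0 < 1 + w k * y" if "k < K" for k
    using w[OF that] y0 by (simp add: add_pos_nonneg)
  define Q where "Q = exp (- (\<Sum>k<K. ln (1 + w k * y)) - S * ln r)"
  define e where "e \<sigma> t = (t / (n * \<eta>)) powr (- (n * \<sigma>))" for \<sigma> t :: real
  have le: "(\<Prod>k<K. 1 / (1 + w k * t)) \<le> Q * (e \<sigma>1 t + e \<sigma>2 t)" if t: "0 < t" for t
  proof -
    have "(\<Prod>k<K. 1 / (1 + w k * t)) \<le> (\<Prod>k<K. 1 / (1 + w k * y) * (t / y) powr (- (w k * y / (1 + w k * y))))"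
      using w t y0 by (intro prod_mono conjI inverse_one_plus_le_powr) (auto intro!: divide_nonneg_nonneg add_nonneg_nonneg)
    also have "\<dots> = (\<Prod>k<K. 1 / (1 + w k * y)) * (\<Prod>k<K. (t / y) powr (- (w k * y / (1 + w k * y))))"
      by (rule prod.distrib)
    also have "(\<Prod>k<K. (t / y) powr (- (w k * y / (1 + w k * y)))) = (t / y) powr (- S)"
      using t y0 by (subst powr_sum[symmetric]) (auto simp: S(1) sum_negf)
    also have "(\<Prod>k<K. 1 / (1 + w k * y)) = exp (- (\<Sum>k<K. ln (1 + w k * y)))"
      using pos by (simp add: exp_sum sum_negf[symmetric] exp_minus divide_inverse)
    also have "(t / y) powr (- S) = exp (- S * ln r) * (t / (n * \<eta>)) powr (- S)"
      using t n \<eta> r by (simp add: y powr_def ln_div ln_mult mult_exp_exp algebra_simps)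
    \<comment> \<open>S is only known to lie between n \<sigma>1 and n \<sigma>2. A base at least 1
      is served by the smaller exponent, a base below 1 by the larger one, and the sum covers both;
      hence the factor 2 in the statement.\<close>
    also have "(t / (n * \<eta>)) powr (- S) \<le> e \<sigma>1 t + e \<sigma>2 t"
    proof (cases "1 \<le> t / (n * \<eta>)")
      case True
      have "(t / (n * \<eta>)) powr (- S) \<le> e \<sigma>1 t"
        unfolding e_def using S True by (intro powr_mono) auto
      then show ?thesis by (simp add: e_def add_increasing2)
    next
      case False
      have "(t / (n * \<eta>)) powr (- S) \<le> e \<sigma>2 t"
        unfolding e_def using S False t n \<eta> by (intro powr_mono') auto
      then show ?thesis by (simp add: e_def add_increasing)
    qed
    finally show ?thesis
      by (simp add: Q_def exp_diff exp_minus divide_inverse mult.assoc)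
  qed
  have bound: "(\<integral>\<^sup>+t. ennreal (erlang_density (n - 1) 1 t) * ennreal (e \<sigma> t) \<partial>lborel) \<le> ennreal (exp 1 * n / (1 - \<sigma>2) * exp (n * \<tau>))"
    if "0 \<le> \<sigma>" "\<sigma> \<le> \<sigma>2" "\<sigma> * ln \<eta> + (1 - \<sigma>) * ln (1 - \<sigma>) + \<sigma> \<le> \<tau>" for \<sigma>
  proof -
    have "n * (1 - \<sigma>2) \<le> n * (1 - \<sigma>)" using that by (intro mult_left_mono) auto
    then have "1 \<le> n * (1 - \<sigma>)" using \<sigma>(4) by linarith
    then have "(\<integral>\<^sup>+t. ennreal (erlang_density (n - 1) 1 t) * ennreal (e \<sigma> t) \<partial>lborel) \<le>
      ennreal (exp 1 * n / (1 - \<sigma>) * exp (n * (\<sigma> * ln \<eta> + (1 - \<sigma>) * ln (1 - \<sigma>) + \<sigma>)))"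
      unfolding e_def using that \<sigma> n \<eta> by (intro erlang_neg_power) auto
    also have "\<dots> \<le> ennreal (exp 1 * n / (1 - \<sigma>2) * exp (n * \<tau>))"
      using that \<sigma> n by (intro ennreal_leI mult_mono frac_le) (auto intro!: mult_left_mono)
    finally show ?thesis .
  qed
  have Q0: "0 \<le> Q" by (simp add: Q_def)
  have "(\<integral>\<^sup>+X. ennreal (1 / covdet n w K X) \<partial>gauss_mat n K) =
    (\<integral>\<^sup>+z. ennreal (\<Prod>k<K. 1 / (1 + w k * (\<Sum>i<n. (cmod (z i))\<^sup>2))) \<partial>gauss_vec n)"
    by (rule nn_integral_inverse_covdet[OF w])
  also have "\<dots> = (\<integral>\<^sup>+t. ennreal (erlang_density (n - 1) 1 t) * ennreal (\<Prod>k<K. 1 / (1 + w k * t)) \<partial>lborel)"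
    by (rule distributed_nn_integral[OF gauss_vec_norm_square_erlang[OF n], symmetric]) measurable
  also have "\<dots> \<le> (\<integral>\<^sup>+t. ennreal Q * (ennreal (erlang_density (n - 1) 1 t) * ennreal (e \<sigma>1 t) +
      ennreal (erlang_density (n - 1) 1 t) * ennreal (e \<sigma>2 t)) \<partial>lborel)"
  proof (rule nn_integral_mono_AE, rule AE_mp[OF AE_lborel_singleton[of 0]], rule AE_I2, rule impI)
    fix t :: real assume "t \<noteq> 0"
    then consider "t < 0" | "0 < t" by linarith
    then show "ennreal (erlang_density (n - 1) 1 t) * ennreal (\<Prod>k<K. 1 / (1 + w k * t)) \<le>
      ennreal Q * (ennreal (erlang_density (n - 1) 1 t) * ennreal (e \<sigma>1 t) +
      ennreal (erlang_density (n - 1) 1 t) * ennreal (e \<sigma>2 t))"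
    proof cases
      case 1
      then show ?thesis by (simp add: erlang_density_def)
    next
      case 2
      have "ennreal (erlang_density (n - 1) 1 t) * ennreal (\<Prod>k<K. 1 / (1 + w k * t)) \<le>
        ennreal (erlang_density (n - 1) 1 t) * ennreal (Q * (e \<sigma>1 t + e \<sigma>2 t))"
        by (intro mult_left_mono ennreal_leI le 2) auto
      also have "\<dots> = ennreal Q * (ennreal (erlang_density (n - 1) 1 t) * ennreal (e \<sigma>1 t) +
        ennreal (erlang_density (n - 1) 1 t) * ennreal (e \<sigma>2 t))"
        using Q0 by (simp add: ennreal_mult ennreal_plus e_def distrib_left mult_ac)
      finally show ?thesis .
    qed
  qed
  also have "\<dots> = ennreal Q * ((\<integral>\<^sup>+t. ennreal (erlang_density (n - 1) 1 t) * ennreal (e \<sigma>1 t) \<partial>lborel) +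
      (\<integral>\<^sup>+t. ennreal (erlang_density (n - 1) 1 t) * ennreal (e \<sigma>2 t) \<partial>lborel))"
    unfolding e_def by (subst nn_integral_cmult, measurable, subst nn_integral_add, measurable)
  also have "\<dots> \<le> ennreal Q * (ennreal (exp 1 * n / (1 - \<sigma>2) * exp (n * \<tau>)) + ennreal (exp 1 * n / (1 - \<sigma>2) * exp (n * \<tau>)))"
    using \<sigma> \<tau> by (intro mult_left_mono add_mono bound) auto
  also have "\<dots> = ennreal (Q * (2 * exp 1 * n / (1 - \<sigma>2)) * exp (n * \<tau>))"
    using \<sigma> Q0 by (simp add: ennreal_mult[symmetric] flip: ennreal_plus)
  also have "Q * (2 * exp 1 * n / (1 - \<sigma>2)) * exp (n * \<tau>) =
      exp (- ((\<Sum>k<K. ln (1 + w k * y)) + S * ln r - n * \<tau> - ln (2 * exp 1 * n / (1 - \<sigma>2))))"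
  proof -
    have "2 * exp 1 * n / (1 - \<sigma>2) = exp (ln (2 * exp 1 * n / (1 - \<sigma>2)))"
      using n \<sigma> by (subst exp_ln) auto
    then have "Q * (2 * exp 1 * n / (1 - \<sigma>2)) * exp (n * \<tau>) = Q * exp (ln (2 * exp 1 * n / (1 - \<sigma>2))) * exp (n * \<tau>)"
      by (simp only:)
    also have "\<dots> = exp ((- (\<Sum>k<K. ln (1 + w k * y)) - S * ln r) + ln (2 * exp 1 * n / (1 - \<sigma>2)) + n * \<tau>)"
      by (simp only: Q_def mult_exp_exp)
    also have "(- (\<Sum>k<K. ln (1 + w k * y)) - S * ln r) + ln (2 * exp 1 * n / (1 - \<sigma>2)) + n * \<tau> =
      - ((\<Sum>k<K. ln (1 + w k * y)) + S * ln r - n * \<tau> - ln (2 * exp 1 * n / (1 - \<sigma>2)))"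
      by linarith
    finally show ?thesis .
  qed
  finally show "(\<integral>\<^sup>+X. ennreal (1 / covdet n w K X) \<partial>gauss_mat n K) \<le>
    ennreal (exp (- ((\<Sum>k<K. ln (1 + w k * y)) + S * ln r - n * \<tau> - ln (2 * exp 1 * n / (1 - \<sigma>2)))))" .
qed


section \<open>Laws of large numbers\<close>


lemma (in prob_space) identically_distributed_integral:
  fixes X Y :: "'a \<Rightarrow> real"
  assumes "random_variable borel X" "random_variable borel Y" "distr M borel X = distr M borel Y"
  shows "integrable M X \<longleftrightarrow> integrable M Y" "expectation X = expectation Y"
proof -
  have "integrable M Z \<longleftrightarrow> integrable (distr M borel Z) (\<lambda>x. x)" "expectation Z = (\<integral>x. x \<partial>distr M borel Z)"
    if "random_variable borel Z" for Z :: "'a \<Rightarrow> real"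
    using that by (simp_all add: integrable_distr_eq integral_distr)
  then show "integrable M X \<longleftrightarrow> integrable M Y" "expectation X = expectation Y"
    using assms by metis+
qed

text \<open>Only the large values of \<open>X\<close> are unbounded, and these help: truncate and apply Hoeffding's inequality.\<close>
lemma (in prob_space) iid_nonneg_lower_tail:
  fixes X :: "nat \<Rightarrow> 'a \<Rightarrow> real"
  assumes ind: "indep_vars (\<lambda>_. borel) X UNIV"
    and distr: "\<And>m. distr M borel (X m) = distr M borel (X 0)"
    and nonneg: "\<And>m x. x \<in> space M \<Longrightarrow> 0 \<le> X m x"
    and int: "integrable M (X 0)"
    and e: "0 < \<epsilon>"
  shows "\<exists>c>0. \<forall>K\<ge>1. prob {x \<in> space M. (\<Sum>m<K. X m x) \<le> real K * (expectation (X 0) - \<epsilon>)} \<le> exp (- c * real K)"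
proof -
  have rv [measurable]: "random_variable borel (X m)" for m
    using ind by (auto simp: indep_vars_def)
  have "(\<lambda>b. expectation (\<lambda>x. min (X 0 x) (real b))) \<longlonglongrightarrow> expectation (X 0)"
  proof (rule integral_dominated_convergence[where w="\<lambda>x. \<bar>X 0 x\<bar>"])
    show "AE x in M. (\<lambda>b. min (X 0 x) (real b)) \<longlonglongrightarrow> X 0 x"
    proof (rule AE_I2)
      fix x
      have "\<forall>\<^sub>F b in sequentially. X 0 x = min (X 0 x) (real b)"
        using eventually_ge_at_top[of "nat \<lceil>X 0 x\<rceil>"] by eventually_elim linarith
      then show "(\<lambda>b. min (X 0 x) (real b)) \<longlonglongrightarrow> X 0 x"
        by (rule Lim_transform_eventually[OF tendsto_const])
    qed
    show "AE x in M. norm (min (X 0 x) (real b)) \<le> \<bar>X 0 x\<bar>" for b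
      using nonneg by (intro AE_I2) (auto simp: min_def)
  qed (use int in auto)
  then have "\<forall>\<^sub>F b in sequentially. expectation (X 0) - \<epsilon> / 2 < expectation (\<lambda>x. min (X 0 x) (real b))"
    using e by (intro order_tendstoD(1)[of _ "expectation (X 0)"]) auto
  then have "\<forall>\<^sub>F b in sequentially. expectation (X 0) - \<epsilon> / 2 < expectation (\<lambda>x. min (X 0 x) (real b)) \<and> 1 \<le> b"
    using eventually_ge_at_top[of 1] by eventually_elim auto
  then obtain b :: nat where b: "1 \<le> b" "expectation (X 0) - \<epsilon> / 2 < expectation (\<lambda>x. min (X 0 x) (real b))"
    by (auto simp: eventually_at_top_linorder)
  \<comment> \<open>Half of \<epsilon> pays for the truncation at b, the other half is the deviation
    in Hoeffding's bound, whose exponent is 2 (K \<epsilon> / 2)^2 / (K b^2) = c K.\<close>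
  define c where "c = \<epsilon>\<^sup>2 / (2 * (real b)\<^sup>2)"
  have "prob {x \<in> space M. (\<Sum>m<K. X m x) \<le> real K * (expectation (X 0) - \<epsilon>)} \<le> exp (- c * real K)" if K: "1 \<le> K" for K
  proof -
    interpret H: Hoeffding_ineq_iid M "{..<K}" "\<lambda>m x. min (X m x) (real b)" "\<lambda>x. min (X 0 x) (real b)" 0 "real b"
      "expectation (\<lambda>x. min (X 0 x) (real b))"
    proof unfold_locales
      show "indep_vars (\<lambda>_. borel) (\<lambda>m x. min (X m x) (real b)) {..<K}"
        by (rule indep_vars_compose2[OF indep_vars_subset[OF ind]]) auto
      show "distr M borel (\<lambda>x. min (X m x) (real b)) = distr M borel (\<lambda>x. min (X 0 x) (real b))" for m
      proof -
        have "distr M borel (\<lambda>x. min (X m x) (real b)) = distr (distr M borel (X m)) borel (\<lambda>y. min y (real b))" for m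
          by (subst distr_distr) (auto simp: comp_def)
        then show ?thesis using distr[of m] by simp
      qed
      show "AE x in M. min (X 0 x) (real b) \<in> {0..real b}"
        using nonneg by (intro AE_I2) auto
    qed auto
    have "prob {x \<in> space M. (\<Sum>m<K. X m x) \<le> real K * (expectation (X 0) - \<epsilon>)} \<le>
      prob {x \<in> space M. (\<Sum>m<K. min (X m x) (real b)) \<le> real (card {..<K}) * expectation (\<lambda>x. min (X 0 x) (real b)) - real K * \<epsilon> / 2}"
    proof (rule finite_measure_mono)
      have *: "real K * (expectation (X 0) - \<epsilon> / 2) \<le> real K * expectation (\<lambda>x. min (X 0 x) (real b))"
        using b by (intro mult_left_mono) auto
      have "(\<Sum>m<K. min (X m x) (real b)) \<le> real (card {..<K}) * expectation (\<lambda>x. min (X 0 x) (real b)) - real K * \<epsilon> / 2"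
        if "(\<Sum>m<K. X m x) \<le> real K * (expectation (X 0) - \<epsilon>)" for x
      proof -
        have "(\<Sum>m<K. min (X m x) (real b)) \<le> (\<Sum>m<K. X m x)"
          by (intro sum_mono) auto
        then show ?thesis using * that by (simp add: algebra_simps)
      qed
      then show "{x \<in> space M. (\<Sum>m<K. X m x) \<le> real K * (expectation (X 0) - \<epsilon>)} \<subseteq>
        {x \<in> space M. (\<Sum>m<K. min (X m x) (real b)) \<le> real (card {..<K}) * expectation (\<lambda>x. min (X 0 x) (real b)) - real K * \<epsilon> / 2}"
        by auto
    qed measurable
    also have "\<dots> \<le> exp (- 2 * (real K * \<epsilon> / 2)\<^sup>2 / (real (card {..<K}) * (real b - 0)\<^sup>2))"
    proof (rule H.Hoeffding_ineq_le)
      show "0 \<le> real K * \<epsilon> / 2" using e by simp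
      show "0 < real b" using b(1) by simp
      show "{..<K} \<noteq> {}" using K by (metis One_nat_def Suc_le_lessD empty_iff lessThan_iff)
    qed
    also have "- 2 * (real K * \<epsilon> / 2)\<^sup>2 / (real (card {..<K}) * (real b - 0)\<^sup>2) = - c * real K"
      using K by (simp add: c_def power_mult_distrib power_divide power2_eq_square)
    finally show ?thesis .
  qed
  moreover have "0 < c" using e b by (simp add: c_def)
  ultimately show ?thesis by blast
qed

text \<open>For nonnegative variables the lower tail controls the negative part of the centred
  mean, and the positive part has the same expectation.\<close>
lemma (in prob_space) iid_nonneg_L1_lln:
  fixes X :: "nat \<Rightarrow> 'a \<Rightarrow> real"
  assumes ind: "indep_vars (\<lambda>_. borel) X UNIV"
    and distr: "\<And>m. distr M borel (X m) = distr M borel (X 0)"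
    and nonneg: "\<And>m x. x \<in> space M \<Longrightarrow> 0 \<le> X m x"
    and int: "integrable M (X 0)"
  shows "(\<lambda>K. expectation (\<lambda>x. \<bar>(\<Sum>m<K. X m x) / real K - expectation (X 0)\<bar>)) \<longlonglongrightarrow> 0"
proof (rule tendstoI)
  fix e :: real assume e: "0 < e"
  have rv [measurable]: "random_variable borel (X m)" for m
    using ind by (auto simp: indep_vars_def)
  let ?\<mu> = "expectation (X 0)"
  have \<mu>: "0 \<le> ?\<mu>" using nonneg by (intro integral_nonneg_AE AE_I2) auto
  have intX: "integrable M (X m)" and EX: "expectation (X m) = ?\<mu>" for m
    using identically_distributed_integral[OF rv rv distr, of m] int by simp_all
  obtain c where c: "0 < c" "\<And>K. 1 \<le> K \<Longrightarrow> prob {x \<in> space M. (\<Sum>m<K. X m x) \<le> real K * (?\<mu> - e / 4)} \<le> exp (- c * real K)"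
    using iid_nonneg_lower_tail[OF ind distr nonneg int, of "e / 4"] e by auto
  have "((\<lambda>K. 2 * (e / 4 + ?\<mu> * exp (- c * real K))) \<longlongrightarrow> 2 * (e / 4 + ?\<mu> * 0)) sequentially"
    by (intro tendsto_intros) (use c(1) in real_asymp)
  then have "\<forall>\<^sub>F K in sequentially. 2 * (e / 4 + ?\<mu> * exp (- c * real K)) < e"
    by (rule order_tendstoD(2)) (use e in simp)
  then show "\<forall>\<^sub>F K in sequentially. dist (expectation (\<lambda>x. \<bar>(\<Sum>m<K. X m x) / real K - ?\<mu>\<bar>)) 0 < e"
    using eventually_ge_at_top[of 1]
  proof eventually_elim
    case (elim K)
    define Z where "Z x = (\<Sum>m<K. X m x) / real K - ?\<mu>" for x
    define B where "B = {x \<in> space M. (\<Sum>m<K. X m x) \<le> real K * (?\<mu> - e / 4)}"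
    have [measurable]: "B \<in> sets M" unfolding B_def by measurable
    have intB: "integrable M (\<lambda>x. indicator B x :: real)"
      by (intro integrable_real_indicator) (auto simp: emeasure_eq_measure)
    have intZ: "integrable M Z" unfolding Z_def using intX by auto
    have "(\<Sum>m<K. expectation (X m)) = (\<Sum>m<K. ?\<mu>)"
      by (rule sum.cong[OF refl EX])
    then have EZ: "expectation Z = 0"
      unfolding Z_def using intX elim by (simp add: prob_space Bochner_Integration.integral_sum)
    \<comment> \<open>|Z| is Z plus twice its negative part, which is at most e / 4 off
      \<open>B\<close> and at most the mean of \<open>X 0\<close> everywhere.\<close>
    have "expectation (\<lambda>x. \<bar>Z x\<bar>) \<le> expectation (\<lambda>x. Z x + 2 * (e / 4 + ?\<mu> * indicator B x))"
    proof (rule integral_mono)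
      fix x assume x: "x \<in> space M"
      have "0 \<le> (\<Sum>m<K. X m x) / real K" using nonneg[OF x] by (auto intro!: divide_nonneg_nonneg sum_nonneg)
      then have "- ?\<mu> \<le> Z x" by (simp add: Z_def)
      moreover have "- (e / 4) \<le> Z x" if "x \<notin> B"
        using that x elim by (simp add: Z_def B_def field_simps)
      ultimately show "\<bar>Z x\<bar> \<le> Z x + 2 * (e / 4 + ?\<mu> * indicator B x)"
        using e \<mu> by (cases "x \<in> B") auto
    qed (use intZ intB in \<open>auto intro!: Bochner_Integration.integrable_add\<close>)
    also have "\<dots> = expectation Z + (\<integral>x. 2 * (e / 4 + ?\<mu> * indicator B x) \<partial>M)"
      using intZ intB by (intro Bochner_Integration.integral_add) auto
    also have "\<dots> = 2 * (e / 4 + ?\<mu> * prob B)"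
      unfolding EZ using intB by (simp add: prob_space)
    also have "\<dots> \<le> 2 * (e / 4 + ?\<mu> * exp (- c * real K))"
      using c(2)[of K] elim \<mu> unfolding B_def by (intro mult_left_mono add_left_mono) auto
    also have "\<dots> < e" by (rule elim)
    finally have "expectation (\<lambda>x. \<bar>Z x\<bar>) < e" .
    then show ?case by (simp add: Z_def abs_of_nonneg)
  qed
qed


lemma (in prob_space) iid_nonneg_weak_law:
  fixes X :: "nat \<Rightarrow> 'a \<Rightarrow> real"
  assumes ind: "indep_vars (\<lambda>_. borel) X UNIV"
    and distr: "\<And>m. distr M borel (X m) = distr M borel (X 0)"
    and nonneg: "\<And>m x. x \<in> space M \<Longrightarrow> 0 \<le> X m x"
    and int: "integrable M (X 0)"
    and \<delta>: "0 < \<delta>"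
  shows "(\<lambda>K. prob {x \<in> space M. \<delta> \<le> \<bar>(\<Sum>m<K. X m x) / real K - expectation (X 0)\<bar>}) \<longlonglongrightarrow> 0"
proof -
  have rv [measurable]: "random_variable borel (X m)" for m
    using ind by (auto simp: indep_vars_def)
  have intX: "integrable M (X m)" for m
    using identically_distributed_integral(1)[OF rv rv distr, of m] int by simp
  have le: "prob {x \<in> space M. \<delta> \<le> \<bar>(\<Sum>m<K. X m x) / real K - expectation (X 0)\<bar>} \<le>
    expectation (\<lambda>x. \<bar>(\<Sum>m<K. X m x) / real K - expectation (X 0)\<bar>) / \<delta>" for K
    using intX \<delta> by (intro integral_Markov_inequality_measure[where A = "{}"]) auto
  have "(\<lambda>K. expectation (\<lambda>x. \<bar>(\<Sum>m<K. X m x) / real K - expectation (X 0)\<bar>) / \<delta>) \<longlonglongrightarrow> 0 / \<delta>"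
    using iid_nonneg_L1_lln[OF ind distr nonneg int] \<delta> by (intro tendsto_intros) auto
  then have lim: "(\<lambda>K. expectation (\<lambda>x. \<bar>(\<Sum>m<K. X m x) / real K - expectation (X 0)\<bar>) / \<delta>) \<longlonglongrightarrow> 0"
    by simp
  show ?thesis
    by (rule tendsto_sandwich[OF always_eventually always_eventually tendsto_const lim]) (use le in auto)
qed


section \<open>Random weights\<close>


text \<open>The situation of one cell: \<open>a\<close> holds the numerators of the weights,
  \<open>c\<close> the summands of the trace and \<open>s\<close> the noise term. For a given user
  \<open>a m\<close> and \<open>c m\<close> are functions of the same attenuations, so independence
  is assumed within each sequence only; each enters through its own law of large numbers.\<close>

locale iid_weights = prob_space M for M :: "'a measure" +
  fixes a c :: "nat \<Rightarrow> 'a \<Rightarrow> real" and s \<beta> \<eta> :: real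
  assumes a_indep: "indep_vars (\<lambda>_. borel) a UNIV" and c_indep: "indep_vars (\<lambda>_. borel) c UNIV"
    and a_distr: "\<And>m. distr M borel (a m) = distr M borel (a 0)"
    and c_distr: "\<And>m. distr M borel (c m) = distr M borel (c 0)"
    and a_pos: "\<And>m \<omega>. \<omega> \<in> space M \<Longrightarrow> 0 < a m \<omega>" and c_pos: "\<And>m \<omega>. \<omega> \<in> space M \<Longrightarrow> 0 < c m \<omega>"
    and c_int: "integrable M (c 0)" and ln_a_int: "integrable M (\<lambda>\<omega>. ln (1 + a 0 \<omega>))"
    and s_pos: "0 < s" and \<beta>_pos: "0 < \<beta>" and \<eta>: "0 < \<eta>" "\<eta> < 1"
    and fixed_point: "\<beta> * (1 - expectation (\<lambda>\<omega>. 1 / (1 + \<eta> * (a 0 \<omega> / (\<beta> * expectation (c 0)))))) = 1 - \<eta>"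
begin

text \<open>For K = \<beta> N the mean of the sum in the trace is exactly N \<theta>. Hence at y = N
  \<eta> the product of weight and y is close to \<eta> a / \<theta>, and \<open>V\<close> and
  \<open>W\<close> are the resulting value ln (1 + w y) and slope w y / (1 + w y).
  \<open>limit_value\<close> is \<open>Psi\<close> in natural logarithms.\<close>

definition \<theta> :: real where "\<theta> = \<beta> * expectation (c 0)"
definition V :: "nat \<Rightarrow> 'a \<Rightarrow> real" where "V k \<omega> = ln (1 + \<eta> * (a k \<omega> / \<theta>))"
definition W :: "nat \<Rightarrow> 'a \<Rightarrow> real" where "W k \<omega> = 1 - 1 / (1 + \<eta> * (a k \<omega> / \<theta>))"
definition trc :: "nat \<Rightarrow> 'a \<Rightarrow> real" where "trc K \<omega> = (\<Sum>m<K. c m \<omega>) + s"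
definition limit_value :: real where
  "limit_value = \<beta> * expectation (V 0) - ln \<eta> + \<eta> - 1"

lemma a_measurable [measurable]: "random_variable borel (a m)"
  using a_indep by (auto simp: indep_vars_def)

lemma c_measurable [measurable]: "random_variable borel (c m)"
  using c_indep by (auto simp: indep_vars_def)

lemma expectation_c_pos: "0 < expectation (c 0)"
proof -
  have "expectation (c 0) \<noteq> 0"
  proof
    assume "expectation (c 0) = 0"
    then have "AE \<omega> in M. c 0 \<omega> = 0"
      using c_int c_pos by (subst integral_nonneg_eq_0_iff_AE[symmetric]) (auto intro!: AE_I2 less_imp_le)
    then have "AE \<omega> in M. False"
      using AE_space by eventually_elim (metis c_pos less_irrefl)
    then show False by simp
  qed
  moreover have "0 \<le> expectation (c 0)" using c_pos by (intro integral_nonneg_AE AE_I2) (auto intro: less_imp_le)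
  ultimately show ?thesis by simp
qed

lemma \<theta>_pos: "0 < \<theta>"
  using expectation_c_pos \<beta>_pos by (simp add: \<theta>_def)

lemma A_pos: "\<omega> \<in> space M \<Longrightarrow> 0 < \<eta> * (a k \<omega> / \<theta>)"
  using a_pos \<theta>_pos \<eta> by simp

lemma V_measurable [measurable]: "random_variable borel (V k)"
  unfolding V_def by measurable

lemma W_measurable [measurable]: "random_variable borel (W k)"
  unfolding W_def by measurable

lemma V_nonneg: "\<omega> \<in> space M \<Longrightarrow> 0 \<le> V k \<omega>"
  using A_pos[of \<omega> k] by (simp add: V_def)

lemma W_bounds: "\<omega> \<in> space M \<Longrightarrow> 0 \<le> W k \<omega>" "\<omega> \<in> space M \<Longrightarrow> W k \<omega> \<le> 1"
  using A_pos[of \<omega> k] by (simp_all add: W_def)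

lemma function_of_a_iid:
  assumes [measurable]: "g \<in> borel_measurable borel"
  shows "indep_vars (\<lambda>_. borel) (\<lambda>k \<omega>. g (a k \<omega>) :: real) UNIV"
    and "distr M borel (\<lambda>\<omega>. g (a k \<omega>)) = distr M borel (\<lambda>\<omega>. g (a 0 \<omega>) :: real)"
proof -
  show "indep_vars (\<lambda>_. borel) (\<lambda>k \<omega>. g (a k \<omega>)) UNIV"
    by (rule indep_vars_compose2[OF a_indep]) simp
  have "distr M borel (\<lambda>\<omega>. g (a k \<omega>)) = distr (distr M borel (a k)) borel g" for k
    by (subst distr_distr) (auto simp: comp_def)
  then show "distr M borel (\<lambda>\<omega>. g (a k \<omega>)) = distr M borel (\<lambda>\<omega>. g (a 0 \<omega>))"
    by (simp add: a_distr[of k])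
qed

lemma V_iid: "indep_vars (\<lambda>_. borel) V UNIV" "distr M borel (V k) = distr M borel (V 0)"
  using function_of_a_iid[of "\<lambda>x. ln (1 + \<eta> * (x / \<theta>))"] by (simp_all add: V_def[abs_def])

lemma W_iid: "indep_vars (\<lambda>_. borel) W UNIV" "distr M borel (W k) = distr M borel (W 0)"
  using function_of_a_iid[of "\<lambda>x. 1 - 1 / (1 + \<eta> * (x / \<theta>))"] by (simp_all add: W_def[abs_def])

text \<open>Integrability is assumed for ln (1 + a); by 1 + k x \<le> (1 + k) (1 + x) the rescaling
  costs only a constant.\<close>

lemma V_int: "integrable M (V k)"
proof -
  have "integrable M (V 0)"
  proof (rule Bochner_Integration.integrable_bound)
    show "integrable M (\<lambda>\<omega>. ln (1 + \<eta> / \<theta>) + ln (1 + a 0 \<omega>))"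
      using ln_a_int by simp
    show "AE \<omega> in M. norm (V 0 \<omega>) \<le> norm (ln (1 + \<eta> / \<theta>) + ln (1 + a 0 \<omega>))"
    proof (rule AE_I2)
      fix \<omega> assume \<omega>: "\<omega> \<in> space M"
      have p: "0 < \<eta> / \<theta>" using \<eta> \<theta>_pos by simp
      have "1 + k * x \<le> (1 + k) * (1 + x)" if "0 < k" "0 < x" for k x :: real
        using that by (simp add: algebra_simps)
      from this[OF p a_pos[OF \<omega>, of 0]] have "1 + \<eta> * (a 0 \<omega> / \<theta>) \<le> (1 + \<eta> / \<theta>) * (1 + a 0 \<omega>)"
        by simp
      then have "V 0 \<omega> \<le> ln ((1 + \<eta> / \<theta>) * (1 + a 0 \<omega>))"
        unfolding V_def using A_pos[OF \<omega>, of 0] by (subst ln_le_cancel_iff) (auto intro: order_less_le_trans)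
      also have "\<dots> = ln (1 + \<eta> / \<theta>) + ln (1 + a 0 \<omega>)"
        using p a_pos[OF \<omega>, of 0] by (intro ln_mult_pos) auto
      finally show "norm (V 0 \<omega>) \<le> norm (ln (1 + \<eta> / \<theta>) + ln (1 + a 0 \<omega>))"
        using V_nonneg[OF \<omega>, of 0] by simp
    qed
  qed measurable
  then show ?thesis
    using identically_distributed_integral(1)[OF V_measurable V_measurable V_iid(2)] by blast
qed

lemma V_expectation: "expectation (V k) = expectation (V 0)"
  by (rule identically_distributed_integral(2)[OF V_measurable V_measurable V_iid(2)])

lemma W_int: "integrable M (W k)"
  using W_bounds by (intro integrable_const_bound[where B = 1]) auto

text \<open>The form in which the fixed point equation is used: the sum of the slopes concentrates
  at N (1 - \<eta>), the exponent for which the Erlang mean has its mass where the tangents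
  touch.\<close>

lemma W_expectation: "\<beta> * expectation (W 0) = 1 - \<eta>"
proof -
  have "integrable M (\<lambda>\<omega>. 1 / (1 + \<eta> * (a 0 \<omega> / \<theta>)))"
    using Bochner_Integration.integrable_diff[OF integrable_const W_int[of 0], of 1] by (simp add: W_def)
  then show ?thesis
    using fixed_point unfolding W_def \<theta>_def by (simp add: prob_space)
qed

lemma expectation_V_nonneg: "0 \<le> expectation (V 0)"
  using V_nonneg by (intro integral_nonneg_AE AE_I2)

lemma limit_value_nonneg: "0 \<le> limit_value"
proof -
  have "0 \<le> \<beta> * expectation (V 0)" using expectation_V_nonneg \<beta>_pos by simp
  then show ?thesis using ln_le_minus_one[OF \<eta>(1)] by (simp add: limit_value_def)
qed

lemma trc_ge: "\<omega> \<in> space M \<Longrightarrow> s \<le> trc K \<omega>"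
  using c_pos by (simp add: trc_def sum_nonneg less_imp_le)

lemma trc_pos: "\<omega> \<in> space M \<Longrightarrow> 0 < trc K \<omega>"
  using trc_ge[of \<omega> K] s_pos by linarith

lemma trc_measurable [measurable]: "random_variable borel (trc K)"
  unfolding trc_def[abs_def] by measurable

text \<open>The Gaussian matrix is averaged first, for frozen weights;
  \<open>mean_ln_covdet_independent\<close> identifies the result with the joint mean.\<close>

definition rate :: "nat \<Rightarrow> nat \<Rightarrow> ennreal" where
  "rate N K = (\<integral>\<^sup>+\<omega>. mean_ln_covdet N (\<lambda>k. a k \<omega> / trc K \<omega>) K \<partial>M)"

text \<open>The determinantal bound holds for every y, so the deterministic choice N \<eta> is
  possible, and only a trace below its mean does harm. Its effect \<open>p\<close> on each summand
  is at most l on a typical event and at most O(ln N) always, as the trace is at least s. The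
  exponential lower tail makes the atypical contribution o(N).\<close>

lemma rate_upper:
  assumes e: "0 < e"
  shows "\<exists>N0. \<forall>N\<ge>N0. \<forall>K. real K = \<beta> * real N \<longrightarrow> rate N K \<le> ennreal (real N * (limit_value + e))"
proof -
  \<comment> \<open>Since K = \<beta> N, an error l per user costs N e / 2 in total. The \<epsilon>
    below is such that off the bad event the trace exceeds exp (- l) times N \<theta>.\<close>
  define l where "l = e / (2 * \<beta>)"
  have l: "0 < l" using e \<beta>_pos by (simp add: l_def)
  define \<epsilon> where "\<epsilon> = expectation (c 0) * (1 - exp (- l))"
  have \<epsilon>: "0 < \<epsilon>" using l expectation_c_pos by (simp add: \<epsilon>_def)
  obtain q where q: "0 < q" "\<And>K. 1 \<le> K \<Longrightarrow> prob {\<omega> \<in> space M. (\<Sum>m<K. c m \<omega>) \<le> real K * (expectation (c 0) - \<epsilon>)} \<le> exp (- q * real K)"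
    using iid_nonneg_lower_tail[OF c_indep c_distr _ c_int \<epsilon>] c_pos by (auto intro: less_imp_le)
  \<comment> \<open>Errors per antenna: the bad event, then Stirling's formula.\<close>
  define err where "err N = \<beta> * exp (- q * (\<beta> * real N)) * (\<bar>ln (\<theta> / s)\<bar> + ln (real N)) + (ln (real N) + 1) / real N" for N
  have "err \<longlonglongrightarrow> 0"
  proof -
    define b where "b = q * \<beta>"
    have "0 < b" using q \<beta>_pos by (simp add: b_def)
    then have "((\<lambda>N::nat. exp (- (b * real N)) * (C + ln (real N))) \<longlongrightarrow> 0) sequentially" for C
      by real_asymp
    moreover have "((\<lambda>N::nat. (ln (real N) + 1) / real N) \<longlongrightarrow> 0) sequentially"
      by real_asymp
    ultimately have "((\<lambda>N::nat. \<beta> * (exp (- (b * real N)) * (\<bar>ln (\<theta> / s)\<bar> + ln (real N))) + (ln (real N) + 1) / real N) \<longlongrightarrow> \<beta> * 0 + 0) sequentially"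
      by (intro tendsto_intros)
    then show ?thesis by (simp add: err_def[abs_def] b_def mult.assoc)
  qed
  then have "\<forall>\<^sub>F N in sequentially. err N < e / 2"
    using e by (intro order_tendstoD(2)) auto
  then have "\<forall>\<^sub>F N in sequentially. err N < e / 2 \<and> 1 \<le> N"
    using eventually_ge_at_top[of 1] by eventually_elim auto
  then obtain N0 where N0: "\<And>N. N0 \<le> N \<Longrightarrow> err N < e / 2 \<and> 1 \<le> N"
    by (auto simp: eventually_at_top_linorder)
  show ?thesis
  proof (intro exI[of _ N0] allI impI)
    fix N K assume "N0 \<le> N" and K: "real K = \<beta> * real N"
    then have N: "err N < e / 2" "1 \<le> N" using N0 by auto
    have "0 < real K" using K N \<beta>_pos by simp
    then have K1: "1 \<le> K" by simp
    define p where "p \<omega> = max 0 (ln (\<theta> * N / trc K \<omega>))" for \<omega>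
    define L where "L = \<bar>ln (\<theta> / s)\<bar> + ln (real N)"
    define \<kappa> where "\<kappa> = real N * (- ln \<eta> + \<eta> - 1) + ln (real N) + 1"
    define B where "B = {\<omega> \<in> space M. (\<Sum>m<K. c m \<omega>) \<le> real K * (expectation (c 0) - \<epsilon>)}"
    have [measurable]: "B \<in> sets M" unfolding B_def by measurable
    have [measurable]: "random_variable borel p" unfolding p_def by measurable
    have \<kappa>: "0 \<le> \<kappa>"
      using ln_le_minus_one[OF \<eta>(1)] N by (auto simp: \<kappa>_def intro!: add_nonneg_nonneg)
    have L0: "0 \<le> L" using N by (simp add: L_def)
    have p0: "0 \<le> p \<omega>" for \<omega> by (simp add: p_def)
    have pL: "p \<omega> \<le> L" if \<omega>: "\<omega> \<in> space M" for \<omega>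
    proof -
      have "\<theta> * N / trc K \<omega> \<le> \<theta> * N / s"
        using trc_ge[OF \<omega>] s_pos \<theta>_pos by (intro divide_left_mono mult_pos_pos trc_pos[OF \<omega>]) auto
      then have "ln (\<theta> * N / trc K \<omega>) \<le> ln (\<theta> / s * N)"
        using \<theta>_pos N trc_pos[OF \<omega>] s_pos by (subst ln_le_cancel_iff) auto
      also have "\<dots> = ln (\<theta> / s) + ln N"
        using \<theta>_pos N s_pos by (intro ln_mult_pos) auto
      also have "\<dots> \<le> L" by (simp add: L_def)
      finally show ?thesis using L0 by (simp add: p_def)
    qed
    have pB: "p \<omega> \<le> l + L * indicator B \<omega>" if \<omega>: "\<omega> \<in> space M" for \<omega>
    proof (cases "\<omega> \<in> B")
      case True
      then show ?thesis using pL[OF \<omega>] l by simp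
    next
      case False
      then have "real K * (expectation (c 0) * exp (- l)) < (\<Sum>m<K. c m \<omega>)"
        using \<omega> by (simp add: B_def \<epsilon>_def algebra_simps)
      then have "\<theta> * N * exp (- l) < trc K \<omega>"
        using s_pos by (simp add: trc_def K \<theta>_def mult_ac)
      then have "\<theta> * N / trc K \<omega> < exp l"
        using trc_pos[OF \<omega>] by (simp add: exp_minus field_simps)
      moreover have "0 < \<theta> * N / trc K \<omega>"
        using \<theta>_pos N trc_pos[OF \<omega>] by simp
      ultimately have "ln (\<theta> * N / trc K \<omega>) < l"
        by (metis exp_less_cancel_iff exp_ln)
      then show ?thesis using False l by (simp add: p_def)
    qed
    have pint: "integrable M p"
      using p0 pL by (intro integrable_const_bound[where B = L]) auto
    have Ep: "expectation p \<le> l + L * exp (- q * real K)"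
    proof -
      have iB: "integrable M (\<lambda>\<omega>. indicator B \<omega> :: real)"
        by (intro integrable_real_indicator) (auto simp: emeasure_eq_measure)
      have "expectation p \<le> expectation (\<lambda>\<omega>. l + L * indicator B \<omega>)"
        using pB by (intro integral_mono pint) (use iB in auto)
      also have "\<dots> = l + L * prob B" using iB by (simp add: prob_space)
      also have "\<dots> \<le> l + L * exp (- q * real K)"
        using q(2)[OF K1] L0 unfolding B_def by (intro add_left_mono mult_left_mono)
      finally show ?thesis .
    qed
    have Vint: "integrable M (\<lambda>\<omega>. \<Sum>k<K. V k \<omega>)" using V_int by auto
    have EV: "expectation (\<lambda>\<omega>. \<Sum>k<K. V k \<omega>) = K * expectation (V 0)"
    proof -
      have "expectation (\<lambda>\<omega>. \<Sum>k<K. V k \<omega>) = (\<Sum>k<K. expectation (V k))"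
        using V_int by (intro Bochner_Integration.integral_sum) auto
      also have "\<dots> = (\<Sum>k<K. expectation (V 0))" by (rule sum.cong[OF refl V_expectation])
      finally show ?thesis by simp
    qed
    have "rate N K \<le> (\<integral>\<^sup>+\<omega>. ennreal ((\<Sum>k<K. V k \<omega>) + K * p \<omega> + \<kappa>) \<partial>M)"
      unfolding rate_def
    proof (rule nn_integral_mono)
      fix \<omega> assume \<omega>: "\<omega> \<in> space M"
      have T: "0 < trc K \<omega>" by (rule trc_pos[OF \<omega>])
      have "mean_ln_covdet N (\<lambda>k. a k \<omega> / trc K \<omega>) K \<le>
        ennreal ((\<Sum>k<K. ln (1 + a k \<omega> / trc K \<omega> * (N * \<eta>))) + ln (fact N) - real N * ln (N * \<eta>) + N * \<eta>)"
        using a_pos[OF \<omega>] T N \<eta> by (intro mean_ln_covdet_le) (auto intro: less_imp_le)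
      also have "\<dots> \<le> ennreal ((\<Sum>k<K. V k \<omega>) + K * p \<omega> + \<kappa>)"
      proof (rule ennreal_leI)
        have "ln (1 + a k \<omega> / trc K \<omega> * (N * \<eta>)) \<le> V k \<omega> + p \<omega>" for k
        proof -
          define x where "x = \<eta> * (a k \<omega> / \<theta>)"
          define z where "z = \<theta> * N / trc K \<omega>"
          have x: "0 < x" using A_pos[OF \<omega>] by (simp add: x_def)
          have z: "0 < z" using \<theta>_pos N T by (simp add: z_def)
          have "a k \<omega> / trc K \<omega> * (N * \<eta>) = x * z"
            using \<theta>_pos by (simp add: x_def z_def)
          \<comment> \<open>The one-sided maximum charges only traces below N \<theta>; for larger
            ones z \<le> 1 and monotonicity is enough.\<close>
          moreover have "ln (1 + x * z) \<le> ln (1 + x) + max 0 (ln z)"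
          proof -
            have "1 + x * z \<le> (1 + x) * max 1 z"
              using x z by (simp add: max_def algebra_simps mult_le_cancel_left1)
            then have "ln (1 + x * z) \<le> ln ((1 + x) * max 1 z)"
              using x z by (subst ln_le_cancel_iff) (auto intro: add_pos_pos mult_pos_pos)
            also have "\<dots> = ln (1 + x) + ln (max 1 z)"
              using x by (intro ln_mult_pos) auto
            also have "ln (max 1 z) = max 0 (ln z)"
              using z by (auto simp: max_def)
            finally show ?thesis .
          qed
          ultimately show ?thesis
            unfolding V_def p_def x_def[symmetric] z_def[symmetric] by (simp only:)
        qed
        then have "(\<Sum>k<K. ln (1 + a k \<omega> / trc K \<omega> * (N * \<eta>))) \<le> (\<Sum>k<K. V k \<omega> + p \<omega>)"
          by (intro sum_mono)
        also have "\<dots> = (\<Sum>k<K. V k \<omega>) + K * p \<omega>" by (simp add: sum.distrib)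
        finally have 1: "(\<Sum>k<K. ln (1 + a k \<omega> / trc K \<omega> * (N * \<eta>))) \<le> (\<Sum>k<K. V k \<omega>) + K * p \<omega>" .
        have "ln (N * \<eta>) = ln (real N) + ln \<eta>" using N \<eta> by (simp add: ln_mult)
        then have "ln (fact N) - real N * ln (N * \<eta>) + N * \<eta> \<le> \<kappa>"
          using ln_fact_le[OF N(2)] by (simp add: \<kappa>_def algebra_simps)
        with 1 show "(\<Sum>k<K. ln (1 + a k \<omega> / trc K \<omega> * (N * \<eta>))) + ln (fact N) - real N * ln (N * \<eta>) + N * \<eta> \<le>
          (\<Sum>k<K. V k \<omega>) + K * p \<omega> + \<kappa>" by linarith
      qed
      finally show "mean_ln_covdet N (\<lambda>k. a k \<omega> / trc K \<omega>) K \<le> ennreal ((\<Sum>k<K. V k \<omega>) + K * p \<omega> + \<kappa>)" .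
    qed
    also have "\<dots> = ennreal (expectation (\<lambda>\<omega>. (\<Sum>k<K. V k \<omega>) + K * p \<omega> + \<kappa>))"
    proof (rule nn_integral_eq_integral)
      show "integrable M (\<lambda>\<omega>. (\<Sum>k<K. V k \<omega>) + K * p \<omega> + \<kappa>)"
        using Vint pint by auto
      show "AE \<omega> in M. 0 \<le> (\<Sum>k<K. V k \<omega>) + K * p \<omega> + \<kappa>"
        using V_nonneg p0 \<kappa> by (intro AE_I2 add_nonneg_nonneg sum_nonneg) auto
    qed
    also have "expectation (\<lambda>\<omega>. (\<Sum>k<K. V k \<omega>) + K * p \<omega> + \<kappa>) = K * expectation (V 0) + K * expectation p + \<kappa>"
      using Vint pint by (simp add: EV prob_space)
    also have "ennreal \<dots> \<le> ennreal (real N * (limit_value + e))"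
    proof (rule ennreal_leI)
      have "K * expectation p \<le> K * (l + L * exp (- q * real K))"
        using Ep by (intro mult_left_mono) auto
      moreover have "K * l = N * (e / 2)" using \<beta>_pos by (simp add: K l_def)
      moreover have "K * (L * exp (- q * real K)) + (ln (real N) + 1) = N * err N"
        using N by (simp add: K L_def err_def field_simps)
      moreover have "N * err N \<le> N * (e / 2)" using N by (intro mult_left_mono) auto
      moreover have "K * expectation (V 0) + N * (- ln \<eta> + \<eta> - 1) = N * limit_value"
        by (simp add: K limit_value_def algebra_simps)
      ultimately show "K * expectation (V 0) + K * expectation p + \<kappa> \<le> real N * (limit_value + e)"
        by (simp add: \<kappa>_def algebra_simps)
    qed
    finally show "rate N K \<le> ennreal (real N * (limit_value + e))" .
  qed
qed

text \<open>The integrand is nonnegative, so it suffices to bound it on an event of probability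
  close to 1, where the averages of \<open>c\<close>, \<open>W\<close> and \<open>V\<close> are all
  near their means. There the tangent bound is deterministic.\<close>

lemma rate_lower:
  assumes e: "0 < e"
  shows "\<exists>N0. \<forall>N\<ge>N0. \<forall>K. real K = \<beta> * real N \<longrightarrow> ennreal (real N * (limit_value - e)) \<le> rate N K"
proof -
  \<comment> \<open>Five losses: the average of \<open>V\<close>, the trace through S ln r, the
    oscillation of \<open>h\<close>, the prefactor ln (C N), and the discarded event.\<close>
  define e' where "e' = e / 5"
  have e': "0 < e'" using e by (simp add: e'_def)
  define h where "h \<sigma> = \<sigma> * ln \<eta> + (1 - \<sigma>) * ln (1 - \<sigma>) + \<sigma>" for \<sigma> :: real
  have h0: "h (1 - \<eta>) = ln \<eta> + 1 - \<eta>" by (simp add: h_def algebra_simps)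
  have "isCont h (1 - \<eta>)"
    unfolding h_def using \<eta> by (intro continuous_intros) auto
  then obtain d where d: "0 < d" "\<And>\<sigma>. \<bar>\<sigma> - (1 - \<eta>)\<bar> < d \<Longrightarrow> \<bar>h \<sigma> - h (1 - \<eta>)\<bar> < e'"
    using e' unfolding continuous_at_eps_delta dist_real_def by metis
  \<comment> \<open>Below d for the continuity of the Erlang exponent \<open>h\<close>; below \<eta>
    so that \<sigma>2 < 1, which keeps the negative power integrable; below 1 - \<eta> so that
    \<sigma>1 \<ge> 0.\<close>
  define \<epsilon> where "\<epsilon> = min (d / 2) (min (\<eta> / 2) ((1 - \<eta>) / 2))"
  have \<epsilon>: "0 < \<epsilon>" "\<epsilon> < d" "\<epsilon> < \<eta>" "\<epsilon> < 1 - \<eta>"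
    using d(1) \<eta> by (auto simp: \<epsilon>_def min_def)
  define \<sigma>1 where "\<sigma>1 = 1 - \<eta> - \<epsilon>"
  define \<sigma>2 where "\<sigma>2 = 1 - \<eta> + \<epsilon>"
  define \<tau> where "\<tau> = ln \<eta> + 1 - \<eta> + e'"
  have \<sigma>: "0 \<le> \<sigma>1" "\<sigma>1 \<le> \<sigma>2" "\<sigma>2 < 1" using \<epsilon> by (auto simp: \<sigma>1_def \<sigma>2_def)
  have \<tau>: "h \<sigma>1 \<le> \<tau>" "h \<sigma>2 \<le> \<tau>"
    using d(2)[of \<sigma>1] d(2)[of \<sigma>2] \<epsilon> h0 by (auto simp: \<sigma>1_def \<sigma>2_def \<tau>_def abs_less_iff)
  define l where "l = e' / \<beta>"
  have l: "0 < l" using e' \<beta>_pos by (simp add: l_def)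
  \<comment> \<open>Half of the gap between the mean of \<open>c 0\<close> and exp l times it; the
    other half is for the noise term s / K.\<close>
  define \<delta>1 where "\<delta>1 = expectation (c 0) * (exp l - 1) / 2"
  have \<delta>1: "0 < \<delta>1" using l expectation_c_pos by (simp add: \<delta>1_def)
  \<comment> \<open>Makes \<open>limit_value * \<delta> \<le> e'\<close>; the added 1 covers a
    vanishing limit.\<close>
  define \<delta> where "\<delta> = e' / (limit_value + 1)"
  have \<delta>: "0 < \<delta>" using e' limit_value_nonneg by (simp add: \<delta>_def)
  define B1 where "B1 K = {\<omega> \<in> space M. \<delta>1 \<le> \<bar>(\<Sum>m<K. c m \<omega>) / real K - expectation (c 0)\<bar>}" for K
  define B2 where "B2 K = {\<omega> \<in> space M. \<epsilon> / \<beta> \<le> \<bar>(\<Sum>m<K. W m \<omega>) / real K - expectation (W 0)\<bar>}" for K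
  define B3 where "B3 K = {\<omega> \<in> space M. e' / \<beta> \<le> \<bar>(\<Sum>m<K. V m \<omega>) / real K - expectation (V 0)\<bar>}" for K
  have [measurable]: "B1 K \<in> sets M" "B2 K \<in> sets M" "B3 K \<in> sets M" for K
    unfolding B1_def B2_def B3_def by measurable
  have "(\<lambda>K. prob (B1 K)) \<longlonglongrightarrow> 0" unfolding B1_def
    using iid_nonneg_weak_law[OF c_indep c_distr _ c_int \<delta>1] c_pos by (auto intro: less_imp_le)
  moreover have "(\<lambda>K. prob (B2 K)) \<longlonglongrightarrow> 0" unfolding B2_def
    using W_bounds \<epsilon>(1) \<beta>_pos by (intro iid_nonneg_weak_law[OF W_iid _ W_int]) auto
  moreover have "(\<lambda>K. prob (B3 K)) \<longlonglongrightarrow> 0" unfolding B3_def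
    using V_nonneg e' \<beta>_pos by (intro iid_nonneg_weak_law[OF V_iid _ V_int]) auto
  ultimately have "(\<lambda>K. prob (B1 K) + prob (B2 K) + prob (B3 K)) \<longlonglongrightarrow> 0 + 0 + 0"
    by (intro tendsto_intros)
  then have "\<forall>\<^sub>F K in sequentially. prob (B1 K) + prob (B2 K) + prob (B3 K) < \<delta>"
    using \<delta> by (intro order_tendstoD(2)) auto
  moreover have "\<forall>\<^sub>F K in sequentially. s / real K < \<delta>1"
  proof -
    have "(\<lambda>K. s / real K) \<longlonglongrightarrow> 0" by real_asymp
    then show ?thesis using \<delta>1 by (rule order_tendstoD(2))
  qed
  ultimately have "\<forall>\<^sub>F K in sequentially. prob (B1 K) + prob (B2 K) + prob (B3 K) < \<delta> \<and> s / real K < \<delta>1 \<and> 1 \<le> K"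
    using eventually_ge_at_top[of 1] by eventually_elim auto
  then obtain K0 where K0: "\<And>K. K0 \<le> K \<Longrightarrow> prob (B1 K) + prob (B2 K) + prob (B3 K) < \<delta> \<and> s / real K < \<delta>1 \<and> 1 \<le> K"
    by (auto simp: eventually_at_top_linorder)
  define C where "C = 2 * exp 1 / (1 - \<sigma>2)"
  have C: "0 < C" using \<sigma> by (simp add: C_def)
  have "\<forall>\<^sub>F N in sequentially. ln (C * real N) / real N < e'"
  proof -
    have "(\<lambda>N. ln (C * real N) / real N) \<longlonglongrightarrow> 0" using C by real_asymp
    then show ?thesis using e' by (rule order_tendstoD(2))
  qed
  moreover have "\<forall>\<^sub>F N in sequentially. 1 \<le> real N * (1 - \<sigma>2)"
  proof -
    have "0 < 1 - \<sigma>2" using \<sigma> by simp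
    then have "filterlim (\<lambda>N. real N * (1 - \<sigma>2)) at_top sequentially" by real_asymp
    then show ?thesis by (simp add: filterlim_at_top)
  qed
  moreover have "\<forall>\<^sub>F N in sequentially. real K0 \<le> \<beta> * real N"
  proof -
    have "filterlim (\<lambda>N. \<beta> * real N) at_top sequentially" using \<beta>_pos by real_asymp
    then show ?thesis by (simp add: filterlim_at_top)
  qed
  ultimately have "\<forall>\<^sub>F N in sequentially. ln (C * real N) / real N < e' \<and> 1 \<le> real N * (1 - \<sigma>2) \<and> real K0 \<le> \<beta> * real N \<and> 1 \<le> N"
    using eventually_ge_at_top[of 1] by eventually_elim auto
  then obtain N0 where N0: "\<And>N. N0 \<le> N \<Longrightarrow> ln (C * real N) / real N < e' \<and> 1 \<le> real N * (1 - \<sigma>2) \<and> real K0 \<le> \<beta> * real N \<and> 1 \<le> N"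
    by (auto simp: eventually_at_top_linorder)
  show ?thesis
  proof (intro exI[of _ N0] allI impI)
    fix N K assume "N0 \<le> N" and K: "real K = \<beta> * real N"
    then have N: "ln (C * real N) / real N < e'" "1 \<le> real N * (1 - \<sigma>2)" "real K0 \<le> real K" "1 \<le> N"
      using N0 by auto
    then have K': "prob (B1 K) + prob (B2 K) + prob (B3 K) < \<delta>" "s / real K < \<delta>1" "1 \<le> K"
      using K0[of K] by auto
    have Kpos: "0 < real K" using K'(3) by simp
    define G where "G = space M - (B1 K \<union> B2 K \<union> B3 K)"
    have [measurable]: "G \<in> sets M" unfolding G_def by measurable
    have G: "1 - \<delta> \<le> prob G"
    proof -
      have "prob (B1 K \<union> B2 K \<union> B3 K) \<le> prob (B1 K) + prob (B2 K) + prob (B3 K)"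
        using measure_Un_le[of "B1 K \<union> B2 K" M "B3 K"] measure_Un_le[of "B1 K" M "B2 K"] by simp
      moreover have "prob G = 1 - prob (B1 K \<union> B2 K \<union> B3 K)"
        unfolding G_def by (rule prob_compl) measurable
      ultimately show ?thesis using K'(1) by linarith
    qed
    have good: "ennreal (real N * (limit_value - 4 * e')) \<le> mean_ln_covdet N (\<lambda>k. a k \<omega> / trc K \<omega>) K" if \<omega>G: "\<omega> \<in> G" for \<omega>
    proof -
      have \<omega>: "\<omega> \<in> space M" using \<omega>G by (simp add: G_def)
      have T: "0 < trc K \<omega>" by (rule trc_pos[OF \<omega>])
      define r where "r = \<theta> * N / trc K \<omega>"
      have r: "0 < r" using T \<theta>_pos N by (simp add: r_def)
      \<comment> \<open>The touching point follows the random trace, y = \<eta> * trc / \<theta>, so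
        that weight times y is exactly \<eta> a / \<theta> and the sums of \<open>V\<close> and
        \<open>W\<close> appear without error. The price is the term S ln r, with r close to
        1.\<close>
      define y where "y = N * \<eta> / r"
      define S where "S = (\<Sum>k<K. W k \<omega>)"
      have wy: "a k \<omega> / trc K \<omega> * y = \<eta> * (a k \<omega> / \<theta>)" for k
        using T \<theta>_pos N by (simp add: y_def r_def)
      have W_eq: "W k \<omega> = a k \<omega> / trc K \<omega> * y / (1 + a k \<omega> / trc K \<omega> * y)" for k
      proof -
        have "1 - 1 / (1 + x) = x / (1 + x)" if "0 < x" for x :: real
          using that by (simp add: field_simps)
        then show ?thesis unfolding wy W_def using A_pos[OF \<omega>] by blast
      qed
      have lnr: "- l \<le> ln r"
      proof -
        have "(\<Sum>m<K. c m \<omega>) / real K - expectation (c 0) < \<delta>1"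
          using \<omega>G \<omega> by (auto simp: G_def B1_def)
        then have "(\<Sum>m<K. c m \<omega>) / real K + s / real K < expectation (c 0) + 2 * \<delta>1"
          using K'(2) by linarith
        moreover have "expectation (c 0) + 2 * \<delta>1 = expectation (c 0) * exp l"
          unfolding \<delta>1_def by (simp add: field_simps)
        ultimately have "trc K \<omega> / real K < expectation (c 0) * exp l"
          by (simp add: trc_def add_divide_distrib)
        then have "trc K \<omega> < \<theta> * N * exp l"
          using Kpos by (simp add: \<theta>_def K field_simps)
        then have "exp (- l) < r"
          using T by (simp add: r_def exp_minus field_simps)
        then show ?thesis using r by (simp add: ln_ge_iff)
      qed
      have SK: "\<bar>S - N * (1 - \<eta>)\<bar> < N * \<epsilon>"
      proof -
        have "\<bar>S / real K - expectation (W 0)\<bar> < \<epsilon> / \<beta>"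
          using \<omega>G \<omega> by (auto simp: G_def B2_def S_def not_le)
        then have "real K * \<bar>S / real K - expectation (W 0)\<bar> < real K * (\<epsilon> / \<beta>)"
          using Kpos by (intro mult_strict_left_mono)
        moreover have "real K * \<bar>S / real K - expectation (W 0)\<bar> = \<bar>S - N * (\<beta> * expectation (W 0))\<bar>"
        proof -
          have "real K * \<bar>S / real K - expectation (W 0)\<bar> = \<bar>real K * (S / real K - expectation (W 0))\<bar>"
            using Kpos by (simp add: abs_mult)
          also have "real K * (S / real K - expectation (W 0)) = S - N * (\<beta> * expectation (W 0))"
            using Kpos by (simp add: right_diff_distrib) (simp add: K)
          finally show ?thesis .
        qed
        moreover have "real K * (\<epsilon> / \<beta>) = N * \<epsilon>" using \<beta>_pos by (simp add: K)
        ultimately show ?thesis by (simp add: W_expectation)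
      qed
      have VK: "N * (\<beta> * expectation (V 0)) - N * e' \<le> (\<Sum>k<K. V k \<omega>)"
      proof -
        have "\<not> e' / \<beta> \<le> \<bar>(\<Sum>k<K. V k \<omega>) / real K - expectation (V 0)\<bar>"
          using \<omega>G \<omega> by (auto simp: G_def B3_def)
        then have "expectation (V 0) - e' / \<beta> \<le> (\<Sum>k<K. V k \<omega>) / real K" by linarith
        then have "real K * (expectation (V 0) - e' / \<beta>) \<le> (\<Sum>k<K. V k \<omega>)"
          using Kpos by (simp add: field_simps)
        moreover have "real K * (expectation (V 0) - e' / \<beta>) = N * (\<beta> * expectation (V 0)) - N * e'"
          using \<beta>_pos by (simp add: K right_diff_distrib)
        ultimately show ?thesis by simp
      qed
      have S0: "0 \<le> S" "S \<le> K"
      proof -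
        show "0 \<le> S" unfolding S_def using W_bounds[OF \<omega>] by (intro sum_nonneg) auto
        have "S \<le> (\<Sum>k<K. 1)" unfolding S_def using W_bounds[OF \<omega>] by (intro sum_mono) auto
        then show "S \<le> K" by simp
      qed
      have "- (N * e') = - (K * l)" using \<beta>_pos by (simp add: K l_def)
      also have "\<dots> \<le> - (S * l)" using S0 l by simp
      also have "\<dots> = S * (- l)" by simp
      also have "\<dots> \<le> S * ln r" using S0 lnr by (intro mult_left_mono)
      finally have Sr: "- (N * e') \<le> S * ln r" .
      have lnC: "ln (2 * exp 1 * N / (1 - \<sigma>2)) \<le> N * e'"
        using N(1,4) by (simp add: C_def field_simps)
      have tangent: "ennreal ((\<Sum>k<K. ln (1 + a k \<omega> / trc K \<omega> * y)) + S * ln r - N * \<tau> - ln (2 * exp 1 * N / (1 - \<sigma>2))) \<le>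
        mean_ln_covdet N (\<lambda>k. a k \<omega> / trc K \<omega>) K"
      proof (rule mean_ln_covdet_ge_tangent[where \<eta> = \<eta> and ?\<sigma>1.0 = \<sigma>1])
        show "0 \<le> a k \<omega> / trc K \<omega>" for k using a_pos[OF \<omega>, of k] T by simp
        show "S = (\<Sum>k<K. a k \<omega> / trc K \<omega> * y / (1 + a k \<omega> / trc K \<omega> * y))"
          unfolding S_def W_eq ..
        show "real N * \<sigma>1 \<le> S" "S \<le> real N * \<sigma>2"
          using SK by (auto simp: \<sigma>1_def \<sigma>2_def algebra_simps abs_less_iff)
        show "\<sigma>1 * ln \<eta> + (1 - \<sigma>1) * ln (1 - \<sigma>1) + \<sigma>1 \<le> \<tau>" "\<sigma>2 * ln \<eta> + (1 - \<sigma>2) * ln (1 - \<sigma>2) + \<sigma>2 \<le> \<tau>"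
          using \<tau> by (simp_all add: h_def)
      qed (use N \<eta> r \<sigma> in \<open>auto simp: y_def\<close>)
      have sum_V: "(\<Sum>k<K. ln (1 + a k \<omega> / trc K \<omega> * y)) = (\<Sum>k<K. V k \<omega>)"
        unfolding wy V_def ..
      have "N * (limit_value - 4 * e') \<le> (\<Sum>k<K. V k \<omega>) + S * ln r - N * \<tau> - ln (2 * exp 1 * N / (1 - \<sigma>2))"
        using VK Sr lnC by (simp add: limit_value_def \<tau>_def algebra_simps)
      then show ?thesis
        by (rule order_trans[OF ennreal_leI tangent[unfolded sum_V]])
    qed
    have "ennreal (real N * (limit_value - e)) \<le> ennreal (real N * (limit_value - 4 * e')) * ennreal (prob G)"
    proof (cases "0 \<le> limit_value - 4 * e'")
      case True
      have "limit_value * \<delta> \<le> e'"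
        using limit_value_nonneg e' by (simp add: \<delta>_def field_simps)
      moreover have "0 \<le> e' * \<delta>" using e' \<delta> by simp
      moreover have "e = 5 * e'" by (simp add: e'_def)
      ultimately have "limit_value - e \<le> (limit_value - 4 * e') * (1 - \<delta>)"
        by (simp add: algebra_simps)
      also have "\<dots> \<le> (limit_value - 4 * e') * prob G"
        using True G by (intro mult_left_mono)
      finally have "real N * (limit_value - e) \<le> real N * ((limit_value - 4 * e') * prob G)"
        by (intro mult_left_mono) auto
      then show ?thesis using True
        by (simp add: ennreal_mult'[symmetric] mult.assoc ennreal_leI)
    next
      case False
      then have "limit_value - e < 0" using e by (simp add: e'_def)
      then have "real N * (limit_value - e) \<le> 0" by (simp add: mult_nonneg_nonpos)
      then show ?thesis by (simp add: ennreal_neg)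
    qed
    also have "\<dots> = (\<integral>\<^sup>+\<omega>. ennreal (real N * (limit_value - 4 * e')) * indicator G \<omega> \<partial>M)"
      by (simp add: nn_integral_cmult_indicator emeasure_eq_measure)
    also have "\<dots> \<le> rate N K"
      unfolding rate_def using good by (intro nn_integral_mono) (auto simp: indicator_def)
    finally show "ennreal (real N * (limit_value - e)) \<le> rate N K" .
  qed
qed

lemma rate_tendsto:
  "((\<lambda>N. enn2real (rate N (nat \<lfloor>\<beta> * real N\<rfloor>)) / real N) \<longlongrightarrow> limit_value) (ratio_filter \<beta>)"
proof (rule tendstoI)
  fix e :: real assume "0 < e"
  then have e: "0 < e / 2" by simp
  obtain N1 where N1: "\<And>N K. N1 \<le> N \<Longrightarrow> real K = \<beta> * real N \<Longrightarrow> rate N K \<le> ennreal (real N * (limit_value + e / 2))"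
    using rate_upper[OF e] by blast
  obtain N2 where N2: "\<And>N K. N2 \<le> N \<Longrightarrow> real K = \<beta> * real N \<Longrightarrow> ennreal (real N * (limit_value - e / 2)) \<le> rate N K"
    using rate_lower[OF e] by blast
  have "\<forall>\<^sub>F N in at_top. (\<exists>K. real K = \<beta> * real N) \<longrightarrow> dist (enn2real (rate N (nat \<lfloor>\<beta> * real N\<rfloor>)) / real N) limit_value < e"
    using eventually_ge_at_top[of "max (max N1 N2) 1"]
  proof eventually_elim
    case (elim N)
    show ?case
    proof
      assume "\<exists>K. real K = \<beta> * real N"
      then obtain K where K: "real K = \<beta> * real N" by blast
      have K': "nat \<lfloor>\<beta> * real N\<rfloor> = K" by (simp flip: K)
      have up: "rate N K \<le> ennreal (real N * (limit_value + e / 2))" using N1 K elim by simp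
      have lo: "ennreal (real N * (limit_value - e / 2)) \<le> rate N K" using N2 K elim by simp
      have N: "0 < real N" using elim by simp
      have "enn2real (rate N K) \<le> real N * (limit_value + e / 2)"
        using up e limit_value_nonneg by (intro enn2real_leI) auto
      moreover have "real N * (limit_value - e / 2) \<le> enn2real (rate N K)"
      proof (cases "0 \<le> real N * (limit_value - e / 2)")
        case True
        \<comment> \<open>An infinite rate would be sent to 0 by \<open>enn2real\<close>.\<close>
        have "rate N K < \<top>" using up by (simp add: order_le_less_trans ennreal_less_top)
        then show ?thesis using enn2real_mono[OF lo] True by simp
      next
        case False
        then show ?thesis using enn2real_nonneg[of "rate N K"] by linarith
      qed
      ultimately have "enn2real (rate N K) / real N \<le> limit_value + e / 2"
        "limit_value - e / 2 \<le> enn2real (rate N K) / real N"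
        using N by (simp_all add: pos_divide_le_eq pos_le_divide_eq mult.commute)
      then have "\<bar>enn2real (rate N K) / real N - limit_value\<bar> \<le> e / 2"
        by linarith
      then show "dist (enn2real (rate N (nat \<lfloor>\<beta> * real N\<rfloor>)) / real N) limit_value < e"
        using e by (simp add: dist_real_def K')
    qed
  qed
  then show "\<forall>\<^sub>F N in ratio_filter \<beta>. dist (enn2real (rate N (nat \<lfloor>\<beta> * real N\<rfloor>)) / real N) limit_value < e"
    unfolding ratio_filter_def eventually_inf_principal by simp
qed

end

text \<open>The definite description requires a unique solution. As the mean \<open>I\<close> is
  below 1 at positive arguments, the denominator can be cleared; the resulting \<open>g\<close> is
  continuous and strictly increasing with g 0 = -1 and g 1 > 0. The sign at 1 also excludes \<eta> =
  1.\<close>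

lemma (in prob_space) eta_of_props:
  assumes [measurable]: "random_variable borel A" and pos: "\<And>\<omega>. \<omega> \<in> space M \<Longrightarrow> 0 < A \<omega>" and \<beta>: "0 < \<beta>"
  defines "\<eta> \<equiv> eta_of M A \<beta>"
  shows "0 < \<eta>" "\<eta> < 1" "\<beta> * (1 - expectation (\<lambda>\<omega>. 1 / (1 + \<eta> * A \<omega>))) = 1 - \<eta>"
proof -
  define I where "I x = expectation (\<lambda>\<omega>. 1 / (1 + x * A \<omega>))" for x
  have den: "1 \<le> 1 + x * A \<omega>" if "0 \<le> x" "\<omega> \<in> space M" for x \<omega>
    using pos[OF that(2)] that(1) by simp
  have bnd: "\<bar>1 / (1 + x * A \<omega>)\<bar> \<le> 1" if "0 \<le> x" "\<omega> \<in> space M" for x \<omega>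
    using den[OF that] by simp
  have int: "integrable M (\<lambda>\<omega>. 1 / (1 + x * A \<omega>))" if "0 \<le> x" for x
    using bnd[OF that] by (intro integrable_const_bound[where B = 1]) auto
  have I_less: "I x < 1" if "0 < x" for x
  proof -
    have "I x < expectation (\<lambda>_. 1)" unfolding I_def
    proof (rule integral_less_AE_space)
      show "AE \<omega> in M. 1 / (1 + x * A \<omega>) < 1"
        using that pos by (intro AE_I2) (simp add: add_pos_pos)
      show "emeasure M (space M) \<noteq> 0" by (simp add: emeasure_space_1)
    qed (use int that in auto)
    then show ?thesis by (simp add: prob_space)
  qed
  have I_mono: "I y \<le> I x" if "0 \<le> x" "x \<le> y" for x y
    unfolding I_def
  proof (rule integral_mono)
    fix \<omega> assume \<omega>: "\<omega> \<in> space M"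
    have "x * A \<omega> \<le> y * A \<omega>" using that pos[OF \<omega>] by (intro mult_right_mono) auto
    then show "1 / (1 + y * A \<omega>) \<le> 1 / (1 + x * A \<omega>)"
      using den[OF that(1) \<omega>] by (intro divide_left_mono) (auto intro!: mult_pos_pos)
  qed (use int that in auto)
  have cont: "continuous_on {0..1} I"
    unfolding I_def
  proof (rule continuous_on_sequentiallyI)
    fix u :: "nat \<Rightarrow> real" and x assume u: "\<forall>n. u n \<in> {0..1}" and x: "x \<in> {0..1}" and lim: "u \<longlonglongrightarrow> x"
    show "(\<lambda>n. expectation (\<lambda>\<omega>. 1 / (1 + u n * A \<omega>))) \<longlonglongrightarrow> expectation (\<lambda>\<omega>. 1 / (1 + x * A \<omega>))"
    proof (rule integral_dominated_convergence[where w="\<lambda>_. 1"])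
      show "AE \<omega> in M. (\<lambda>n. 1 / (1 + u n * A \<omega>)) \<longlonglongrightarrow> 1 / (1 + x * A \<omega>)"
      proof (rule AE_I2)
        fix \<omega> assume "\<omega> \<in> space M"
        then have "1 + x * A \<omega> \<noteq> 0" using den[of x \<omega>] x by auto
        then show "(\<lambda>n. 1 / (1 + u n * A \<omega>)) \<longlonglongrightarrow> 1 / (1 + x * A \<omega>)"
          by (intro tendsto_intros lim)
      qed
      show "AE \<omega> in M. norm (1 / (1 + u n * A \<omega>)) \<le> 1" for n
        using bnd[of "u n"] u by (intro AE_I2) auto
    qed auto
  qed
  define g where "g x = \<beta> * (1 - I x) - (1 - x)" for x
  have "\<exists>x\<ge>0. x \<le> 1 \<and> g x = 0"
  proof (rule IVT')
    show "g 0 \<le> 0" by (simp add: g_def I_def prob_space)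
    show "0 \<le> g 1" using I_less[of 1] \<beta> by (simp add: g_def)
    show "continuous_on {0..1} g" unfolding g_def by (intro continuous_intros cont)
  qed simp
  then obtain x where x: "0 \<le> x" "x \<le> 1" "g x = 0" by blast
  have x_pos: "0 < x" using x by (cases "x = 0") (auto simp: g_def I_def prob_space)
  have x_less: "x < 1" using x I_less[of 1] \<beta> by (cases "x = 1") (auto simp: g_def)
  have g_strict: "g y < g z" if "0 \<le> y" "y < z" for y z
  proof -
    have "\<beta> * (1 - I y) \<le> \<beta> * (1 - I z)" using I_mono[of y z] that \<beta> by (intro mult_left_mono) auto
    then show ?thesis using that by (simp add: g_def)
  qed
  have iff: "0 < y \<and> y \<le> 1 \<and> \<beta> = (1 - y) / (1 - I y) \<longleftrightarrow> 0 < y \<and> y \<le> 1 \<and> g y = 0" for y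
    using I_less[of y] by (auto simp: g_def field_simps)
  have "\<eta> = x" unfolding \<eta>_def eta_of_def I_def[symmetric] iff
  proof (rule the_equality)
    show "0 < x \<and> x \<le> 1 \<and> g x = 0" using x x_pos by simp
    fix y assume y: "0 < y \<and> y \<le> 1 \<and> g y = 0"
    show "y = x"
      using g_strict[of x y] g_strict[of y x] y x by (cases y x rule: linorder_cases) auto
  qed
  then show "0 < \<eta>" "\<eta> < 1" "\<beta> * (1 - expectation (\<lambda>\<omega>. 1 / (1 + \<eta> * A \<omega>))) = 1 - \<eta>"
    using x x_pos x_less by (simp_all add: g_def I_def)
qed


section \<open>The uplink rate\<close>


lemma det_uplink_eq_covmat:
  "det (1\<^sub>m N + Mmat N K G \<omega> * PhiTD tau_p sigma2 L K d k z \<omega> * MmatH N K G \<omega>) =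
    det (covmat N (\<lambda>j. bcoef tau_p sigma2 L d k k j \<omega> * (d k k j \<omega>)\<^sup>2 /
      ((\<Sum>m<K. (1 - bcoef tau_p sigma2 L d k k m \<omega>) * (d k k m \<omega>)\<^sup>2) + z * sigma2)) K (\<lambda>j i. G i j \<omega>))"
proof -
  define w where "w j = bcoef tau_p sigma2 L d k k j \<omega> * (d k k j \<omega>)\<^sup>2 /
      ((\<Sum>m<K. (1 - bcoef tau_p sigma2 L d k k m \<omega>) * (d k k m \<omega>)\<^sup>2) + z * sigma2)" for j
  have Phi: "PhiTD tau_p sigma2 L K d k z \<omega> = mat K K (\<lambda>(i, j). if i = j then of_real (w i) else 0)"
    by (simp only: PhiTD_def Let_def w_def)
  have "Mmat N K G \<omega> * mat K K (\<lambda>(i, j). if i = j then of_real (w i) else 0) = mat N K (\<lambda>(i, j). G i j \<omega> * of_real (w j))"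
    by (intro eq_matI) (auto simp: Mmat_def scalar_prod_def if_distrib cong: if_cong)
  then have "1\<^sub>m N + Mmat N K G \<omega> * PhiTD tau_p sigma2 L K d k z \<omega> * MmatH N K G \<omega> = covmat N w K (\<lambda>j i. G i j \<omega>)"
    unfolding Phi
    by (intro eq_matI) (auto simp: MmatH_def covmat_def gramw_def scalar_prod_def atLeast0LessThan mult_ac intro!: sum.cong)
  then show ?thesis by (simp add: w_def[abs_def])
qed

context prob_space
begin

section \<open>Joint laws of the Gaussian columns and the attenuations\<close>

lemma distributed_std_cgauss:
  assumes "distributed M lborel Z std_cgauss_density"
  shows "random_variable borel Z" "distr M cgauss Z = cgauss"
proof -
  show "random_variable borel Z"
    using assms by (simp add: distributed_def)
  have "distr M cgauss Z = distr M lborel Z"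
    by (rule distr_cong) simp_all
  then show "distr M cgauss Z = cgauss"
    using assms by (simp add: distributed_def cgauss_def)
qed

lemma indep_vars_reindex:
  assumes ind: "indep_vars M' X I" and f: "inj_on f J" "f ` J \<subseteq> I"
  shows "indep_vars (\<lambda>j. M' (f j)) (\<lambda>j. X (f j)) J"
proof -
  have "indep_vars (\<lambda>j. PiM {f j} M') (\<lambda>j \<omega>. restrict (\<lambda>i. X i \<omega>) {f j}) J"
    using f by (intro indep_vars_restrict[OF ind]) (auto simp: disjoint_family_on_def inj_on_def)
  then have "indep_vars (\<lambda>j. M' (f j)) (\<lambda>j \<omega>. (restrict (\<lambda>i. X i \<omega>) {f j}) (f j)) J"
    by (rule indep_vars_compose2[where Y = "\<lambda>j x. x (f j)"]) auto
  then show ?thesis by simp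
qed

text \<open>The nested product law arises in two stages: entries within a column are independent,
  and columns are independent as disjoint blocks of the family. The characterisation of independence
  by product laws is applied to nonempty index sets, hence N, K \<ge> 1.\<close>

lemma gauss_columns:
  assumes ind: "indep_vars (\<lambda>_. borel) (\<lambda>(i, j). G i j) UNIV"
    and G: "\<And>i j. distributed M lborel (G i j) std_cgauss_density"
    and N: "1 \<le> N" and K: "1 \<le> K"
  shows "distr M (gauss_mat N K) (\<lambda>\<omega>. \<lambda>j\<in>{..<K}. \<lambda>i\<in>{..<N}. G i j \<omega>) = gauss_mat N K"
proof -
  have ne: "{..<n} \<noteq> {}" if "1 \<le> n" for n :: nat
    using that by (metis One_nat_def Suc_le_lessD empty_iff lessThan_iff)
  have ind_cg: "indep_vars (\<lambda>_. cgauss) (\<lambda>(i, j). G i j) UNIV"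
  proof -
    have "indep_vars (\<lambda>_. cgauss) (\<lambda>p x. (case p of (i, j) \<Rightarrow> G i j) x) UNIV"
      by (rule indep_vars_compose2[OF ind, where Y = "\<lambda>_ x. x"]) simp
    then show ?thesis by simp
  qed
  have col: "distr M (gauss_vec N) (\<lambda>\<omega>. \<lambda>i\<in>{..<N}. G i j \<omega>) = gauss_vec N" for j
  proof -
    have "indep_vars (\<lambda>_. cgauss) (\<lambda>i. G i j) {..<N}"
      using indep_vars_reindex[OF ind_cg, of "\<lambda>i. (i, j)" "{..<N}"] by (simp add: inj_on_def)
    then have "distr M (gauss_vec N) (\<lambda>\<omega>. \<lambda>i\<in>{..<N}. G i j \<omega>) = PiM {..<N} (\<lambda>i. distr M cgauss (G i j))"
      using distributed_std_cgauss(1)[OF G] ne[OF N]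
      by (subst (asm) indep_vars_iff_distr_eq_PiM') (auto simp: measurable_cong_sets[OF refl sets_cgauss])
    then show ?thesis by (simp add: distributed_std_cgauss(2)[OF G])
  qed
  have "indep_vars (\<lambda>j. PiM ((\<lambda>i. (i, j)) ` {..<N}) (\<lambda>_. cgauss)) (\<lambda>j \<omega>. restrict (\<lambda>p. (case p of (i, j) \<Rightarrow> G i j) \<omega>) ((\<lambda>i. (i, j)) ` {..<N})) {..<K}"
    by (rule indep_vars_restrict[OF ind_cg]) (auto simp: disjoint_family_on_def)
  then have "indep_vars (\<lambda>_. gauss_vec N) (\<lambda>j \<omega>. \<lambda>i\<in>{..<N}. restrict (\<lambda>p. (case p of (i, j) \<Rightarrow> G i j) \<omega>) ((\<lambda>i. (i, j)) ` {..<N}) (i, j)) {..<K}"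
  proof (rule indep_vars_compose2[where Y = "\<lambda>j x. \<lambda>i\<in>{..<N}. x (i, j)"])
    show "(\<lambda>x. \<lambda>i\<in>{..<N}. x (i, j)) \<in> PiM ((\<lambda>i. (i, j)) ` {..<N}) (\<lambda>_. cgauss) \<rightarrow>\<^sub>M gauss_vec N" for j
      by (intro measurable_restrict measurable_component_singleton) auto
  qed
  also have "(\<lambda>j \<omega>. \<lambda>i\<in>{..<N}. restrict (\<lambda>p. (case p of (i, j) \<Rightarrow> G i j) \<omega>) ((\<lambda>i. (i, j)) ` {..<N}) (i, j)) =
    (\<lambda>j \<omega>. \<lambda>i\<in>{..<N}. G i j \<omega>)"
    by (intro ext) (auto simp: restrict_def)
  finally have "distr M (gauss_mat N K) (\<lambda>\<omega>. \<lambda>j\<in>{..<K}. \<lambda>i\<in>{..<N}. G i j \<omega>) =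
    PiM {..<K} (\<lambda>j. distr M (gauss_vec N) (\<lambda>\<omega>. \<lambda>i\<in>{..<N}. G i j \<omega>))"
    using distributed_std_cgauss(1)[OF G] ne[OF K]
    by (subst (asm) indep_vars_iff_distr_eq_PiM')
       (auto intro!: measurable_restrict simp: measurable_cong_sets[OF refl sets_cgauss])
  then show ?thesis by (simp add: col)
qed

text \<open>Conditioning on the attenuations, carried out as Fubini for the joint law of two
  independent blocks. \<open>Z\<close> and \<open>Y\<close> are meant to be raw restrictions of the
  whole family, for which block independence is immediate; weights and columns are read off by the
  measurable maps \<open>w\<close> and \<open>g\<close>.\<close>

lemma mean_ln_covdet_independent:
  fixes Z Y :: "'a \<Rightarrow> 'c" and w :: "nat \<Rightarrow> 'c \<Rightarrow> real"
  assumes ind: "indep_var S Z T Y"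
    and w [measurable]: "\<And>j. j < K \<Longrightarrow> w j \<in> borel_measurable S"
    and g [measurable]: "g \<in> T \<rightarrow>\<^sub>M gauss_mat N K"
    and law: "distr M (gauss_mat N K) (\<lambda>\<omega>. g (Y \<omega>)) = gauss_mat N K"
  shows "(\<integral>\<^sup>+\<omega>. ennreal (ln (covdet N (\<lambda>j. w j (Z \<omega>)) K (g (Y \<omega>)))) \<partial>M) =
    (\<integral>\<^sup>+\<omega>. mean_ln_covdet N (\<lambda>j. w j (Z \<omega>)) K \<partial>M)"
proof -
  let ?f = "\<lambda>p. ennreal (ln (covdet N (\<lambda>j. w j (fst p)) K (snd p)))"
  have Z [measurable]: "random_variable S Z" and Y [measurable]: "random_variable T Y"
    and prod: "distr M S Z \<Otimes>\<^sub>M distr M T Y = distr M (S \<Otimes>\<^sub>M T) (\<lambda>x. (Z x, Y x))"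
    using ind unfolding indep_var_distribution_eq by auto
  have "(\<lambda>p. covdet N (\<lambda>j. w j (fst p)) K (snd p)) \<in> borel_measurable (S \<Otimes>\<^sub>M gauss_mat N K)"
  proof (rule measurable_covdet)
    show "(\<lambda>p. snd p k i) \<in> borel_measurable (S \<Otimes>\<^sub>M gauss_mat N K)" if "k < K" "i < N" for k i
      by (rule measurable_compose[OF measurable_snd measurable_gauss_mat_component[OF that]])
  qed measurable
  then have f: "?f \<in> borel_measurable (S \<Otimes>\<^sub>M gauss_mat N K)" by measurable
  then have fg: "(\<lambda>p. ?f (fst p, g (snd p))) \<in> borel_measurable (S \<Otimes>\<^sub>M T)"
    by (rule measurable_compose[rotated]) measurable
  interpret T: prob_space "distr M T Y" by (rule prob_space_distr) (rule Y)
  have "(\<integral>\<^sup>+\<omega>. ennreal (ln (covdet N (\<lambda>j. w j (Z \<omega>)) K (g (Y \<omega>)))) \<partial>M) =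
      (\<integral>\<^sup>+p. ?f (fst p, g (snd p)) \<partial>distr M (S \<Otimes>\<^sub>M T) (\<lambda>x. (Z x, Y x)))"
    using fg by (subst nn_integral_distr) auto
  also have "\<dots> = (\<integral>\<^sup>+z. (\<integral>\<^sup>+y. ?f (z, g y) \<partial>distr M T Y) \<partial>distr M S Z)"
    unfolding prod[symmetric] using fg
    by (subst T.nn_integral_fst[symmetric])
       (auto simp: measurable_cong_sets[OF sets_pair_measure_cong[OF sets_distr sets_distr] refl])
  also have "\<dots> = (\<integral>\<^sup>+z. mean_ln_covdet N (\<lambda>j. w j z) K \<partial>distr M S Z)"
  proof (intro nn_integral_cong)
    fix z assume "z \<in> space (distr M S Z)"
    then have z: "z \<in> space S" by simp
    have fz: "(\<lambda>X. ?f (z, X)) \<in> borel_measurable (gauss_mat N K)"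
      by simp
    have "distr (distr M T Y) (gauss_mat N K) g = gauss_mat N K"
      using law by (subst distr_distr) (auto simp: comp_def)
    then have "mean_ln_covdet N (\<lambda>j. w j z) K = (\<integral>\<^sup>+X. ?f (z, X) \<partial>distr (distr M T Y) (gauss_mat N K) g)"
      by (simp add: mean_ln_covdet_def)
    also have "\<dots> = (\<integral>\<^sup>+y. ?f (z, g y) \<partial>distr M T Y)"
      by (rule nn_integral_distr) (use fz in auto)
    finally show "(\<integral>\<^sup>+y. ?f (z, g y) \<partial>distr M T Y) = mean_ln_covdet N (\<lambda>j. w j z) K" ..
  qed
  also have "\<dots> = (\<integral>\<^sup>+\<omega>. mean_ln_covdet N (\<lambda>j. w j (Z \<omega>)) K \<partial>M)"
  proof (rule nn_integral_distr[OF Z])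
    interpret GM: prob_space "gauss_mat N K" by (rule prob_space_gauss_mat)
    show "(\<lambda>z. mean_ln_covdet N (\<lambda>j. w j z) K) \<in> borel_measurable (distr M S Z)"
      using GM.borel_measurable_nn_integral_fst[OF f] by (simp add: mean_ln_covdet_def)
  qed
  finally show ?thesis .
qed

text \<open>An instance of \<open>iid_weights\<close> with noise term \<open>z * sigma2\<close>.
  What remains to be shown is that numerators and trace summands are i.i.d. over the users, and that
  the Gaussian matrix can be averaged separately.\<close>

lemma cell_rate_tendsto:
  fixes d :: "nat \<Rightarrow> nat \<Rightarrow> nat \<Rightarrow> 'a \<Rightarrow> real" and G :: "nat \<Rightarrow> nat \<Rightarrow> 'a \<Rightarrow> complex"
  assumes tp: "0 < tp" and sigma2: "0 < sigma2" and beta: "0 < beta" and z: "0 < z" and k: "k < L"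
    and d_rv: "\<And>k l m. k < L \<Longrightarrow> l < L \<Longrightarrow> random_variable borel (d k l m)"
    and d_pos: "\<And>k l m \<omega>. k < L \<Longrightarrow> l < L \<Longrightarrow> \<omega> \<in> space M \<Longrightarrow> 0 < d k l m \<omega>"
    and d_distr: "\<And>k l m. k < L \<Longrightarrow> l < L \<Longrightarrow> distr M borel (d k l m) = distr M borel (d k l 0)"
    and G: "\<And>i j. distributed M lborel (G i j) std_cgauss_density"
    and ind: "indep_vars (\<lambda>_. borel) (all_vars d G) ({(k, l, m). k < L \<and> l < L} <+> UNIV)"
    and c_int: "integrable M (\<lambda>\<omega>. (1 - bcoef tp sigma2 L d k k 0 \<omega>) * (d k k 0 \<omega>)\<^sup>2)"
    and ln_int: "integrable M (\<lambda>\<omega>. ln (1 + bcoef tp sigma2 L d k k 0 \<omega> * (d k k 0 \<omega>)\<^sup>2))"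
  shows "((\<lambda>N. (\<integral>\<omega>. log 2 (Re (det (1\<^sub>m N + Mmat N (nat \<lfloor>beta * real N\<rfloor>) G \<omega> *
            PhiTD tp sigma2 L (nat \<lfloor>beta * real N\<rfloor>) d k z \<omega> * MmatH N (nat \<lfloor>beta * real N\<rfloor>) G \<omega>))) \<partial>M) / real N)
          \<longlongrightarrow> Psi M (ATD M tp sigma2 L d beta k) beta) (ratio_filter beta)"
proof -
  \<comment> \<open>The coefficient b of a user involves its attenuations from all L cells. Weights
    and trace summands are therefore functions of the vector \<open>D m\<close>, and it is this
    vector that is i.i.d. over m.\<close>
  define bb where "bb x = tp * (x k)\<^sup>2 / (sigma2 + tp * (\<Sum>l'<L. (x l')\<^sup>2))" for x :: "nat \<Rightarrow> real"
  define aa where "aa x = bb x * (x k)\<^sup>2" for x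
  define cc where "cc x = (1 - bb x) * (x k)\<^sup>2" for x
  define a where "a m \<omega> = bcoef tp sigma2 L d k k m \<omega> * (d k k m \<omega>)\<^sup>2" for m \<omega>
  define c where "c m \<omega> = (1 - bcoef tp sigma2 L d k k m \<omega>) * (d k k m \<omega>)\<^sup>2" for m \<omega>
  define D where "D m \<omega> = (\<lambda>l\<in>{..<L}. d k l m \<omega>)" for m \<omega>
  define J where "J = {(k, l, m :: nat). k < L \<and> l < L} <+> (UNIV :: (nat \<times> nat) set)"
  let ?X = "all_vars d G"
  let ?DM = "PiM {..<L} (\<lambda>_. borel :: real measure)"
  note ind = ind[folded J_def]
  \<comment> \<open>\<open>D m\<close> is undefined outside {..<L}, so the values may depend on the
    coordinates below L only.\<close>
  have cong: "bb x = bb y" "aa x = aa y" "cc x = cc y" if "\<And>l. l < L \<Longrightarrow> x l = y l" for x y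
  proof -
    have "(\<Sum>l'<L. (x l')\<^sup>2) = (\<Sum>l'<L. (y l')\<^sup>2)" "x k = y k"
      using that k by (auto intro!: sum.cong)
    then show "bb x = bb y" "aa x = aa y" "cc x = cc y"
      unfolding aa_def cc_def bb_def by simp_all
  qed
  have a_eq: "a m \<omega> = aa (\<lambda>l. d k l m \<omega>)" and c_eq: "c m \<omega> = cc (\<lambda>l. d k l m \<omega>)" for m \<omega>
    by (simp_all add: a_def c_def aa_def cc_def bb_def bcoef_def)
  have aD: "a m \<omega> = aa (D m \<omega>)" and cD: "c m \<omega> = cc (D m \<omega>)" for m \<omega>
    unfolding a_eq c_eq by (intro cong; simp add: D_def)+
  have comp: "(\<lambda>x. x l) \<in> borel_measurable ?DM" if "l < L" for l
    using that by (intro measurable_component_singleton) auto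
  have aa_meas [measurable]: "aa \<in> borel_measurable ?DM" and cc_meas [measurable]: "cc \<in> borel_measurable ?DM"
    unfolding aa_def[abs_def] cc_def[abs_def] bb_def[abs_def] using comp k by measurable
  have d_all: "d k l m = (\<lambda>\<omega>. Re (?X (Inl (k, l, m)) \<omega>))" for l m
    by (simp add: all_vars_def)
  have D_indep: "indep_vars (\<lambda>_. ?DM) D UNIV"
  proof -
    let ?K = "\<lambda>m::nat. (\<lambda>l. Inl (k, l, m) :: (nat \<times> nat \<times> nat) + (nat \<times> nat)) ` {..<L}"
    have "indep_vars (\<lambda>m. PiM (?K m) (\<lambda>_. borel)) (\<lambda>m \<omega>. restrict (\<lambda>i. ?X i \<omega>) (?K m)) UNIV"
      using k by (intro indep_vars_restrict[OF ind]) (auto simp: J_def disjoint_family_on_def)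
    then have "indep_vars (\<lambda>_. ?DM) (\<lambda>m \<omega>. \<lambda>l\<in>{..<L}. Re (restrict (\<lambda>i. ?X i \<omega>) (?K m) (Inl (k, l, m)))) UNIV"
    proof (rule indep_vars_compose2[where Y = "\<lambda>m x. \<lambda>l\<in>{..<L}. Re (x (Inl (k, l, m)))"])
      show "(\<lambda>x. \<lambda>l\<in>{..<L}. Re (x (Inl (k, l, m)))) \<in> PiM (?K m) (\<lambda>_. borel) \<rightarrow>\<^sub>M ?DM" for m
        by (intro measurable_restrict measurable_compose[OF measurable_component_singleton]) auto
    qed
    also have "(\<lambda>m \<omega>. \<lambda>l\<in>{..<L}. Re (restrict (\<lambda>i. ?X i \<omega>) (?K m) (Inl (k, l, m)))) = D"
      by (intro ext) (auto simp: D_def restrict_def all_vars_def)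
    finally show ?thesis .
  qed
  have D_rv [measurable]: "random_variable ?DM (D m)" for m
    using D_indep by (auto simp: indep_vars_def)
  \<comment> \<open>Equal marginals give equal vectors only because the attenuations are also
    independent over l: both laws are the product of the marginals.\<close>
  have D_distr: "distr M ?DM (D m) = distr M ?DM (D 0)" for m
  proof -
    have "distr M ?DM (D m) = PiM {..<L} (\<lambda>l. distr M borel (d k l m))" for m
    proof -
      have "indep_vars (\<lambda>_. borel) (\<lambda>l. ?X (Inl (k, l, m))) {..<L}"
        using k indep_vars_reindex[OF ind, of "\<lambda>l. Inl (k, l, m)" "{..<L}"] by (auto simp: inj_on_def J_def)
      then have "indep_vars (\<lambda>_. borel) (\<lambda>l \<omega>. Re (?X (Inl (k, l, m)) \<omega>)) {..<L}"
        by (rule indep_vars_compose2) simp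
      then have "indep_vars (\<lambda>_. borel) (\<lambda>l. d k l m) {..<L}"
        by (simp add: d_all)
      moreover have "{..<L} \<noteq> {}" using k by auto
      ultimately show ?thesis
        using d_rv[OF k] by (subst (asm) indep_vars_iff_distr_eq_PiM') (auto simp: D_def[abs_def])
    qed
    moreover have "PiM {..<L} (\<lambda>l. distr M borel (d k l m)) = PiM {..<L} (\<lambda>l. distr M borel (d k l 0))"
      by (rule PiM_cong, rule refl, rule d_distr[OF k]) simp
    ultimately show ?thesis by simp
  qed
  have iid: "indep_vars (\<lambda>_. borel) (\<lambda>m \<omega>. f (D m \<omega>)) UNIV"
    "distr M borel (\<lambda>\<omega>. f (D m \<omega>)) = distr M borel (\<lambda>\<omega>. f (D 0 \<omega>))"
    if f: "f \<in> borel_measurable ?DM" for f :: "(nat \<Rightarrow> real) \<Rightarrow> real" and m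
  proof -
    show "indep_vars (\<lambda>_. borel) (\<lambda>m \<omega>. f (D m \<omega>)) UNIV"
      by (rule indep_vars_compose2[OF D_indep f])
    have "distr M borel (\<lambda>\<omega>. f (D m \<omega>)) = distr (distr M ?DM (D m)) borel f" for m
      using f by (subst distr_distr) (auto simp: comp_def)
    then show "distr M borel (\<lambda>\<omega>. f (D m \<omega>)) = distr M borel (\<lambda>\<omega>. f (D 0 \<omega>))"
      by (simp add: D_distr[of m])
  qed
  have a_iid: "indep_vars (\<lambda>_. borel) a UNIV" "distr M borel (a m) = distr M borel (a 0)" for m
    using iid[OF aa_meas] by (simp_all add: aD[symmetric])
  have c_iid: "indep_vars (\<lambda>_. borel) c UNIV" "distr M borel (c m) = distr M borel (c 0)" for m
    using iid[OF cc_meas] by (simp_all add: cD[symmetric])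
  have bounds: "0 < bcoef tp sigma2 L d k k m \<omega>" "bcoef tp sigma2 L d k k m \<omega> < 1" if \<omega>: "\<omega> \<in> space M" for m \<omega>
  proof -
    have "(d k k m \<omega>)\<^sup>2 \<le> (\<Sum>l'<L. (d k l' m \<omega>)\<^sup>2)"
      using k by (intro member_le_sum) auto
    then have le: "tp * (d k k m \<omega>)\<^sup>2 \<le> tp * (\<Sum>l'<L. (d k l' m \<omega>)\<^sup>2)"
      using tp by (intro mult_left_mono) auto
    moreover have p: "0 < tp * (d k k m \<omega>)\<^sup>2"
      using tp d_pos[OF k k \<omega>, of m] by simp
    ultimately show "0 < bcoef tp sigma2 L d k k m \<omega>" "bcoef tp sigma2 L d k k m \<omega> < 1"
      using sigma2 unfolding bcoef_def by (auto intro!: divide_pos_pos simp: divide_less_eq_1)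
  qed
  have a_pos: "0 < a m \<omega>" and c_pos: "0 < c m \<omega>" if "\<omega> \<in> space M" for m \<omega>
    using bounds[OF that, of m] d_pos[OF k k that, of m] by (simp_all add: a_def c_def)
  have a_rv [measurable]: "random_variable borel (a m)" for m
    using a_iid(1) by (auto simp: indep_vars_def)
  have c_rv [measurable]: "random_variable borel (c m)" for m
    using c_iid(1) by (auto simp: indep_vars_def)
  have c_int: "integrable M (c 0)" using c_int by (simp add: c_def[abs_def])
  have Ec: "0 < expectation (c 0)"
  proof -
    have "expectation (\<lambda>_. 0) < expectation (c 0)"
      using c_int c_pos by (intro integral_less_AE_space) (auto simp: emeasure_space_1)
    then show ?thesis by simp
  qed
  define A where "A = ATD M tp sigma2 L d beta k"
  have A: "A \<omega> = a 0 \<omega> / (beta * expectation (c 0))" for \<omega>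
    by (simp add: A_def ATD_def a_def c_def[abs_def])
  define \<eta> where "\<eta> = eta_of M A beta"
  have A_rv: "random_variable borel A" unfolding A[abs_def] by measurable
  have \<eta>: "0 < \<eta>" "\<eta> < 1" "beta * (1 - expectation (\<lambda>\<omega>. 1 / (1 + \<eta> * A \<omega>))) = 1 - \<eta>"
    using eta_of_props[OF A_rv _ beta] a_pos Ec beta by (simp_all add: \<eta>_def A)
  interpret W: iid_weights M a c "z * sigma2" beta \<eta>
  proof
    show "integrable M (\<lambda>\<omega>. ln (1 + a 0 \<omega>))" using ln_int by (simp add: a_def)
    show "beta * (1 - expectation (\<lambda>\<omega>. 1 / (1 + \<eta> * (a 0 \<omega> / (beta * expectation (c 0)))))) = 1 - \<eta>"
      using \<eta>(3) by (simp add: A)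
  qed (use a_iid c_iid a_pos c_pos c_int z sigma2 beta \<eta> in auto)
  have G_ind: "indep_vars (\<lambda>_. borel) (\<lambda>(i, j). G i j) UNIV"
  proof -
    have "indep_vars (\<lambda>_. borel) (\<lambda>p. ?X (Inr p)) UNIV"
      using indep_vars_reindex[OF ind, of Inr UNIV] by (auto simp: J_def)
    moreover have "(\<lambda>p. ?X (Inr p)) = (\<lambda>(i, j). G i j)"
      by (auto simp: all_vars_def)
    ultimately show ?thesis by simp
  qed
  have integral_eq: "(\<integral>\<omega>. log 2 (Re (det (1\<^sub>m N + Mmat N K G \<omega> * PhiTD tp sigma2 L K d k z \<omega> * MmatH N K G \<omega>))) \<partial>M) =
      enn2real (W.rate N K) / ln 2" if N: "1 \<le> N" and K: "1 \<le> K" for N K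
  proof -
    let ?w = "\<lambda>\<omega> j. a j \<omega> / W.trc K \<omega>"
    let ?C = "\<lambda>\<omega>. covdet N (?w \<omega>) K (\<lambda>j i. G i j \<omega>)"
    \<comment> \<open>S and T split the index set into attenuations and Gaussian entries. The
      attenuations are stored as complex numbers in the joint family, so \<open>dr\<close> takes
      real parts.\<close>
    define S :: "((nat \<times> nat \<times> nat) + (nat \<times> nat)) set" where "S = Inl ` {(k, l, m). k < L \<and> l < L}"
    define T where "T = range (Inr :: _ \<Rightarrow> (nat \<times> nat \<times> nat) + (nat \<times> nat))"
    define dr where "dr m x l = Re (x (Inl (k, l, m)))" for m l and x :: "(nat \<times> nat \<times> nat) + (nat \<times> nat) \<Rightarrow> complex"
    define w where "w j x = aa (dr j x) / ((\<Sum>m<K. cc (dr m x)) + z * sigma2)" for j x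
    define g where "g x = (\<lambda>j\<in>{..<K}. \<lambda>i\<in>{..<N}. x (Inr (i, j)))" for x :: "(nat \<times> nat \<times> nat) + (nat \<times> nat) \<Rightarrow> complex"
    let ?Z = "\<lambda>\<omega>. restrict (\<lambda>i. ?X i \<omega>) S" and ?Y = "\<lambda>\<omega>. restrict (\<lambda>i. ?X i \<omega>) T"
    have wZ: "w j (?Z \<omega>) = ?w \<omega> j" for j \<omega>
    proof -
      have "dr m (?Z \<omega>) l = d k l m \<omega>" if "l < L" for m l
        using that k by (simp add: dr_def S_def all_vars_def image_iff)
      then have "aa (dr m (?Z \<omega>)) = a m \<omega>" "cc (dr m (?Z \<omega>)) = c m \<omega>" for m
        unfolding a_eq c_eq by (auto intro!: cong)
      then show ?thesis by (simp add: w_def W.trc_def)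
    qed
    have gY: "g (?Y \<omega>) = (\<lambda>j\<in>{..<K}. \<lambda>i\<in>{..<N}. G i j \<omega>)" for \<omega>
      by (intro ext) (simp add: g_def T_def all_vars_def restrict_def)
    have "(\<integral>\<^sup>+\<omega>. ennreal (ln (covdet N (\<lambda>j. w j (?Z \<omega>)) K (g (?Y \<omega>)))) \<partial>M) =
      (\<integral>\<^sup>+\<omega>. mean_ln_covdet N (\<lambda>j. w j (?Z \<omega>)) K \<partial>M)"
    proof (rule mean_ln_covdet_independent[where Z = ?Z and Y = ?Y and w = w and g = g
          and S = "PiM S (\<lambda>_. borel)" and T = "PiM T (\<lambda>_. borel)"])
      show "indep_var (PiM S (\<lambda>_. borel)) ?Z (PiM T (\<lambda>_. borel)) ?Y"
        by (rule indep_var_restrict[OF ind]) (auto simp: S_def T_def J_def)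
      have dr_meas [measurable]: "(\<lambda>x. dr m x l) \<in> borel_measurable (PiM S (\<lambda>_. borel))" if "l < L" for m l
        unfolding dr_def using that k
        by (intro measurable_compose[OF measurable_component_singleton]) (auto simp: S_def)
      have "(\<lambda>x. aa (dr m x)) \<in> borel_measurable (PiM S (\<lambda>_. borel))" "(\<lambda>x. cc (dr m x)) \<in> borel_measurable (PiM S (\<lambda>_. borel))" for m
        unfolding aa_def cc_def bb_def using dr_meas k by measurable
      then show "w j \<in> borel_measurable (PiM S (\<lambda>_. borel))" for j
        unfolding w_def[abs_def] by measurable
      show "g \<in> PiM T (\<lambda>_. borel) \<rightarrow>\<^sub>M gauss_mat N K"
        unfolding g_def[abs_def]
        by (intro measurable_restrict)
           (auto simp: T_def measurable_cong_sets[OF refl sets_cgauss] intro!: measurable_component_singleton)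
      show "distr M (gauss_mat N K) (\<lambda>\<omega>. g (?Y \<omega>)) = gauss_mat N K"
        unfolding gY by (rule gauss_columns[OF G_ind G N K])
    qed
    also have "(\<integral>\<^sup>+\<omega>. mean_ln_covdet N (\<lambda>j. w j (?Z \<omega>)) K \<partial>M) = W.rate N K"
      unfolding wZ W.rate_def ..
    finally have fubini: "(\<integral>\<^sup>+\<omega>. ennreal (ln (covdet N (\<lambda>j. w j (?Z \<omega>)) K (g (?Y \<omega>)))) \<partial>M) = W.rate N K" .
    have "covdet N (\<lambda>j. w j (?Z \<omega>)) K (g (?Y \<omega>)) = ?C \<omega>" for \<omega>
      unfolding wZ gY by (rule covdet_cong) auto
    with fubini have nn: "(\<integral>\<^sup>+\<omega>. ennreal (ln (?C \<omega>)) \<partial>M) = W.rate N K"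
      by (simp only:)
    have C_meas: "random_variable borel ?C"
      using distributed_std_cgauss(1)[OF G] by (intro measurable_covdet) auto
    have C1: "1 \<le> ?C \<omega>" if "\<omega> \<in> space M" for \<omega>
      using a_pos[OF that] W.trc_pos[OF that, of K] by (intro covdet_ge_1) (auto intro: less_imp_le)
    have "Re (det (1\<^sub>m N + Mmat N K G \<omega> * PhiTD tp sigma2 L K d k z \<omega> * MmatH N K G \<omega>)) = ?C \<omega>" for \<omega>
      unfolding det_uplink_eq_covmat covdet_def W.trc_def a_def c_def by simp
    then have "(\<integral>\<omega>. log 2 (Re (det (1\<^sub>m N + Mmat N K G \<omega> * PhiTD tp sigma2 L K d k z \<omega> * MmatH N K G \<omega>))) \<partial>M) =
      (\<integral>\<omega>. ln (?C \<omega>) \<partial>M) / ln 2"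
      by (simp add: log_def)
    \<comment> \<open>Valid without knowing that the mean is finite: in the infinite case both sides
      are 0. Finiteness for large N comes with \<open>rate_upper\<close>.\<close>
    also have "(\<integral>\<omega>. ln (?C \<omega>) \<partial>M) = enn2real (\<integral>\<^sup>+\<omega>. ennreal (ln (?C \<omega>)) \<partial>M)"
      using C_meas C1 by (intro integral_eq_nn_integral) (auto intro!: AE_I2 borel_measurable_ln)
    finally show ?thesis unfolding nn .
  qed
  have Psi: "Psi M A beta = W.limit_value / ln 2"
  proof -
    have "W.V 0 = (\<lambda>\<omega>. ln (1 + \<eta> * A \<omega>))"
      by (simp add: fun_eq_iff W.V_def W.\<theta>_def A)
    then have "(\<integral>\<omega>. log 2 (1 + \<eta> * A \<omega>) \<partial>M) = expectation (W.V 0) / ln 2"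
      by (simp add: log_def)
    then show ?thesis
      unfolding Psi_def Let_def \<eta>_def[symmetric] W.limit_value_def
      by (simp add: log_def add_divide_distrib diff_divide_distrib)
  qed
  have "((\<lambda>N. enn2real (W.rate N (nat \<lfloor>beta * real N\<rfloor>)) / real N / ln 2) \<longlongrightarrow> W.limit_value / ln 2) (ratio_filter beta)"
    by (intro tendsto_intros W.rate_tendsto) auto
  moreover have "\<forall>\<^sub>F N in ratio_filter beta. enn2real (W.rate N (nat \<lfloor>beta * real N\<rfloor>)) / real N / ln 2 =
      (\<integral>\<omega>. log 2 (Re (det (1\<^sub>m N + Mmat N (nat \<lfloor>beta * real N\<rfloor>) G \<omega> *
            PhiTD tp sigma2 L (nat \<lfloor>beta * real N\<rfloor>) d k z \<omega> * MmatH N (nat \<lfloor>beta * real N\<rfloor>) G \<omega>))) \<partial>M) / real N"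
    unfolding ratio_filter_def eventually_inf_principal
    using eventually_ge_at_top[of 1]
  proof eventually_elim
    case (elim N)
    show ?case
    proof
      assume "N \<in> {N. \<exists>K. real K = beta * real N}"
      then obtain K where K: "real K = beta * real N" by blast
      have K': "nat \<lfloor>beta * real N\<rfloor> = K" by (simp flip: K)
      have "0 < real K" using K elim beta by simp
      then have "1 \<le> K" by simp
      then show "enn2real (W.rate N (nat \<lfloor>beta * real N\<rfloor>)) / real N / ln 2 =
        (\<integral>\<omega>. log 2 (Re (det (1\<^sub>m N + Mmat N (nat \<lfloor>beta * real N\<rfloor>) G \<omega> *
            PhiTD tp sigma2 L (nat \<lfloor>beta * real N\<rfloor>) d k z \<omega> * MmatH N (nat \<lfloor>beta * real N\<rfloor>) G \<omega>))) \<partial>M) / real N"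
        unfolding K' integral_eq[OF elim \<open>1 \<le> K\<close>] by simp
    qed
  qed
  ultimately show ?thesis
    unfolding A_def[symmetric] Psi by (rule Lim_transform_eventually)
qed

end

theorem theorem4:
  fixes P :: "'a measure"
    and L :: nat and tau_c tau_p :: nat and sigma2 beta :: real
    and d :: "nat \<Rightarrow> nat \<Rightarrow> nat \<Rightarrow> 'a \<Rightarrow> real"
    and G :: "nat \<Rightarrow> nat \<Rightarrow> 'a \<Rightarrow> complex"
    and zeta :: "nat \<Rightarrow> real"
  assumes "prob_space P"
    and "L \<ge> 1" and "1 \<le> tau_p" and "tau_p \<le> tau_c" and "sigma2 > 0"
    and "beta > 0" and "beta \<in> \<rat>"
    and "\<And>k. k < L \<Longrightarrow> zeta k > 0" and "(\<Sum>k<L. zeta k) = 1"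
    and "\<And>k l m. k < L \<Longrightarrow> l < L \<Longrightarrow> d k l m \<in> borel_measurable P"
    and "\<And>k l m \<omega>. k < L \<Longrightarrow> l < L \<Longrightarrow> \<omega> \<in> space P \<Longrightarrow> d k l m \<omega> > 0"
    and "\<And>k l m. k < L \<Longrightarrow> l < L \<Longrightarrow> distr P borel (d k l m) = distr P borel (d k l 0)"
    and "\<And>i j. distributed P lborel (G i j) std_cgauss_density"
    and "prob_space.indep_vars P (\<lambda>_. borel) (all_vars d G)
           ({(k, l, m). k < L \<and> l < L} <+> UNIV)"
    and "\<And>k. k < L \<Longrightarrow> integrable P (\<lambda>\<omega>.
           (1 - bcoef (real tau_p) sigma2 L d k k 0 \<omega>) * (d k k 0 \<omega>)\<^sup>2)"
    and "\<And>k. k < L \<Longrightarrow> integrable P (\<lambda>\<omega>.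
           ln (1 + bcoef (real tau_p) sigma2 L d k k 0 \<omega> * (d k k 0 \<omega>)\<^sup>2))"
  shows "((\<lambda>N. rTD P (real tau_c) (real tau_p) (real tau_c - real tau_p) sigma2 L d G zeta
                N (nat \<lfloor>beta * real N\<rfloor>))
          \<longlongrightarrow> (real tau_c - real tau_p) / real tau_c * (1 / (real L * beta)) *
                (\<Sum>k<L. zeta k * Psi P (ATD P (real tau_p) sigma2 L d beta k) beta))
         (ratio_filter beta)"
proof -
  interpret prob_space P by (rule assms(1))
  let ?C = "(real tau_c - real tau_p) / real tau_c"
  define I where "I k N = (\<integral>\<omega>. log 2 (Re (det (1\<^sub>m N + Mmat N (nat \<lfloor>beta * real N\<rfloor>) G \<omega> *
      PhiTD (real tau_p) sigma2 L (nat \<lfloor>beta * real N\<rfloor>) d k (zeta k) \<omega> * MmatH N (nat \<lfloor>beta * real N\<rfloor>) G \<omega>))) \<partial>P)" for k N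
  have lim: "((\<lambda>N. I k N / real N) \<longlongrightarrow> Psi P (ATD P (real tau_p) sigma2 L d beta k) beta) (ratio_filter beta)"
    if "k < L" for k
    unfolding I_def
    by (rule cell_rate_tendsto[OF _ assms(5,6) assms(8)[OF that] that assms(10-14) assms(15,16)[OF that]])
       (use assms(3) in simp)
  have "((\<lambda>N. ?C * (1 / (real L * beta)) * (\<Sum>k<L. zeta k * (I k N / real N))) \<longlongrightarrow>
      ?C * (1 / (real L * beta)) * (\<Sum>k<L. zeta k * Psi P (ATD P (real tau_p) sigma2 L d beta k) beta)) (ratio_filter beta)"
    by (intro tendsto_mult tendsto_const tendsto_sum lim) simp
  \<comment> \<open>Along the filter K equals \<beta> N exactly, so 1 / (L K) splits into 1 / (L
    \<beta>) and 1 / N as an identity; at N = 0 both sides are 0 by the convention for division by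
    zero.\<close>
  moreover have "\<forall>\<^sub>F N in ratio_filter beta. ?C * (1 / (real L * beta)) * (\<Sum>k<L. zeta k * (I k N / real N)) =
      rTD P (real tau_c) (real tau_p) (real tau_c - real tau_p) sigma2 L d G zeta N (nat \<lfloor>beta * real N\<rfloor>)"
    unfolding ratio_filter_def eventually_inf_principal
  proof (intro always_eventually allI impI)
    fix N assume "N \<in> {N. \<exists>K. real K = beta * real N}"
    then obtain K where "real K = beta * real N" by blast
    then have K: "real (nat \<lfloor>beta * real N\<rfloor>) = beta * real N" by (metis floor_of_nat nat_int)
    have "(\<Sum>k<L. zeta k * (I k N / real N)) = (\<Sum>k<L. zeta k * I k N) / real N"
      by (simp add: sum_divide_distrib)
    then show "?C * (1 / (real L * beta)) * (\<Sum>k<L. zeta k * (I k N / real N)) =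
        rTD P (real tau_c) (real tau_p) (real tau_c - real tau_p) sigma2 L d G zeta N (nat \<lfloor>beta * real N\<rfloor>)"
      unfolding rTD_def I_def[symmetric] K by simp
  qed
  ultimately show ?thesis by (rule Lim_transform_eventually)
qed

end
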